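(* Let $\{\mathcal F_t^Y\}_{t\ge0}$ be the filtration generated by $\{Y(t)\}_{t\ge0}$, and assume that the process $\{Z(t)\}_{t\ge0}$ in $\Gamma_Z(t)=Z(t)\otimes Y(t)$ is $\mathcal F_t^Y$-adapted. Then for any $f\in H$ and $t\ge0$, $$\mathbb E\left[e^{\mathrm i\langle X(t),f\rangle}\right]=e^{\mathrm i\langle\mathcal S(t)X_0,f\rangle}\,\mathbb E\left[\exp\left(-\frac12\left\langle\left(\int_0^t|Q_B^{1/2}Z(s)|^2\,\mathcal S(t-s)\mathcal V(s)\mathcal S^*(t-s)\,ds\right)f,f\right\rangle\right)\right],$$ where the $ds$-integral on the right-hand side is a Bochner integral in $L(H)$.
   Context: $(\Omega,\mathcal F,\{\mathcal F_t\}_{t\ge0},\mathbb P)$ is a filtered probability space. $H$ is a real separable Hilbert space with inner product $\langle\cdot,\cdot\rangle$ and norm $|\cdot|$; $L(H)$ is the space of bounded linear operators on $H$. For $f,g\in H$ the tensor product is the operator $f\otimes g:=\langle f,\cdot\rangle g$, and $f^{\otimes2}:=f\otimes f$. $\{W(t)\}_{t\ge0}$ and $\{B(t)\}_{t\ge0}$ are independent $H$-valued $\mathcal F_t$-Wiener processes with covariance operators $Q_W$ and $Q_B$ respectively (both symmetric, positive definite, trace class). $\mathcal A$ is a densely defined operator on $H$ generating a $C_0$-semigroup $\{\mathcal U(t)\}_{t\ge0}$, $\eta\in L(H)$, $Y_0\in H$, and $\{Y(t)\}_{t\ge0}$ is the mild solution of $dY(t)=\mathcal AY(t)\,dt+\eta\,dW(t)$,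 $Y(0)=Y_0$, i.e. $Y(t)=\mathcal U(t)Y_0+\int_0^t\mathcal U(t-s)\eta\,dW(s)$. The tensor Heston stochastic variance process is $\mathcal V(t):=Y(t)^{\otimes2}$. $\{Z(t)\}_{t\ge0}$ is an $H$-valued adapted process with $|Z(t)|=1$ for all $t\ge 0$, and $\Gamma_Z(t):=Z(t)\otimes Y(t)$. The processes $Y$ and $Z$ are understood to be measurable in time (predictable), so that stochastic and time integrals involving them make sense. $\mathcal C$ is a densely defined operator on $H$ generating a $C_0$-semigroup $\{\mathcal S(t)\}_{t\ge0}$, $X_0\in H$, and $\{X(t)\}_{t\ge0}$ is the mild solution of $dX(t)=\mathcal CX(t)\,dt+\Gamma_Z(t)\,dB(t)$, $X(0)=X_0$, i.e. $X(t)=\mathcal S(t)X_0+\int_0^t\mathcal S(t-s)\Gamma_Z(s)\,dB(s)$. *)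

theory Defs
  imports "HOL-Probability.Probability"
begin

section \<open>Bounded operators on a real Hilbert space\<close>

lift_definition tensor :: "'h::real_inner \<Rightarrow> 'h \<Rightarrow> 'h \<Rightarrow>\<^sub>L 'h"
  is "\<lambda>f g h. (f \<bullet> h) *\<^sub>R g"
  by (intro bounded_linear_intros)

definition adjoint_op :: "('h::{real_inner, complete_space} \<Rightarrow>\<^sub>L 'h) \<Rightarrow> 'h \<Rightarrow>\<^sub>L 'h" where
  "adjoint_op A = Blinfun (adjoint (blinfun_apply A))"

definition symmetric_op :: "('h::real_inner \<Rightarrow>\<^sub>L 'h) \<Rightarrow> bool" where
  "symmetric_op A \<longleftrightarrow> (\<forall>x y. A x \<bullet> y = x \<bullet> A y)"

definition nonnegative_op :: "('h::real_inner \<Rightarrow>\<^sub>L 'h) \<Rightarrow> bool" where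
  "nonnegative_op A \<longleftrightarrow> (\<forall>x. 0 \<le> A x \<bullet> x)"

definition positive_definite_op :: "('h::real_inner \<Rightarrow>\<^sub>L 'h) \<Rightarrow> bool" where
  "positive_definite_op A \<longleftrightarrow> (\<forall>x. x \<noteq> 0 \<longrightarrow> 0 < A x \<bullet> x)"

(* A symmetric non-negative operator on a Hilbert space has exactly one symmetric
   non-negative square root, so the choice below is no real choice. *)
definition sqrt_op :: "('h::real_inner \<Rightarrow>\<^sub>L 'h) \<Rightarrow> 'h \<Rightarrow>\<^sub>L 'h" where
  "sqrt_op A = (SOME R. symmetric_op R \<and> nonnegative_op R \<and> R o\<^sub>L R = A)"

definition orthonormal_basis :: "'h::real_inner set \<Rightarrow> bool" where
  "orthonormal_basis E \<longleftrightarrow>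
     pairwise orthogonal E \<and> (\<forall>e\<in>E. norm e = 1) \<and> closure (span E) = UNIV"

(* Squared Hilbert-Schmidt norm; the sum does not depend on the orthonormal basis. *)
definition hs_norm_sq :: "('h::real_inner \<Rightarrow>\<^sub>L 'h) \<Rightarrow> ennreal" where
  "hs_norm_sq A =
     (\<integral>\<^sup>+ e. ennreal ((norm (A e))\<^sup>2) \<partial>count_space (SOME E. orthonormal_basis E))"

(* For a symmetric non-negative operator Q, being
   trace class means that the sum of <Q e, e> over one (equivalently, over every)
   orthonormal basis is finite. *)
definition covariance_op :: "('h::real_inner \<Rightarrow>\<^sub>L 'h) \<Rightarrow> bool" where
  "covariance_op Q \<longleftrightarrow> symmetric_op Q \<and> nonnegative_op Q \<and>
     (\<exists>E. orthonormal_basis E \<and> (\<lambda>e. Q e \<bullet> e) summable_on E)"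

section \<open>Strongly continuous semigroups\<close>

definition C0_semigroup :: "(real \<Rightarrow> 'h::real_normed_vector \<Rightarrow>\<^sub>L 'h) \<Rightarrow> bool" where
  "C0_semigroup S \<longleftrightarrow> S 0 = id_blinfun \<and>
     (\<forall>s\<ge>0. \<forall>t\<ge>0. S (s + t) = S s o\<^sub>L S t) \<and>
     (\<forall>x. ((\<lambda>t. S t x) \<longlongrightarrow> x) (at_right 0))"

(* The unbounded operator is given by its domain D together with a function A of which
   only the values on D matter. *)
definition generates_C0_semigroup ::
  "'h set \<Rightarrow> ('h \<Rightarrow> 'h) \<Rightarrow> (real \<Rightarrow> 'h::real_normed_vector \<Rightarrow>\<^sub>L 'h) \<Rightarrow> bool" where
  "generates_C0_semigroup D A S \<longleftrightarrow>
     subspace D \<and> closure D = UNIV \<and>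
     (\<forall>x\<in>D. \<forall>y\<in>D. A (x + y) = A x + A y) \<and> (\<forall>c. \<forall>x\<in>D. A (c *\<^sub>R x) = c *\<^sub>R A x) \<and>
     C0_semigroup S \<and>
     D = {x. \<exists>y. ((\<lambda>h. (S h x - x) /\<^sub>R h) \<longlongrightarrow> y) (at_right 0)} \<and>
     (\<forall>x\<in>D. ((\<lambda>h. (S h x - x) /\<^sub>R h) \<longlongrightarrow> A x) (at_right 0))"

section \<open>Bochner integral in a possibly non-separable normed space\<close>

(* The library's Bochner integral needs a second countable range, which the space of
   bounded operators with the operator norm is not.  Strong measurability is therefore
   part of the definition, as almost everywhere convergence of simple functions. *)
definition has_strong_bochner_integral ::
  "'a measure \<Rightarrow> ('a \<Rightarrow> 'b::real_normed_vector) \<Rightarrow> 'b \<Rightarrow> bool" where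
  "has_strong_bochner_integral M f x \<longleftrightarrow>
     (\<exists>s. (\<forall>i. Bochner_Integration.simple_bochner_integrable M (s i)) \<and>
          (AE y in M. (\<lambda>i. s i y) \<longlonglongrightarrow> f y) \<and>
          (\<lambda>i. \<integral>\<^sup>+ y. ennreal (norm (f y - s i y)) \<partial>M) \<longlonglongrightarrow> 0 \<and>
          (\<lambda>i. Bochner_Integration.simple_bochner_integral M (s i)) \<longlonglongrightarrow> x)"

definition strong_bochner_integrable ::
  "'a measure \<Rightarrow> ('a \<Rightarrow> 'b::real_normed_vector) \<Rightarrow> bool" where
  "strong_bochner_integrable M f \<longleftrightarrow> (\<exists>x. has_strong_bochner_integral M f x)"

definition strong_bochner_integral ::
  "'a measure \<Rightarrow> ('a \<Rightarrow> 'b::real_normed_vector) \<Rightarrow> 'b" where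
  "strong_bochner_integral M f =
     (if strong_bochner_integrable M f then THE x. has_strong_bochner_integral M f x else 0)"

section \<open>Filtrations and processes with time set \<open>[0, \<infinity>)\<close>\<close>

(* Time is of type real throughout; values at negative times are never used. *)

definition filtered_prob_space :: "'a measure \<Rightarrow> (real \<Rightarrow> 'a measure) \<Rightarrow> bool" where
  "filtered_prob_space M F \<longleftrightarrow> prob_space M \<and> (\<forall>t\<ge>0. subalgebra M (F t)) \<and>
     (\<forall>s t. 0 \<le> s \<longrightarrow> s \<le> t \<longrightarrow> sets (F s) \<subseteq> sets (F t))"

definition generated_sigma ::
  "'a measure \<Rightarrow> (real \<Rightarrow> 'a \<Rightarrow> 'h::topological_space) \<Rightarrow> real set \<Rightarrow> 'a measure" where
  "generated_sigma M X I =
     sigma (space M) (\<Union>s\<in>I. {X s -` A \<inter> space M | A. A \<in> sets borel})"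

definition natural_filtration ::
  "'a measure \<Rightarrow> (real \<Rightarrow> 'a \<Rightarrow> 'h::topological_space) \<Rightarrow> real \<Rightarrow> 'a measure" where
  "natural_filtration M X t = generated_sigma M X {0..t}"

definition adapted_process ::
  "(real \<Rightarrow> 'a measure) \<Rightarrow> (real \<Rightarrow> 'a \<Rightarrow> 'h::topological_space) \<Rightarrow> bool" where
  "adapted_process F X \<longleftrightarrow> (\<forall>t\<ge>0. X t \<in> borel_measurable (F t))"

definition predictable_sigma :: "'a measure \<Rightarrow> (real \<Rightarrow> 'a measure) \<Rightarrow> (real \<times> 'a) measure" where
  "predictable_sigma M F = sigma ({0..} \<times> space M)
     ({{s<..t} \<times> A | s t A. 0 \<le> s \<and> s \<le> t \<and> A \<in> sets (F s)} \<union> {{0} \<times> A | A. A \<in> sets (F 0)})"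

definition predictable_process ::
  "'a measure \<Rightarrow> (real \<Rightarrow> 'a measure) \<Rightarrow> (real \<Rightarrow> 'a \<Rightarrow> 'h::topological_space) \<Rightarrow> bool" where
  "predictable_process M F X \<longleftrightarrow>
     (\<lambda>(t, \<omega>). X t \<omega>) \<in> borel_measurable (predictable_sigma M F)"

section \<open>Hilbert space valued Wiener processes and stochastic integrals\<close>

(* Centred Gaussian law with covariance operator C; degenerate directions are allowed. *)
definition centred_gaussian :: "'a measure \<Rightarrow> ('a \<Rightarrow> 'h::real_inner) \<Rightarrow> ('h \<Rightarrow>\<^sub>L 'h) \<Rightarrow> bool" where
  "centred_gaussian M \<xi> C \<longleftrightarrow> \<xi> \<in> borel_measurable M \<and>
     (\<forall>h. distr M borel (\<lambda>\<omega>. \<xi> \<omega> \<bullet> h) =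
        (if C h \<bullet> h = 0 then return borel 0
         else density lborel (\<lambda>x. ennreal (normal_density 0 (sqrt (C h \<bullet> h)) x))))"

definition wiener_process ::
  "'a measure \<Rightarrow> (real \<Rightarrow> 'a measure) \<Rightarrow> ('h::real_inner \<Rightarrow>\<^sub>L 'h) \<Rightarrow> (real \<Rightarrow> 'a \<Rightarrow> 'h) \<Rightarrow> bool" where
  "wiener_process M F Q W \<longleftrightarrow> covariance_op Q \<and> adapted_process F W \<and>
     (AE \<omega> in M. W 0 \<omega> = 0) \<and>
     (AE \<omega> in M. continuous_on {0..} (\<lambda>t. W t \<omega>)) \<and>
     (\<forall>s t. 0 \<le> s \<longrightarrow> s \<le> t \<longrightarrow>
        centred_gaussian M (\<lambda>\<omega>. W t \<omega> - W s \<omega>) ((t - s) *\<^sub>R Q) \<and>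
        prob_space.indep_set M (sets (F s))
          {(\<lambda>\<omega>. W t \<omega> - W s \<omega>) -` A \<inter> space M | A. A \<in> sets borel})"

definition independent_processes ::
  "'a measure \<Rightarrow> (real \<Rightarrow> 'a \<Rightarrow> 'h::topological_space) \<Rightarrow> (real \<Rightarrow> 'a \<Rightarrow> 'h) \<Rightarrow> bool" where
  "independent_processes M X X' \<longleftrightarrow>
     prob_space.indep_set M (sets (generated_sigma M X {0..})) (sets (generated_sigma M X' {0..}))"

(* Elementary integrand on [0,T]: the random operator A i (with finitely many values)
   on the interval from \<tau> i to \<tau> (i + 1), for i < n. *)
definition elementary_data ::
  "(real \<Rightarrow> 'a measure) \<Rightarrow> real \<Rightarrow> nat \<Rightarrow> (nat \<Rightarrow> real) \<Rightarrow>
   (nat \<Rightarrow> 'a \<Rightarrow> 'h::real_normed_vector \<Rightarrow>\<^sub>L 'h) \<Rightarrow> bool" where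
  "elementary_data F T n \<tau> A \<longleftrightarrow> 0 \<le> \<tau> 0 \<and> \<tau> n \<le> T \<and>
     (\<forall>i<n. \<tau> i \<le> \<tau> (Suc i) \<and> simple_function (F (\<tau> i)) (A i))"

definition elementary_integrand ::
  "nat \<Rightarrow> (nat \<Rightarrow> real) \<Rightarrow> (nat \<Rightarrow> 'a \<Rightarrow> 'h::real_normed_vector \<Rightarrow>\<^sub>L 'h) \<Rightarrow> real \<Rightarrow> 'a \<Rightarrow> 'h \<Rightarrow>\<^sub>L 'h" where
  "elementary_integrand n \<tau> A s \<omega> = (\<Sum>i<n. indicator {\<tau> i<..\<tau> (Suc i)} s *\<^sub>R A i \<omega>)"

definition elementary_integral ::
  "(real \<Rightarrow> 'a \<Rightarrow> 'h) \<Rightarrow> nat \<Rightarrow> (nat \<Rightarrow> real) \<Rightarrow> (nat \<Rightarrow> 'a \<Rightarrow> 'h::real_normed_vector \<Rightarrow>\<^sub>L 'h) \<Rightarrow>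
   'a \<Rightarrow> 'h" where
  "elementary_integral W n \<tau> A \<omega> = (\<Sum>i<n. A i \<omega> (W (\<tau> (Suc i)) \<omega> - W (\<tau> i) \<omega>))"

(* I is a version of the Ito integral of \<Phi> over [0,T] with respect to the Q-Wiener process W:
   \<Phi> is predictable on [0,T], and along some elementary integrands that converge to \<Phi> in
     E (integral over [0,T] of the squared Hilbert-Schmidt norm of (...) Q^(1/2)),
   the elementary integrals converge to I in mean square.  By the Ito isometry I is unique
   up to null sets, and the predictable \<Phi> that possess such an I are exactly those for which
   the above quantity, evaluated at \<Phi>, is finite. *)
definition has_stochastic_integral ::
  "'a measure \<Rightarrow> (real \<Rightarrow> 'a measure) \<Rightarrow> ('h::real_inner \<Rightarrow>\<^sub>L 'h) \<Rightarrow> (real \<Rightarrow> 'a \<Rightarrow> 'h) \<Rightarrow> real \<Rightarrow>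
   (real \<Rightarrow> 'a \<Rightarrow> 'h \<Rightarrow>\<^sub>L 'h) \<Rightarrow> ('a \<Rightarrow> 'h) \<Rightarrow> bool" where
  "has_stochastic_integral M F Q W T \<Phi> I \<longleftrightarrow>
     (\<forall>h. predictable_process M F (\<lambda>s \<omega>. indicator {0..T} s *\<^sub>R \<Phi> s \<omega> h)) \<and>
     I \<in> borel_measurable M \<and>
     (\<exists>n \<tau> A. (\<forall>k. elementary_data F T (n k) (\<tau> k) (A k)) \<and>
        (\<lambda>k. \<integral>\<^sup>+ \<omega>. (\<integral>\<^sup>+ s.
            hs_norm_sq ((elementary_integrand (n k) (\<tau> k) (A k) s \<omega> - \<Phi> s \<omega>) o\<^sub>L sqrt_op Q) *
            indicator {0..T} s \<partial>lborel) \<partial>M) \<longlonglongrightarrow> 0 \<and>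
        (\<lambda>k. \<integral>\<^sup>+ \<omega>. ennreal ((norm (elementary_integral W (n k) (\<tau> k) (A k) \<omega> - I \<omega>))\<^sup>2) \<partial>M)
          \<longlonglongrightarrow> 0)"

definition mild_solution ::
  "'a measure \<Rightarrow> (real \<Rightarrow> 'a measure) \<Rightarrow> ('h::real_inner \<Rightarrow>\<^sub>L 'h) \<Rightarrow> (real \<Rightarrow> 'a \<Rightarrow> 'h) \<Rightarrow>
   (real \<Rightarrow> 'h \<Rightarrow>\<^sub>L 'h) \<Rightarrow> (real \<Rightarrow> 'a \<Rightarrow> 'h \<Rightarrow>\<^sub>L 'h) \<Rightarrow> 'h \<Rightarrow> (real \<Rightarrow> 'a \<Rightarrow> 'h) \<Rightarrow> bool" where
  "mild_solution M F Q W S \<Phi> x0 X \<longleftrightarrow> adapted_process F X \<and>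
     (\<forall>t\<ge>0. \<exists>I. has_stochastic_integral M F Q W t (\<lambda>s \<omega>. S (t - s) o\<^sub>L \<Phi> s \<omega>) I \<and>
        (AE \<omega> in M. X t \<omega> = S t x0 + I \<omega>))"

section \<open>The tensor Heston model\<close>

definition heston_variance :: "(real \<Rightarrow> 'a \<Rightarrow> 'h::real_inner) \<Rightarrow> real \<Rightarrow> 'a \<Rightarrow> 'h \<Rightarrow>\<^sub>L 'h" where
  "heston_variance Y t \<omega> = tensor (Y t \<omega>) (Y t \<omega>)"

definition heston_volatility ::
  "(real \<Rightarrow> 'a \<Rightarrow> 'h::real_inner) \<Rightarrow> (real \<Rightarrow> 'a \<Rightarrow> 'h) \<Rightarrow> real \<Rightarrow> 'a \<Rightarrow> 'h \<Rightarrow>\<^sub>L 'h" where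
  "heston_volatility Z Y t \<omega> = tensor (Z t \<omega>) (Y t \<omega>)"

end

theory Submission
  imports Defs
begin

text \<open>Each \<open>Y(s)\<close> is a stochastic integral of a deterministic integrand, hence a limit of linear
  combinations of increments of \<open>W\<close>; so the processes \<open>Y\<close> and \<open>Z\<close> are, up to null sets, measurable with
  respect to \<open>\<sigma>(W)\<close>, which is independent of \<open>B\<close>. Testing with \<open>f\<close> turns the stochastic integral in
  \<open>X(t)\<close> into the scalar integral against \<open>B\<close> of \<open>\<psi>(s) = \<langle>S(t - s)Y(s), f\<rangle> Z(s)\<close>. The elementary
  integrands that approximate \<open>\<psi>\<close> are adapted to a filtration that may be larger than \<open>\<sigma>(W)\<close>. They are
  therefore replaced by step processes that sample \<open>\<psi>\<close> itself on a fine grid with a well chosen offset;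
  by the Ito isometry the integrals of these have the same limit. Given \<open>\<sigma>(W)\<close>, the integral of such a
  step process is a centred Gaussian variable whose variance is the squared \<open>L\<^sup>2\<close> norm of \<open>Q\<^sub>B\<^sup>1\<^sup>/\<^sup>2\<close>
  applied to the process. This gives the formula for step processes, and both sides pass to the limit.\<close>

section \<open>Adjoints and square roots of bounded operators\<close>

text \<open>Two demands compete for the approximating integrands. The Ito isometry wants them
  adapted to \<open>F\<close>, to which B is adapted too; the Gaussian computation wants them frozen
  once \<sigma>(W) is known. The values of \<psi> meet both demands, because they are measurable for
  the natural filtration of Y. But \<psi> is merely measurable in time, so its values on a
  prescribed grid say nothing about its integral. Averaging over the offset repairs this: for some
  offset, the Riemann sum of the error energy between \<psi> and a given elementary integrand is
  controlled by the integral of that energy.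

  No integrability of \<psi> is assumed separately; it is extracted from the existence of the
  stochastic integral that defines X(t). Hilbert-Schmidt norms of random operators are not known to
  be measurable in time and path, so they occur only as majorants under
  \<open>nn_integral\<close>.\<close>

lemma inner_eqI: "(\<And>h. x \<bullet> h = y \<bullet> h) \<Longrightarrow> x = y"
  using vector_eq_rdot by blast

text \<open>Riesz representation by the direct method: the representing vector is the minimiser of
  \<open>J\<close>, and completeness enters through the convergence of a minimising
  sequence.\<close>

lemma bounded_linear_functional_inner:
  fixes \<phi> :: "'h::{real_inner, complete_space} \<Rightarrow> real"
  assumes "bounded_linear \<phi>"
  shows "\<exists>y. \<forall>x. \<phi> x = y \<bullet> x"
proof -
  interpret bounded_linear \<phi> by fact
  define J where "J x = x \<bullet> x / 2 - \<phi> x" for x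
  obtain K where K: "\<And>x. norm (\<phi> x) \<le> norm x * K" using bounded by blast
  have lower: "- (K\<^sup>2 / 2) \<le> J x" for x
  proof -
    have "\<phi> x \<le> norm x * K" using K[of x] by auto
    moreover have "0 \<le> (norm x - K)\<^sup>2" by simp
    ultimately show ?thesis
      by (simp add: J_def power2_norm_eq_inner[symmetric] power2_diff algebra_simps)
  qed
  define m where "m = Inf (range J)"
  have bdd: "bdd_below (range J)" using lower by (auto intro!: bdd_belowI)
  have m_le: "m \<le> J x" for x unfolding m_def by (rule cInf_lower) (auto simp: bdd)
  have "\<exists>x. J x < m + 1 / Suc n" for n
  proof -
    have "Inf (range J) < m + 1 / Suc n" by (simp add: m_def)
    then show ?thesis by (auto simp: cInf_less_iff[OF _ bdd])
  qed
  then obtain y where y: "\<And>n. J (y n) < m + 1 / Suc n" by metis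
  \<comment> \<open>The linear parts of \<open>J\<close> cancel, which leaves the parallelogram
    identity; at the midpoint \<open>J\<close> is at least \<open>m\<close>.\<close>
  have mid: "(norm (y i - y j))\<^sup>2 \<le> 4 * (1 / Suc i + 1 / Suc j)" for i j
  proof -
    have "(norm (y i - y j))\<^sup>2 = 4 * J (y i) + 4 * J (y j) - 8 * J ((1/2) *\<^sub>R (y i + y j))"
      by (simp add: J_def power2_norm_eq_inner add scaleR algebra_simps inner_add_left inner_add_right
          inner_diff_left inner_diff_right inner_commute)
    also have "\<dots> \<le> 4 * (m + 1 / Suc i) + 4 * (m + 1 / Suc j) - 8 * m"
      using less_imp_le[OF y[of i]] less_imp_le[OF y[of j]] m_le[of "(1/2) *\<^sub>R (y i + y j)"]
      by argo
    finally show ?thesis by (simp add: algebra_simps)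
  qed
  have "Cauchy y"
  proof (rule metric_CauchyI)
    fix e :: real assume "0 < e"
    then obtain N where N: "1 / Suc N < e\<^sup>2 / 8"
      using nat_approx_posE[of "e\<^sup>2/8"] by auto
    have "dist (y i) (y j) < e" if "N \<le> i" "N \<le> j" for i j
    proof -
      have "1 / real (Suc i) \<le> 1 / Suc N" "1 / real (Suc j) \<le> 1 / Suc N"
        using that by (auto simp: frac_le)
      then have "(norm (y i - y j))\<^sup>2 < e\<^sup>2" using mid[of i j] N by argo
      then show ?thesis using \<open>0 < e\<close> by (auto simp: dist_norm intro: power2_less_imp_less)
    qed
    then show "\<exists>M. \<forall>m\<ge>M. \<forall>n\<ge>M. dist (y m) (y n) < e" by blast
  qed
  then obtain y0 where y0: "y \<longlonglongrightarrow> y0" by (auto simp: Cauchy_convergent_iff convergent_def)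
  have "(\<lambda>n. J (y n)) \<longlonglongrightarrow> J y0"
    unfolding J_def by (intro tendsto_intros y0 tendsto) simp
  moreover have "(\<lambda>n. m + 1 / Suc n) \<longlonglongrightarrow> m + 0"
    by (intro tendsto_intros LIMSEQ_Suc[OF lim_1_over_n])
  ultimately have J0: "J y0 \<le> m"
    using y by (intro LIMSEQ_le[of "\<lambda>n. J (y n)" _ "\<lambda>n. m + 1 / Suc n"]) (auto intro: less_imp_le)
  have "\<phi> z = y0 \<bullet> z" for z
  proof -
    define b where "b = y0 \<bullet> z - \<phi> z"
    \<comment> \<open>Minimality along the line through \<open>y0\<close> in direction
      \<open>z\<close>. The slope \<open>b\<close> must vanish, as the minimiser
      \<open>- b / (z \<bullet> z)\<close> of this quadratic shows.\<close>
    have *: "0 \<le> t * b + t\<^sup>2 / 2 * (z \<bullet> z)" for t :: real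
    proof -
      have "J (y0 + t *\<^sub>R z) = J y0 + t * b + t\<^sup>2 / 2 * (z \<bullet> z)"
        by (simp add: J_def b_def add scaleR power2_eq_square algebra_simps inner_add_left inner_add_right inner_commute)
      then show ?thesis using m_le[of "y0 + t *\<^sub>R z"] J0 by linarith
    qed
    show ?thesis
    proof (cases "z = 0")
      case False
      have "0 \<le> - (b\<^sup>2) / (2 * (z \<bullet> z))"
        using *[of "- b / (z \<bullet> z)"] False by (simp add: power2_eq_square field_simps)
      then have "b\<^sup>2 \<le> 0" using False by (simp add: field_simps zero_le_divide_iff)
      then show ?thesis by (simp add: b_def)
    qed (simp add: zero)
  qed
  then show ?thesis by blast
qed

text \<open>\<open>adjoint\<close> picks some function with the defining identity, so one has to be
  exhibited first, by Riesz, and shown to be bounded before \<open>Blinfun\<close> can be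
  evaluated.\<close>

lemma adjoint_op_inner:
  fixes A :: "'h::{real_inner, complete_space} \<Rightarrow>\<^sub>L 'h"
  shows "adjoint_op A x \<bullet> y = x \<bullet> A y"
proof -
  have "\<exists>z. \<forall>y. x \<bullet> A y = z \<bullet> y" for x
    by (intro bounded_linear_functional_inner bounded_linear_compose[OF bounded_linear_inner_right] blinfun.bounded_linear_right)
  then obtain A' where A': "\<And>x y. x \<bullet> A y = A' x \<bullet> y" by metis
  have "bounded_linear A'"
  proof (rule bounded_linear_intro[where K="norm A"])
    fix x y r
    show "A' (x + y) = A' x + A' y" by (rule inner_eqI) (simp add: inner_add_left A'[symmetric])
    show "A' (r *\<^sub>R x) = r *\<^sub>R A' x" by (rule inner_eqI) (simp add: A'[symmetric])
    have "norm (A' x) * norm (A' x) = x \<bullet> A (A' x)"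
      by (simp add: A' power2_norm_eq_inner[symmetric] power2_eq_square)
    also have "\<dots> \<le> norm x * (norm A * norm (A' x))"
      by (rule order_trans[OF norm_cauchy_schwarz]) (intro mult_left_mono norm_blinfun norm_ge_zero)
    finally show "norm (A' x) \<le> norm x * norm A"
      by (cases "A' x = 0") auto
  qed
  moreover have "adjoint (blinfun_apply A) = A'"
    by (rule adjoint_unique) (metis A' inner_commute)
  ultimately show ?thesis
    by (simp add: adjoint_op_def bounded_linear_Blinfun_apply A')
qed

lemma adjoint_op_sum:
  fixes D :: "'i \<Rightarrow> 'h::{real_inner, complete_space} \<Rightarrow>\<^sub>L 'h"
  shows "adjoint_op (\<Sum>i\<in>I. c i *\<^sub>R D i) f = (\<Sum>i\<in>I. c i *\<^sub>R adjoint_op (D i) f)"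
  by (rule inner_eqI)
     (simp add: adjoint_op_inner blinfun.sum_left blinfun.scaleR_left inner_sum_left inner_sum_right)

lemma adjoint_op_diff:
  fixes D :: "'h::{real_inner, complete_space} \<Rightarrow>\<^sub>L 'h"
  shows "adjoint_op (D - D') f = adjoint_op D f - adjoint_op D' f"
  by (rule inner_eqI) (simp add: adjoint_op_inner blinfun.diff_left inner_diff_left inner_diff_right)

text \<open>Tested with \<open>f\<close>, the operator integrand of X becomes a random multiple of
  Z(s); with D = S(t - s) and y = Y(s) this is the \<psi> of the overview.\<close>

lemma adjoint_op_compose_tensor:
  fixes D :: "'h::{real_inner, complete_space} \<Rightarrow>\<^sub>L 'h"
  shows "adjoint_op (D o\<^sub>L tensor z y) f = (D y \<bullet> f) *\<^sub>R z"
proof (rule inner_eqI)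
  fix h
  show "adjoint_op (D o\<^sub>L tensor z y) f \<bullet> h = ((D y \<bullet> f) *\<^sub>R z) \<bullet> h"
    unfolding adjoint_op_inner by (simp add: tensor.rep_eq blinfun.scaleR_right inner_commute[of f])
qed

text \<open>This writes the Bochner integrand as the tensor square of a single vector, so that
  integrability in operator norm becomes square integrability of a vector function.\<close>

lemma scaled_conjugated_tensor:
  fixes D :: "'h::{real_inner, complete_space} \<Rightarrow>\<^sub>L 'h"
  shows "r\<^sup>2 *\<^sub>R (D o\<^sub>L tensor y y o\<^sub>L adjoint_op D) = tensor (r *\<^sub>R D y) (r *\<^sub>R D y)"
  by (rule blinfun_eqI)
     (simp add: tensor.rep_eq blinfun.scaleR_left blinfun.scaleR_right power2_eq_square
        inner_commute[of y] adjoint_op_inner inner_commute[of _ "D y"])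

section \<open>Square roots of symmetric nonnegative operators\<close>

lemma symmetric_op_norm_le_one:
  fixes A :: "'h::real_inner \<Rightarrow>\<^sub>L 'h"
  assumes sym: "symmetric_op A" and bnd: "\<And>x. \<bar>A x \<bullet> x\<bar> \<le> x \<bullet> x"
  shows "norm (A x) \<le> norm x"
proof (cases "A x = 0 \<or> x = 0")
  case False
  have S: "A x \<bullet> y = x \<bullet> A y" for x y using sym by (auto simp: symmetric_op_def)
  have pol: "4 * (A x \<bullet> y) \<le> 2 * (x \<bullet> x + y \<bullet> y)" for x y
  proof -
    have "4 * (A x \<bullet> y) = A (x + y) \<bullet> (x + y) - A (x - y) \<bullet> (x - y)"
      using S[of x y] S[of y x]
      by (simp add: blinfun.add_right blinfun.diff_right algebra_simps inner_add_left inner_add_right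
          inner_diff_left inner_diff_right inner_commute)
    also have "\<dots> \<le> (x + y) \<bullet> (x + y) + (x - y) \<bullet> (x - y)"
      using bnd[of "x + y"] bnd[of "x - y"] by linarith
    also have "\<dots> = 2 * (x \<bullet> x + y \<bullet> y)"
      by (simp add: algebra_simps inner_add_left inner_add_right inner_diff_left inner_diff_right inner_commute)
    finally show ?thesis .
  qed
  \<comment> \<open>Polarisation bounds \<open>A x \<bullet> y\<close>; the vector with the length
    of \<open>x\<close> and the direction of \<open>A x\<close> turns this into a bound for
    \<open>norm (A x)\<close>.\<close>
  define y where "y = (norm x / norm (A x)) *\<^sub>R A x"
  have "y \<bullet> y = x \<bullet> x" using False by (simp add: y_def dot_square_norm power2_eq_square)
  moreover have "A x \<bullet> y = norm x * norm (A x)" using False by (simp add: y_def dot_square_norm power2_eq_square)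
  ultimately have "4 * (norm x * norm (A x)) \<le> 4 * (norm x * norm x)"
    using pol[of x y] by (simp add: dot_square_norm power2_eq_square)
  then show ?thesis using False by simp
qed auto

text \<open>The iteration \<open>X\<^sub>n\<^sub>+\<^sub>1 = (A + X\<^sub>n\<^sup>2)/2\<close> with \<open>A = I - Q\<close> is dominated in norm by the scalar
  iteration with \<open>A = 1\<close>, so it converges; its limit \<open>X\<close> satisfies \<open>(I - X)\<^sup>2 = Q\<close>.\<close>

fun sqrt_iter :: "('h::real_inner \<Rightarrow>\<^sub>L 'h) \<Rightarrow> nat \<Rightarrow> 'h \<Rightarrow>\<^sub>L 'h" where
  "sqrt_iter A 0 = 0"
| "sqrt_iter A (Suc n) = (1/2) *\<^sub>R (A + (sqrt_iter A n o\<^sub>L sqrt_iter A n))"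

fun sqrt_iter_real :: "nat \<Rightarrow> real" where
  "sqrt_iter_real 0 = 0"
| "sqrt_iter_real (Suc n) = (1 + (sqrt_iter_real n)\<^sup>2) / 2"

lemma sqrt_iter_real_bounds: "0 \<le> sqrt_iter_real n \<and> sqrt_iter_real n \<le> 1"
  by (induction n) (auto simp: power_le_one add_nonneg_nonneg)

lemma sqrt_iter_real_mono: "sqrt_iter_real n \<le> sqrt_iter_real (Suc n)"
proof -
  have "0 \<le> (1 - sqrt_iter_real n)\<^sup>2" by simp
  then show ?thesis by (simp add: power2_diff)
qed

lemma norm_sqrt_iter:
  assumes A: "norm A \<le> 1"
  shows "norm (sqrt_iter A n) \<le> sqrt_iter_real n"
proof (induction n)
  case (Suc n)
  have "norm (A + (sqrt_iter A n o\<^sub>L sqrt_iter A n)) \<le> 1 + (sqrt_iter_real n)\<^sup>2"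
    using A Suc norm_blinfun_compose[of "sqrt_iter A n" "sqrt_iter A n"]
    by (intro norm_triangle_mono order_trans[OF norm_blinfun_compose])
       (auto simp: power2_eq_square sqrt_iter_real_bounds intro!: mult_mono)
  then show ?case by simp
qed simp

lemma norm_sqrt_iter_diff_Suc:
  assumes A: "norm A \<le> 1"
  shows "norm (sqrt_iter A (Suc n) - sqrt_iter A n) \<le> sqrt_iter_real (Suc n) - sqrt_iter_real n"
proof (induction n)
  case 0
  then show ?case using A by simp
next
  case (Suc n)
  define X where "X = sqrt_iter A (Suc n)"
  define Y where "Y = sqrt_iter A n"
  define x where "x = sqrt_iter_real (Suc n)"
  define y where "y = sqrt_iter_real n"
  have b: "norm X \<le> x" "norm Y \<le> y" "norm (X - Y) \<le> x - y" "0 \<le> x" "0 \<le> y"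
    using norm_sqrt_iter[OF A] Suc sqrt_iter_real_bounds
    unfolding X_def Y_def x_def y_def by blast+
  \<comment> \<open>The splitting respects the order of the factors, so no commutation is involved;
    the bounds of the two terms add up to \<open>x\<^sup>2 - y\<^sup>2\<close>, twice the scalar
    increment.\<close>
  have "(X o\<^sub>L X) - (Y o\<^sub>L Y) = (X o\<^sub>L (X - Y)) + ((X - Y) o\<^sub>L Y)"
    by (rule blinfun_eqI) (simp add: blinfun.diff_right blinfun.diff_left blinfun.add_left)
  moreover have "norm (X o\<^sub>L (X - Y)) \<le> x * (x - y)"
    by (rule order_trans[OF norm_blinfun_compose]) (intro mult_mono b norm_ge_zero)
  moreover have "norm ((X - Y) o\<^sub>L Y) \<le> (x - y) * y"
    by (rule order_trans[OF norm_blinfun_compose]) (use b order_trans[OF norm_ge_zero b(3)] in \<open>intro mult_mono norm_ge_zero, auto\<close>)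
  ultimately have D: "norm ((X o\<^sub>L X) - (Y o\<^sub>L Y)) \<le> x * (x - y) + (x - y) * y"
    by (metis norm_triangle_mono)
  have e1: "sqrt_iter A (Suc (Suc n)) - sqrt_iter A (Suc n) = (1/2) *\<^sub>R ((X o\<^sub>L X) - (Y o\<^sub>L Y))"
    unfolding X_def Y_def by (subst (1 2) sqrt_iter.simps(2)) (simp only: scaleR_diff_right scaleR_add_right add_diff_cancel_left)
  have e2: "sqrt_iter_real (Suc (Suc n)) - sqrt_iter_real (Suc n) = (x\<^sup>2 - y\<^sup>2) / 2"
    unfolding x_def y_def by (subst (1 2) sqrt_iter_real.simps(2)) (simp only: diff_divide_distrib add_divide_distrib)
  from D have "norm ((1/2) *\<^sub>R ((X o\<^sub>L X) - (Y o\<^sub>L Y))) \<le> (x * (x - y) + (x - y) * y) / 2"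
    unfolding norm_scaleR by argo
  also have "\<dots> = (x\<^sup>2 - y\<^sup>2) / 2" by (simp add: power2_eq_square algebra_simps)
  finally show ?case unfolding e1 e2 .
qed

lemma sqrt_iter_real_le:
  assumes "m \<le> n"
  shows "sqrt_iter_real m \<le> sqrt_iter_real n"
  using sqrt_iter_real_mono assms by (rule lift_Suc_mono_le)

lemma norm_sqrt_iter_diff:
  assumes A: "norm A \<le> 1" and "m \<le> n"
  shows "norm (sqrt_iter A n - sqrt_iter A m) \<le> sqrt_iter_real n - sqrt_iter_real m"
  using \<open>m \<le> n\<close>
proof (induction rule: dec_induct)
  case (step n)
  have "sqrt_iter A (Suc n) - sqrt_iter A m =
      (sqrt_iter A (Suc n) - sqrt_iter A n) + (sqrt_iter A n - sqrt_iter A m)" by simp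
  then have "norm (sqrt_iter A (Suc n) - sqrt_iter A m) \<le>
      (sqrt_iter_real (Suc n) - sqrt_iter_real n) + (sqrt_iter_real n - sqrt_iter_real m)"
    using norm_sqrt_iter_diff_Suc[OF A, of n] step by (metis norm_triangle_mono)
  then show ?case by linarith
qed simp

lemma sqrt_iter_symmetric: "symmetric_op A \<Longrightarrow> symmetric_op (sqrt_iter A n)"
  by (induction n)
     (auto simp: symmetric_op_def blinfun.add_left blinfun.scaleR_left inner_add_left inner_add_right)

text \<open>The library has this only for a codomain of class \<open>banach\<close>, which the sort
  \<open>{real_inner, complete_space}\<close> does not entail.\<close>

lemma Cauchy_blinfun_convergent:
  fixes X :: "nat \<Rightarrow> 'a::real_normed_vector \<Rightarrow>\<^sub>L 'b::{real_normed_vector, complete_space}"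
  assumes X: "Cauchy X"
  shows "\<exists>L. X \<longlonglongrightarrow> L"
proof -
  have diff: "norm (X n z - X m z) \<le> norm (X n - X m) * norm z" for n m z
    by (metis blinfun.diff_left norm_blinfun)
  have "Cauchy (\<lambda>n. X n z)" for z
  proof (rule CauchyI)
    fix e :: real assume "0 < e"
    define d where "d = e / (norm z + 1)"
    have d: "0 < d" "d * (norm z + 1) = e"
      using \<open>0 < e\<close> norm_ge_zero[of z] by (auto simp: d_def simp del: norm_ge_zero intro!: divide_pos_pos)
    from CauchyD[OF X d(1)] obtain N where N: "\<And>m n. N \<le> m \<Longrightarrow> N \<le> n \<Longrightarrow> norm (X m - X n) < d" by auto
    have "norm (X m z - X n z) < e" if "N \<le> m" "N \<le> n" for m n
    proof -
      have "norm (X m z - X n z) \<le> d * norm z"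
        using diff[of m z n] N[OF that] by (meson less_imp_le mult_right_mono norm_ge_zero order_trans)
      also have "\<dots> < d * (norm z + 1)" using d(1) by simp
      finally show ?thesis by (simp only: d(2))
    qed
    then show "\<exists>M. \<forall>m\<ge>M. \<forall>n\<ge>M. norm (X m z - X n z) < e" by blast
  qed
  then obtain L where L: "\<And>z. (\<lambda>n. X n z) \<longlonglongrightarrow> L z"
    unfolding Cauchy_convergent_iff convergent_def by metis
  obtain K where K: "\<And>n. norm (X n) \<le> K"
    using Cauchy_Bseq[OF X] by (auto simp: Bseq_def)
  have "bounded_linear L"
  proof (rule bounded_linear_intro[where K=K])
    fix x y r
    show "L (x + y) = L x + L y"
      using tendsto_add[OF L[of x] L[of y]] L[of "x + y"]
      by (simp add: blinfun.add_right LIMSEQ_unique)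
    show "L (r *\<^sub>R x) = r *\<^sub>R L x"
      using tendsto_scaleR[OF tendsto_const L[of x], of r] L[of "r *\<^sub>R x"]
      by (simp add: blinfun.scaleR_right LIMSEQ_unique)
    have "norm (X n x) \<le> norm x * K" for n
      using order_trans[OF norm_blinfun mult_right_mono[OF K norm_ge_zero]] by (simp add: mult.commute)
    then show "norm (L x) \<le> norm x * K"
      using LIMSEQ_le_const2[OF tendsto_norm[OF L[of x]]] by auto
  qed
  then obtain B where B: "\<And>z. blinfun_apply B z = L z" by (metis bounded_linear_Blinfun_apply)
  have "X \<longlonglongrightarrow> B"
  proof (rule LIMSEQ_I)
    fix e :: real assume "0 < e"
    then have "0 < e / 2" by simp
    from CauchyD[OF X this] obtain N where N: "\<And>m n. N \<le> m \<Longrightarrow> N \<le> n \<Longrightarrow> norm (X m - X n) < e / 2" by auto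
    have "norm (X n - B) < e" if "N \<le> n" for n
    proof -
      have "norm ((X n - B) z) \<le> e / 2 * norm z" for z
      proof (rule LIMSEQ_le_const2)
        show "(\<lambda>m. norm (X n z - X m z)) \<longlonglongrightarrow> norm ((X n - B) z)"
          unfolding blinfun.diff_left B by (rule tendsto_norm[OF tendsto_diff[OF tendsto_const L]])
        have "norm (X n z - X m z) \<le> e / 2 * norm z" if "N \<le> m" for m
          using diff[of n z m] N[OF \<open>N \<le> n\<close> that] by (meson less_imp_le mult_right_mono norm_ge_zero order_trans)
        then show "\<exists>M. \<forall>m\<ge>M. norm (X n z - X m z) \<le> e / 2 * norm z" by blast
      qed
      then have "norm (X n - B) \<le> e / 2" using \<open>0 < e\<close> by (intro norm_blinfun_bound) auto
      then show ?thesis using \<open>0 < e\<close> by linarith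
    qed
    then show "\<exists>no. \<forall>n\<ge>no. norm (X n - B) < e" by blast
  qed
  then show ?thesis by blast
qed

lemma symmetric_op_one_minus_sqrt:
  fixes A :: "'h::{real_inner, complete_space} \<Rightarrow>\<^sub>L 'h"
  assumes sym: "symmetric_op A" and A: "norm A \<le> 1"
  shows "\<exists>R. symmetric_op R \<and> nonnegative_op R \<and> R o\<^sub>L R = id_blinfun - A"
proof -
  define X where "X = sqrt_iter A"
  have "convergent sqrt_iter_real"
  proof (rule Bseq_mono_convergent)
    show "Bseq sqrt_iter_real" by (rule BseqI'[where K=1]) (use sqrt_iter_real_bounds in auto)
  qed (use sqrt_iter_real_le in auto)
  then have C: "Cauchy sqrt_iter_real" by (rule convergent_Cauchy)
  have diff: "norm (X n - X m) \<le> \<bar>sqrt_iter_real n - sqrt_iter_real m\<bar>" for n m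
  proof (cases "m \<le> n")
    case True
    then show ?thesis using norm_sqrt_iter_diff[OF A True] by (simp add: X_def)
  next
    case False
    then show ?thesis using norm_sqrt_iter_diff[OF A, of n m] by (simp add: X_def norm_minus_commute)
  qed
  have "Cauchy X"
  proof (rule CauchyI)
    fix e :: real assume "0 < e"
    from CauchyD[OF C this] obtain N where "\<And>m n. N \<le> m \<Longrightarrow> N \<le> n \<Longrightarrow> \<bar>sqrt_iter_real m - sqrt_iter_real n\<bar> < e"
      by (auto simp only: real_norm_def)
    then show "\<exists>M. \<forall>m\<ge>M. \<forall>n\<ge>M. norm (X m - X n) < e"
      using diff order_le_less_trans by blast
  qed
  then obtain B where B: "X \<longlonglongrightarrow> B" using Cauchy_blinfun_convergent by blast
  have LB: "(\<lambda>n. X n z) \<longlonglongrightarrow> B z" for z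
    by (rule blinfun.tendsto[OF B tendsto_const])
  have "norm (X n) \<le> 1" for n
    using norm_sqrt_iter[OF A, of n] sqrt_iter_real_bounds[of n] unfolding X_def by linarith
  then have nB: "norm B \<le> 1"
    using LIMSEQ_le_const2[OF tendsto_norm[OF B]] by auto
  have B1: "norm (B z) \<le> norm z" for z
    using norm_blinfun[of B z] nB by (meson mult_left_le_one_le norm_ge_zero order_trans)
  have symB: "B x \<bullet> y = x \<bullet> B y" for x y
  proof -
    have "(\<lambda>n. X n x \<bullet> y) \<longlonglongrightarrow> B x \<bullet> y" "(\<lambda>n. x \<bullet> X n y) \<longlonglongrightarrow> x \<bullet> B y"
      by (intro tendsto_intros LB)+
    moreover have "X n x \<bullet> y = x \<bullet> X n y" for n
      using sqrt_iter_symmetric[OF sym, of n] by (auto simp: X_def symmetric_op_def)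
    ultimately show ?thesis by (simp add: LIMSEQ_unique)
  qed
  have "(\<lambda>n. X (Suc n)) \<longlonglongrightarrow> (1/2) *\<^sub>R (A + (B o\<^sub>L B))"
    unfolding X_def sqrt_iter.simps
    by (rule tendsto_scaleR[OF tendsto_const tendsto_add[OF tendsto_const
          bounded_bilinear.tendsto[OF bounded_bilinear_blinfun_compose B[unfolded X_def] B[unfolded X_def]]]])
  from LIMSEQ_unique[OF LIMSEQ_Suc[OF B] this] have fix_eq: "B = (1/2) *\<^sub>R (A + (B o\<^sub>L B))" .
  have fix_eq: "2 *\<^sub>R B z = A z + B (B z)" for z
  proof -
    have "2 *\<^sub>R B z = 2 *\<^sub>R ((1/2) *\<^sub>R (A + (B o\<^sub>L B))) z" by (subst (1) fix_eq) rule
    then show ?thesis by (simp add: blinfun.scaleR_left blinfun.add_left)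
  qed
  define R where "R = id_blinfun - B"
  have "symmetric_op R"
    by (auto simp: symmetric_op_def R_def blinfun.diff_left inner_diff_left inner_diff_right symB)
  moreover have "nonnegative_op R"
  proof -
    have "B x \<bullet> x \<le> x \<bullet> x" for x
      using norm_cauchy_schwarz[of "B x" x] B1[of x]
      by (smt (verit) dot_square_norm mult_right_mono norm_ge_zero power2_eq_square)
    then show ?thesis by (auto simp: nonnegative_op_def R_def blinfun.diff_left inner_diff_left)
  qed
  moreover have "R o\<^sub>L R = id_blinfun - A"
  proof (rule blinfun_eqI)
    fix z
    have "(R o\<^sub>L R) z = z - 2 *\<^sub>R B z + B (B z)"
      by (simp add: R_def blinfun.diff_left blinfun.diff_right scaleR_2)
    then show "(R o\<^sub>L R) z = (id_blinfun - A) z"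
      by (simp add: fix_eq blinfun.diff_left)
  qed
  ultimately show ?thesis by blast
qed

lemma sqrt_op_ex:
  fixes Q :: "'h::{real_inner, complete_space} \<Rightarrow>\<^sub>L 'h"
  assumes sym: "symmetric_op Q" and nonneg: "nonnegative_op Q"
  shows "\<exists>R. symmetric_op R \<and> nonnegative_op R \<and> R o\<^sub>L R = Q"
proof -
  \<comment> \<open>Dividing by \<open>c\<close> brings the quadratic form of Q between 0 and that
    of the identity; the summand 1 keeps \<open>c\<close> positive when Q = 0. The root is rescaled
    by \<open>sqrt c\<close> at the end.\<close>
  define c where "c = norm Q + 1"
  have c: "0 < c" by (simp add: c_def add_nonneg_pos)
  define A where "A = id_blinfun - (1 / c) *\<^sub>R Q"
  have symA: "symmetric_op A"
    using sym by (auto simp: symmetric_op_def A_def blinfun.diff_left blinfun.scaleR_left inner_diff_left inner_diff_right)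
  have "\<bar>A x \<bullet> x\<bar> \<le> x \<bullet> x" for x
  proof -
    have "Q x \<bullet> x \<le> norm (Q x) * norm x" by (rule norm_cauchy_schwarz)
    also have "\<dots> \<le> (norm Q * norm x) * norm x" by (intro mult_right_mono norm_blinfun norm_ge_zero)
    also have "\<dots> = norm Q * (x \<bullet> x)" by (simp add: dot_square_norm power2_eq_square)
    also have "\<dots> \<le> c * (x \<bullet> x)" by (simp add: c_def mult_right_mono)
    finally have "Q x \<bullet> x / c \<le> x \<bullet> x" using c by (simp add: field_simps)
    moreover have "0 \<le> Q x \<bullet> x / c" using nonneg c by (auto simp: nonnegative_op_def)
    moreover have "A x \<bullet> x = x \<bullet> x - Q x \<bullet> x / c"
      by (simp add: A_def blinfun.diff_left blinfun.scaleR_left inner_diff_left)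
    ultimately show ?thesis using inner_ge_zero[of x] by linarith
  qed
  then have "norm (A x) \<le> norm x" for x by (rule symmetric_op_norm_le_one[OF symA])
  then have "norm A \<le> 1" by (intro norm_blinfun_bound) auto
  from symmetric_op_one_minus_sqrt[OF symA this]
  obtain R where R: "symmetric_op R" "nonnegative_op R" "R o\<^sub>L R = (1 / c) *\<^sub>R Q"
    by (auto simp: A_def)
  define R' where "R' = sqrt c *\<^sub>R R"
  have "R' o\<^sub>L R' = Q"
  proof (rule blinfun_eqI)
    fix x
    have "(R' o\<^sub>L R') x = c *\<^sub>R (R o\<^sub>L R) x"
      using c by (simp add: R'_def blinfun.scaleR_left blinfun.scaleR_right)
    then show "(R' o\<^sub>L R') x = Q x" using c by (simp only: R(3)) (simp add: blinfun.scaleR_left)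
  qed
  moreover have "symmetric_op R'" "nonnegative_op R'"
    using R c by (auto simp: R'_def symmetric_op_def nonnegative_op_def blinfun.scaleR_left)
  ultimately show ?thesis by blast
qed

lemma
  fixes Q :: "'h::{real_inner, complete_space} \<Rightarrow>\<^sub>L 'h"
  assumes "covariance_op Q"
  shows sqrt_op_symmetric: "sqrt_op Q x \<bullet> y = x \<bullet> sqrt_op Q y"
    and sqrt_op_inner: "sqrt_op Q x \<bullet> sqrt_op Q y = Q x \<bullet> y"
proof -
  have *: "symmetric_op (sqrt_op Q) \<and> nonnegative_op (sqrt_op Q) \<and> sqrt_op Q o\<^sub>L sqrt_op Q = Q"
    unfolding sqrt_op_def by (rule someI_ex, rule sqrt_op_ex) (use assms in \<open>auto simp: covariance_op_def\<close>)
  then show sym: "sqrt_op Q x \<bullet> y = x \<bullet> sqrt_op Q y" for x y by (auto simp: symmetric_op_def)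
  have "sqrt_op Q (sqrt_op Q x) = Q x" using * by (metis blinfun_apply_blinfun_compose)
  then show "sqrt_op Q x \<bullet> sqrt_op Q y = Q x \<bullet> y" using sym by metis
qed

section \<open>Orthonormal bases and Hilbert-Schmidt norms\<close>

text \<open>Unlike \<open>nn_integral_cmult\<close> this needs no measurability of the majorant.\<close>

lemma nn_integral_le_cmultI:
  assumes [measurable]: "f \<in> borel_measurable M" and c: "0 \<le> c"
    and le: "\<And>x. x \<in> space M \<Longrightarrow> f x \<le> ennreal c * g x"
  shows "(\<integral>\<^sup>+ x. f x \<partial>M) \<le> ennreal c * (\<integral>\<^sup>+ x. g x \<partial>M)"
proof (cases "c = 0")
  case True
  then have "(\<integral>\<^sup>+ x. f x \<partial>M) = (\<integral>\<^sup>+ x. 0 \<partial>M)" using le by (intro nn_integral_cong) auto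
  then show ?thesis by simp
next
  case False
  with c have c: "0 < c" by simp
  have inv: "ennreal c * ennreal (1 / c) = 1"
    using c by (subst ennreal_mult[symmetric]) auto
  have "ennreal (1 / c) * (\<integral>\<^sup>+ x. f x \<partial>M) = (\<integral>\<^sup>+ x. ennreal (1 / c) * f x \<partial>M)"
    by (rule nn_integral_cmult[symmetric]) measurable
  also have "\<dots> \<le> (\<integral>\<^sup>+ x. g x \<partial>M)"
  proof (rule nn_integral_mono)
    fix x assume "x \<in> space M"
    then have "ennreal (1 / c) * f x \<le> ennreal (1 / c) * (ennreal c * g x)"
      by (intro mult_left_mono le) auto
    then show "ennreal (1 / c) * f x \<le> g x"
      using inv by (simp add: mult.assoc[symmetric] mult.commute)
  qed
  finally have "ennreal c * (ennreal (1 / c) * (\<integral>\<^sup>+ x. f x \<partial>M)) \<le> ennreal c * (\<integral>\<^sup>+ x. g x \<partial>M)"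
    by (rule mult_left_mono) simp
  then show ?thesis by (simp add: mult.assoc[symmetric] inv)
qed

lemma orthonormal_basis_inner:
  assumes "orthonormal_basis E" "e \<in> E" "e' \<in> E"
  shows "e \<bullet> e' = (if e = e' then 1 else 0)"
  using assms unfolding orthonormal_basis_def pairwise_def orthogonal_def
  by (auto simp: dot_square_norm)

text \<open>Distinct basis vectors are at distance sqrt 2, so the balls of radius 1/2 around them
  are disjoint open sets, of which a second countable space has only countably many.\<close>

lemma countable_orthonormal_basis:
  fixes E :: "'h::{real_inner, second_countable_topology} set"
  assumes E: "orthonormal_basis E"
  shows "countable E"
proof -
  have dist: "1 \<le> dist e e'" if "e \<in> E" "e' \<in> E" "e \<noteq> e'" for e e'
  proof -
    have "(dist e e')\<^sup>2 = 2"
      using that orthonormal_basis_inner[OF E]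
      by (simp add: dist_norm power2_norm_eq_inner inner_diff_left inner_diff_right)
    then have "1\<^sup>2 \<le> (dist e e')\<^sup>2" by simp
    then show ?thesis by (rule power2_le_imp_le) simp
  qed
  have disj: "ball e (1/2) \<inter> ball e' (1/2) = {}" if "e \<in> E" "e' \<in> E" "e \<noteq> e'" for e e'
    using dist[OF that] by (intro disjoint_ballI) simp
  have "pairwise disjnt ((\<lambda>e. ball e (1/2)) ` E)"
    unfolding pairwise_def disjnt_def using disj by blast
  then have "countable ((\<lambda>e. ball e (1/2)) ` E)"
    by (intro countable_disjoint_open_subsets) auto
  moreover have "inj_on (\<lambda>e. ball e (1/2)) E"
  proof (rule inj_onI)
    fix e e' assume *: "e \<in> E" "e' \<in> E" "ball e (1/2) = ball e' (1/2)"
    have "e \<in> ball e (1/2)" by simp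
    then show "e = e'" using disj[OF *(1,2)] *(3) by auto
  qed
  ultimately show ?thesis by (rule countable_image_inj_on)
qed

text \<open>The free coefficients let one identity serve twice: \<open>c e = x \<bullet> e\<close>
  gives Bessel's inequality, and arbitrary \<open>c\<close> shows that the orthogonal projection is
  the best approximation.\<close>

lemma norm_diff_projection:
  assumes E: "orthonormal_basis E" and F: "finite F" "F \<subseteq> E"
  shows "(norm (x - (\<Sum>e\<in>F. c e *\<^sub>R e)))\<^sup>2 =
    (norm x)\<^sup>2 - (\<Sum>e\<in>F. (x \<bullet> e)\<^sup>2) + (\<Sum>e\<in>F. (x \<bullet> e - c e)\<^sup>2)"
proof -
  define z where "z = (\<Sum>e\<in>F. c e *\<^sub>R e)"
  have "z \<bullet> z = (\<Sum>e\<in>F. \<Sum>e'\<in>F. c e * (c e' * (e \<bullet> e')))"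
    unfolding z_def inner_sum_left inner_sum_right inner_scaleR_left inner_scaleR_right sum_distrib_left
    by (intro sum.cong refl) (simp add: inner_commute)
  also have "\<dots> = (\<Sum>e\<in>F. \<Sum>e'\<in>F. if e = e' then c e * c e else 0)"
    using orthonormal_basis_inner[OF E subsetD[OF F(2)] subsetD[OF F(2)]] by (intro sum.cong refl) simp
  also have "\<dots> = (\<Sum>e\<in>F. (c e)\<^sup>2)" using F by (simp add: power2_eq_square)
  finally have zz: "z \<bullet> z = (\<Sum>e\<in>F. (c e)\<^sup>2)" .
  have xz: "x \<bullet> z = (\<Sum>e\<in>F. c e * (x \<bullet> e))"
    by (simp add: z_def inner_sum_right)
  have "(norm (x - z))\<^sup>2 = (norm x)\<^sup>2 - 2 * (x \<bullet> z) + z \<bullet> z"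
    by (simp add: power2_norm_eq_inner inner_diff_left inner_diff_right inner_commute)
  also have "\<dots> = (norm x)\<^sup>2 - (\<Sum>e\<in>F. 2 * (c e * (x \<bullet> e)) - (c e)\<^sup>2)"
    by (simp add: zz xz sum_subtractf sum_distrib_left)
  also have "(\<Sum>e\<in>F. 2 * (c e * (x \<bullet> e)) - (c e)\<^sup>2) = (\<Sum>e\<in>F. (x \<bullet> e)\<^sup>2 - (x \<bullet> e - c e)\<^sup>2)"
    by (intro sum.cong refl) (simp add: power2_diff)
  finally show ?thesis by (simp add: z_def sum_subtractf)
qed

lemma bessel_finite:
  assumes "orthonormal_basis E" "finite F" "F \<subseteq> E"
  shows "(\<Sum>e\<in>F. (x \<bullet> e)\<^sup>2) \<le> (norm x)\<^sup>2"
proof -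
  have "0 \<le> (norm (x - (\<Sum>e\<in>F. (x \<bullet> e) *\<^sub>R e)))\<^sup>2" by simp
  then show ?thesis unfolding norm_diff_projection[OF assms] by simp
qed

text \<open>Density of the span supplies only some combination near \<open>x\<close>; by
  \<open>norm_diff_projection\<close>, passing to the coefficients of the projection does not
  increase the distance.\<close>

lemma parseval_approx:
  assumes E: "orthonormal_basis E" and "0 < \<epsilon>"
  shows "\<exists>F. finite F \<and> F \<subseteq> E \<and> (norm x)\<^sup>2 \<le> (\<Sum>e\<in>F. (x \<bullet> e)\<^sup>2) + \<epsilon>"
proof -
  have "x \<in> closure (span E)" using E by (simp add: orthonormal_basis_def)
  then obtain z where z: "z \<in> span E" "dist z x < sqrt \<epsilon>"
    unfolding closure_approachable using real_sqrt_gt_zero[OF \<open>0 < \<epsilon>\<close>] by blast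
  from z(1) obtain F c where F: "finite F" "F \<subseteq> E" "z = (\<Sum>e\<in>F. c e *\<^sub>R e)"
    unfolding span_explicit by blast
  have "(norm (x - z))\<^sup>2 \<le> (sqrt \<epsilon>)\<^sup>2"
    using z(2) by (intro power_mono) (auto simp: dist_norm norm_minus_commute)
  then have "(norm x)\<^sup>2 - (\<Sum>e\<in>F. (x \<bullet> e)\<^sup>2) + (\<Sum>e\<in>F. (x \<bullet> e - c e)\<^sup>2) \<le> \<epsilon>"
    using \<open>0 < \<epsilon>\<close> by (simp add: F(3) norm_diff_projection[OF E F(1,2)])
  moreover have "0 \<le> (\<Sum>e\<in>F. (x \<bullet> e - c e)\<^sup>2)" by (simp add: sum_nonneg)
  ultimately show ?thesis using F by (intro exI[of _ F]) auto
qed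

lemma nn_integral_count_space_le:
  fixes g :: "'b \<Rightarrow> ennreal"
  assumes "countable E" and "\<And>F. finite F \<Longrightarrow> F \<subseteq> E \<Longrightarrow> sum g F \<le> C"
  shows "(\<integral>\<^sup>+ e. g e \<partial>count_space E) \<le> C"
proof (cases "finite E")
  case True
  then show ?thesis using assms(2)[of E] by (simp add: nn_integral_count_space_finite)
next
  case False
  note * = bij_betw_from_nat_into[OF \<open>countable E\<close> False]
  have "(\<integral>\<^sup>+ e. g e \<partial>count_space E) = (\<Sum>n. g (from_nat_into E n))"
    by (simp add: nn_integral_bij_count_space[symmetric, OF *] nn_integral_count_space_nat)
  also have "\<dots> \<le> C"
  proof (rule suminf_le_const)
    fix n
    have "inj_on (from_nat_into E) {..<n}"
      using * by (auto simp: bij_betw_def intro: inj_on_subset)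
    then have "(\<Sum>i<n. g (from_nat_into E i)) = sum g (from_nat_into E ` {..<n})"
      by (simp add: sum.reindex)
    also have "\<dots> \<le> C"
      using False by (intro assms(2)) (auto intro!: from_nat_into)
    finally show "(\<Sum>i<n. g (from_nat_into E i)) \<le> C" .
  qed simp
  finally show ?thesis .
qed

lemma sum_le_nn_integral_count_space:
  fixes g :: "'b \<Rightarrow> ennreal"
  assumes "finite F" "F \<subseteq> E"
  shows "sum g F \<le> (\<integral>\<^sup>+ e. g e \<partial>count_space E)"
proof -
  have "sum g F = (\<integral>\<^sup>+ e. g e * indicator F e \<partial>count_space E)"
    using assms by (subst nn_integral_count_space'[where A=F]) (auto simp: indicator_def)
  also have "\<dots> \<le> (\<integral>\<^sup>+ e. g e \<partial>count_space E)"
    by (intro nn_integral_mono) (auto simp: indicator_def)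
  finally show ?thesis .
qed

text \<open>Written as an integral over a counting measure, as in \<open>hs_norm_sq\<close>, so that
  double sums over two bases can be exchanged as iterated integrals.\<close>

lemma parseval:
  fixes E :: "'h::{real_inner, second_countable_topology} set"
  assumes E: "orthonormal_basis E"
  shows "(\<integral>\<^sup>+ e. ennreal ((x \<bullet> e)\<^sup>2) \<partial>count_space E) = ennreal ((norm x)\<^sup>2)"
proof (rule antisym)
  show "(\<integral>\<^sup>+ e. ennreal ((x \<bullet> e)\<^sup>2) \<partial>count_space E) \<le> ennreal ((norm x)\<^sup>2)"
    by (rule nn_integral_count_space_le[OF countable_orthonormal_basis[OF E]])
       (simp add: ennreal_leI bessel_finite[OF E])
  show "ennreal ((norm x)\<^sup>2) \<le> (\<integral>\<^sup>+ e. ennreal ((x \<bullet> e)\<^sup>2) \<partial>count_space E)"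
  proof (rule ennreal_le_epsilon)
    fix \<epsilon> :: real assume "0 < \<epsilon>"
    from parseval_approx[OF E this, of x] obtain F
      where F: "finite F" "F \<subseteq> E" "(norm x)\<^sup>2 \<le> (\<Sum>e\<in>F. (x \<bullet> e)\<^sup>2) + \<epsilon>" by blast
    have "ennreal ((norm x)\<^sup>2) \<le> ennreal (\<Sum>e\<in>F. (x \<bullet> e)\<^sup>2) + ennreal \<epsilon>"
      using F(3) \<open>0 < \<epsilon>\<close> by (simp add: ennreal_plus[symmetric] sum_nonneg ennreal_leI del: ennreal_plus)
    also have "ennreal (\<Sum>e\<in>F. (x \<bullet> e)\<^sup>2) = (\<Sum>e\<in>F. ennreal ((x \<bullet> e)\<^sup>2))" by simp
    also have "\<dots> \<le> (\<integral>\<^sup>+ e. ennreal ((x \<bullet> e)\<^sup>2) \<partial>count_space E)"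
      by (rule sum_le_nn_integral_count_space[OF F(1,2)])
    finally show "ennreal ((norm x)\<^sup>2) \<le> (\<integral>\<^sup>+ e. ennreal ((x \<bullet> e)\<^sup>2) \<partial>count_space E) + ennreal \<epsilon>"
      by (simp add: add_right_mono)
  qed
qed

section \<open>Hilbert-Schmidt norms of operators composed with the root of Q\<close>

lemma orthonormal_basis_some:
  assumes "covariance_op (Q :: 'h::real_inner \<Rightarrow>\<^sub>L 'h)"
  shows "orthonormal_basis (SOME E :: 'h set. orthonormal_basis E)"
  using assms unfolding covariance_op_def by (metis someI_ex)

lemma hs_norm_sq_compose_le:
  fixes A R :: "'h::real_inner \<Rightarrow>\<^sub>L 'h"
  shows "hs_norm_sq (A o\<^sub>L R) \<le> ennreal ((norm A)\<^sup>2) * hs_norm_sq (id_blinfun o\<^sub>L R)"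
  unfolding hs_norm_sq_def
proof (rule nn_integral_le_cmultI)
  fix e
  have "(norm (A (R e)))\<^sup>2 \<le> (norm A * norm (R e))\<^sup>2" by (intro power_mono norm_blinfun norm_ge_zero)
  then show "ennreal ((norm ((A o\<^sub>L R) e))\<^sup>2) \<le> ennreal ((norm A)\<^sup>2) * ennreal ((norm ((id_blinfun o\<^sub>L R) e))\<^sup>2)"
    by (simp add: ennreal_mult[symmetric] power_mult_distrib ennreal_leI)
qed simp_all

text \<open>\<open>hs_norm_sq\<close> uses a chosen basis, while \<open>covariance_op\<close> grants
  summability along possibly another one. Expanding in both and exchanging the sums, with the
  symmetry of the root, carries the trace from one to the other.\<close>

lemma hs_norm_sq_sqrt_op_finite:
  fixes Q A :: "'h::{real_inner, complete_space, second_countable_topology} \<Rightarrow>\<^sub>L 'h"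
  assumes Q: "covariance_op Q"
  shows "hs_norm_sq (A o\<^sub>L sqrt_op Q) < \<infinity>"
proof -
  define R where "R = sqrt_op Q"
  define E :: "'h set" where "E = (SOME E. orthonormal_basis E)"
  have E: "orthonormal_basis E" unfolding E_def by (rule orthonormal_basis_some[OF Q])
  from Q obtain E' where E': "orthonormal_basis E'" "(\<lambda>e. Q e \<bullet> e) summable_on E'"
    unfolding covariance_op_def by blast
  have R: "R x \<bullet> y = x \<bullet> R y" "R x \<bullet> R y = Q x \<bullet> y" for x y
    unfolding R_def by (rule sqrt_op_symmetric[OF Q] sqrt_op_inner[OF Q])+
  have Qpos: "0 \<le> Q x \<bullet> x" for x using R(2)[of x x] by (metis inner_ge_zero)
  have "(\<integral>\<^sup>+ e. ennreal ((norm (R e))\<^sup>2) \<partial>count_space E) =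
      (\<integral>\<^sup>+ e. \<integral>\<^sup>+ e'. ennreal ((R e \<bullet> e')\<^sup>2) \<partial>count_space E' \<partial>count_space E)"
    by (simp add: parseval[OF E'(1)])
  also have "\<dots> = (\<integral>\<^sup>+ e'. \<integral>\<^sup>+ e. ennreal ((R e \<bullet> e')\<^sup>2) \<partial>count_space E \<partial>count_space E')"
    by (rule nn_integral_count_space_nn_integral[OF countable_orthonormal_basis[OF E'(1)]]) simp
  also have "\<dots> = (\<integral>\<^sup>+ e'. ennreal ((norm (R e'))\<^sup>2) \<partial>count_space E')"
  proof (rule nn_integral_cong)
    fix e'
    have "R e \<bullet> e' = R e' \<bullet> e" for e using R(1)[of e e'] by (simp add: inner_commute)
    then show "(\<integral>\<^sup>+ e. ennreal ((R e \<bullet> e')\<^sup>2) \<partial>count_space E) = ennreal ((norm (R e'))\<^sup>2)"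
      by (simp add: parseval[OF E])
  qed
  also have "\<dots> = (\<integral>\<^sup>+ e'. ennreal (Q e' \<bullet> e') \<partial>count_space E')"
    by (simp add: power2_norm_eq_inner R(2))
  also have "\<dots> < \<infinity>"
  proof (rule le_less_trans)
    show "(\<integral>\<^sup>+ e'. ennreal (Q e' \<bullet> e') \<partial>count_space E') \<le> ennreal (infsum (\<lambda>e. Q e \<bullet> e) E')"
    proof (rule nn_integral_count_space_le[OF countable_orthonormal_basis[OF E'(1)]])
      fix F assume "finite F" "F \<subseteq> E'"
      then show "(\<Sum>e\<in>F. ennreal (Q e \<bullet> e)) \<le> ennreal (infsum (\<lambda>e. Q e \<bullet> e) E')"
        using finite_sum_le_infsum[OF E'(2)] Qpos by (simp add: sum_nonneg ennreal_leI)
    qed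
  qed simp
  finally have fin: "(\<integral>\<^sup>+ e. ennreal ((norm (R e))\<^sup>2) \<partial>count_space E) < \<infinity>" .
  have "hs_norm_sq (A o\<^sub>L R) \<le> ennreal ((norm A)\<^sup>2) * hs_norm_sq (id_blinfun o\<^sub>L R)"
    by (rule hs_norm_sq_compose_le)
  also have "\<dots> < \<infinity>"
    using fin by (simp add: hs_norm_sq_def E_def[symmetric] ennreal_mult_less_top)
  finally show ?thesis unfolding R_def .
qed

text \<open>The vector on the left is the adjoint of \<open>D o\<^sub>L sqrt_op Q\<close> at
  \<open>f\<close>, and the Hilbert-Schmidt norm dominates the operator norm. Thus convergence of
  operator integrands in the Ito sense implies that of the vector integrands obtained by
  testing.\<close>

lemma norm_sqrt_op_adjoint_le_hs_norm_sq:
  fixes Q D :: "'h::{real_inner, complete_space, second_countable_topology} \<Rightarrow>\<^sub>L 'h"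
  assumes Q: "covariance_op Q"
  shows "ennreal ((norm (sqrt_op Q (adjoint_op D f)))\<^sup>2) \<le> ennreal ((norm f)\<^sup>2) * hs_norm_sq (D o\<^sub>L sqrt_op Q)"
proof -
  define E :: "'h set" where "E = (SOME E. orthonormal_basis E)"
  have E: "orthonormal_basis E" unfolding E_def by (rule orthonormal_basis_some[OF Q])
  have "ennreal ((norm (sqrt_op Q (adjoint_op D f)))\<^sup>2) =
      (\<integral>\<^sup>+ e. ennreal ((sqrt_op Q (adjoint_op D f) \<bullet> e)\<^sup>2) \<partial>count_space E)"
    by (rule parseval[OF E, symmetric])
  also have "\<dots> \<le> (\<integral>\<^sup>+ e. ennreal ((norm f)\<^sup>2) * ennreal ((norm ((D o\<^sub>L sqrt_op Q) e))\<^sup>2) \<partial>count_space E)"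
  proof (rule nn_integral_mono)
    fix e
    have "sqrt_op Q (adjoint_op D f) \<bullet> e = f \<bullet> D (sqrt_op Q e)"
      by (simp add: sqrt_op_symmetric[OF Q] adjoint_op_inner)
    then have "(sqrt_op Q (adjoint_op D f) \<bullet> e)\<^sup>2 \<le> (norm f * norm ((D o\<^sub>L sqrt_op Q) e))\<^sup>2"
      using Cauchy_Schwarz_ineq2[of f "D (sqrt_op Q e)"] by (metis abs_ge_zero blinfun_apply_blinfun_compose power2_abs power_mono)
    then show "ennreal ((sqrt_op Q (adjoint_op D f) \<bullet> e)\<^sup>2) \<le> ennreal ((norm f)\<^sup>2) * ennreal ((norm ((D o\<^sub>L sqrt_op Q) e))\<^sup>2)"
      by (simp add: ennreal_mult[symmetric] power_mult_distrib ennreal_leI)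
  qed
  also have "\<dots> = ennreal ((norm f)\<^sup>2) * hs_norm_sq (D o\<^sub>L sqrt_op Q)"
    unfolding hs_norm_sq_def E_def[symmetric] by (rule nn_integral_cmult) simp
  finally show ?thesis .
qed

text \<open>Both Hilbert-Schmidt norms stay on the right-hand side, so that their measurability in
  \<open>(s, \<omega>)\<close> is never needed.\<close>

lemma hs_norm_sq_tensor_le:
  fixes Q D T :: "'h::{real_inner, complete_space, second_countable_topology} \<Rightarrow>\<^sub>L 'h"
  assumes Q: "covariance_op Q"
  shows "ennreal ((norm (sqrt_op Q z))\<^sup>2 * (norm (T y))\<^sup>2) \<le>
    2 * hs_norm_sq ((D - (T o\<^sub>L tensor z y)) o\<^sub>L sqrt_op Q) + 2 * hs_norm_sq (D o\<^sub>L sqrt_op Q)"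
proof -
  define R where "R = sqrt_op Q"
  define E :: "'h set" where "E = (SOME E. orthonormal_basis E)"
  have E: "orthonormal_basis E" unfolding E_def by (rule orthonormal_basis_some[OF Q])
  have "ennreal ((norm (R z))\<^sup>2 * (norm (T y))\<^sup>2) = (\<integral>\<^sup>+ e. ennreal ((R z \<bullet> e)\<^sup>2) \<partial>count_space E) * ennreal ((norm (T y))\<^sup>2)"
    by (simp add: parseval[OF E] ennreal_mult)
  also have "\<dots> = (\<integral>\<^sup>+ e. ennreal ((R z \<bullet> e)\<^sup>2) * ennreal ((norm (T y))\<^sup>2) \<partial>count_space E)"
    by (rule nn_integral_multc[symmetric]) simp
  also have "\<dots> \<le> (\<integral>\<^sup>+ e. 2 * ennreal ((norm (((D - (T o\<^sub>L tensor z y)) o\<^sub>L R) e))\<^sup>2) +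
      2 * ennreal ((norm ((D o\<^sub>L R) e))\<^sup>2) \<partial>count_space E)"
  proof (rule nn_integral_mono)
    fix e
    have T: "(T o\<^sub>L tensor z y) (R e) = (R z \<bullet> e) *\<^sub>R T y"
      by (simp add: tensor.rep_eq blinfun.scaleR_right sqrt_op_symmetric[OF Q, folded R_def])
    have "(R z \<bullet> e)\<^sup>2 * (norm (T y))\<^sup>2 = (norm ((T o\<^sub>L tensor z y) (R e)))\<^sup>2"
      unfolding T by (simp add: power_mult_distrib)
    also have "(T o\<^sub>L tensor z y) (R e) = (D o\<^sub>L R) e - ((D - (T o\<^sub>L tensor z y)) o\<^sub>L R) e"
      by (simp add: blinfun.diff_left)
    also have "(norm \<dots>)\<^sup>2 \<le> (norm ((D o\<^sub>L R) e) + norm (((D - (T o\<^sub>L tensor z y)) o\<^sub>L R) e))\<^sup>2"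
      by (intro power_mono norm_triangle_ineq4 norm_ge_zero)
    also have "\<dots> \<le> 2 * (norm (((D - (T o\<^sub>L tensor z y)) o\<^sub>L R) e))\<^sup>2 + 2 * (norm ((D o\<^sub>L R) e))\<^sup>2"
      using sum_squares_bound[of "norm ((D o\<^sub>L R) e)" "norm (((D - (T o\<^sub>L tensor z y)) o\<^sub>L R) e)"]
      unfolding power2_sum by linarith
    finally have "ennreal ((R z \<bullet> e)\<^sup>2 * (norm (T y))\<^sup>2) \<le>
      ennreal (2 * (norm (((D - (T o\<^sub>L tensor z y)) o\<^sub>L R) e))\<^sup>2 + 2 * (norm ((D o\<^sub>L R) e))\<^sup>2)" by (rule ennreal_leI)
    then show "ennreal ((R z \<bullet> e)\<^sup>2) * ennreal ((norm (T y))\<^sup>2) \<le>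
        2 * ennreal ((norm (((D - (T o\<^sub>L tensor z y)) o\<^sub>L R) e))\<^sup>2) + 2 * ennreal ((norm ((D o\<^sub>L R) e))\<^sup>2)"
      by (simp add: ennreal_mult ennreal_plus)
  qed
  also have "\<dots> = 2 * hs_norm_sq ((D - (T o\<^sub>L tensor z y)) o\<^sub>L R) + 2 * hs_norm_sq (D o\<^sub>L R)"
    unfolding hs_norm_sq_def E_def[symmetric] by (simp add: nn_integral_add nn_integral_cmult)
  finally show ?thesis unfolding R_def .
qed

section \<open>Measurability\<close>

text \<open>Pettis in a separable space: a bound on the norm amounts to countably many conditions on
  inner products, so preimages of closed balls are measurable, and every open set is a countable
  union of closed balls.\<close>

lemma borel_measurable_innerI:
  fixes X :: "'a \<Rightarrow> 'h::{real_inner, second_countable_topology}"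
  assumes [measurable]: "\<And>h. (\<lambda>\<omega>. X \<omega> \<bullet> h) \<in> borel_measurable M"
  shows "X \<in> borel_measurable M"
proof (rule borel_measurableI)
  obtain D :: "'h set" where D: "countable D" "\<And>U. open U \<Longrightarrow> U \<noteq> {} \<Longrightarrow> \<exists>d\<in>D. d \<in> U"
    by (erule countable_dense_setE)
  have norm_le_iff: "norm v \<le> q \<longleftrightarrow> (\<forall>d\<in>D. v \<bullet> d \<le> q * norm d)" if "0 \<le> q" for v q
  proof
    assume "norm v \<le> q"
    then show "\<forall>d\<in>D. v \<bullet> d \<le> q * norm d"
      using norm_cauchy_schwarz[of v] by (meson mult_right_mono norm_ge_zero order_trans)
  next
    assume *: "\<forall>d\<in>D. v \<bullet> d \<le> q * norm d"
    show "norm v \<le> q"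
    proof (rule ccontr)
      assume "\<not> norm v \<le> q"
      then have "q * norm v < norm v * norm v" using that by (intro mult_strict_right_mono) auto
      \<comment> \<open>The vector \<open>v\<close> itself violates the condition; the violation is
        open, so some member of the dense set violates it too.\<close>
      then have "v \<in> {d. q * norm d < v \<bullet> d}" by (simp add: power2_norm_eq_inner[symmetric] power2_eq_square)
      moreover have "open {d. q * norm d < v \<bullet> d}" by (intro open_Collect_less continuous_intros)
      ultimately obtain d where "d \<in> D" "q * norm d < v \<bullet> d" using D(2) by blast
      then show False using * by force
    qed
  qed
  have cball: "X -` cball c q \<inter> space M \<in> sets M" if "0 \<le> q" for c q
  proof -
    have "X -` cball c q \<inter> space M = {\<omega>\<in>space M. \<forall>d\<in>D. X \<omega> \<bullet> d - c \<bullet> d \<le> q * norm d}"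
      using that by (auto simp: dist_norm norm_minus_commute[of c] norm_le_iff inner_diff_left)
    also have "\<dots> \<in> sets M" using D(1) by measurable
    finally show ?thesis .
  qed
  fix U :: "'h set" assume "open U"
  define I where "I = {(d, q). d \<in> D \<and> q \<in> \<rat> \<and> 0 < q \<and> cball d q \<subseteq> U}"
  have "countable I"
    by (rule countable_subset[of _ "D \<times> \<rat>"]) (auto simp: I_def D(1) countable_rat)
  moreover have "U = (\<Union>(d, q)\<in>I. cball d q)"
  proof (intro equalityI subsetI)
    fix u assume "u \<in> U"
    with \<open>open U\<close> obtain e where e: "0 < e" "cball u e \<subseteq> U" by (meson open_contains_cball)
    obtain q where q: "q \<in> \<rat>" "0 < q" "q < e / 2" using Rats_dense_in_real[of 0 "e/2"] e by auto
    obtain d where d: "d \<in> D" "d \<in> ball u q" using D(2)[of "ball u q"] q by auto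
    have "cball d q \<subseteq> cball u e"
    proof
      fix x assume "x \<in> cball d q"
      then show "x \<in> cball u e" using d q dist_triangle[of u x d] by auto
    qed
    then have "(d, q) \<in> I" using d q e by (auto simp: I_def)
    moreover have "u \<in> cball d q" using d by (simp add: dist_commute)
    ultimately show "u \<in> (\<Union>(d, q)\<in>I. cball d q)" by blast
  qed (auto simp: I_def)
  then have "X -` U \<inter> space M = (\<Union>(d, q)\<in>I. X -` cball d q \<inter> space M)" by auto
  ultimately show "X -` U \<inter> space M \<in> sets M"
    by (auto intro!: sets.countable_UN' cball simp: I_def less_imp_le)
qed

lemma borel_measurable_blinfun_apply:
  assumes "X \<in> borel_measurable M"
  shows "(\<lambda>\<omega>. blinfun_apply A (X \<omega>)) \<in> borel_measurable M"
  by (rule borel_measurable_continuous_on[OF _ assms]) (intro continuous_intros)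

text \<open>The point \<omega> is fixed, so \<open>g\<close> may itself be random. This is how an
  increment with a random integrand is split into finitely many events with a constant one.\<close>

lemma simple_function_sum_indicator:
  fixes x :: "'a \<Rightarrow> 'b"
  assumes "simple_function N x" "\<omega> \<in> space N"
  shows "g (x \<omega>) = (\<Sum>v\<in>x ` space N. indicator (x -` {v} \<inter> space N) \<omega> *\<^sub>R (g v :: 'c::real_vector))"
proof -
  have "(\<Sum>v\<in>x ` space N. indicator (x -` {v} \<inter> space N) \<omega> *\<^sub>R g v) = (\<Sum>v\<in>x ` space N. if v = x \<omega> then g v else 0)"
    using assms(2) by (intro sum.cong refl) (auto simp: indicator_def)
  also have "\<dots> = g (x \<omega>)"
    using simple_functionD(1)[OF assms(1)] assms(2) by simp
  finally show ?thesis by simp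
qed

text \<open>The family is measurable only strongly, that is, for each fixed argument; simple
  approximations of \<open>Z\<close> reduce evaluation at a random argument to that case.\<close>

lemma borel_measurable_blinfun_family:
  fixes \<Psi> :: "'a \<Rightarrow> 'h::{real_normed_vector, second_countable_topology} \<Rightarrow>\<^sub>L 'h"
  assumes \<Psi>: "\<And>h. (\<lambda>p. \<Psi> p h) \<in> borel_measurable N" and Z: "Z \<in> borel_measurable N"
  shows "(\<lambda>p. \<Psi> p (Z p)) \<in> borel_measurable N"
proof -
  from borel_measurable_implies_sequence_metric[OF Z, of 0] obtain s where
    s: "\<And>i. simple_function N (s i)" and lim: "\<And>p. p \<in> space N \<Longrightarrow> (\<lambda>i. s i p) \<longlonglongrightarrow> Z p" by auto
  show ?thesis
  proof (rule borel_measurable_LIMSEQ_metric)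
    fix i
    have "(\<lambda>p. \<Sum>v\<in>s i ` space N. indicator (s i -` {v} \<inter> space N) p *\<^sub>R \<Psi> p v) \<in> borel_measurable N"
      by (intro borel_measurable_sum borel_measurable_scaleR \<Psi> borel_measurable_indicator simple_functionD(2)[OF s])
    then show "(\<lambda>p. \<Psi> p (s i p)) \<in> borel_measurable N"
      by (rule measurable_cong[THEN iffD1, rotated]) (rule simple_function_sum_indicator[OF s, symmetric])
  next
    fix p assume "p \<in> space N"
    then show "(\<lambda>i. \<Psi> p (s i p)) \<longlonglongrightarrow> \<Psi> p (Z p)" by (intro blinfun.tendsto tendsto_const lim)
  qed
qed

section \<open>Predictable processes as jointly measurable functions\<close>

lemma space_predictable_sigma: "space (predictable_sigma M F) = {0..} \<times> space M"
  by (simp add: predictable_sigma_def space_measure_of_conv)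

lemma sets_predictable_sigma_subset:
  assumes F: "filtered_prob_space M F"
  shows "sets (predictable_sigma M F) \<subseteq> sets (lborel \<Otimes>\<^sub>M M)"
proof -
  have sub: "A \<in> sets M" "A \<subseteq> space M" if "A \<in> sets (F s)" "0 \<le> s" for A s
  proof -
    have sub: "space (F s) = space M" "sets (F s) \<subseteq> sets M"
      using F that(2) unfolding filtered_prob_space_def subalgebra_def by auto
    show "A \<in> sets M" using sub(2) that(1) by auto
    then show "A \<subseteq> space M" by (rule sets.sets_into_space)
  qed
  let ?G = "{{s<..t} \<times> A | s t A. 0 \<le> s \<and> s \<le> t \<and> A \<in> sets (F s)} \<union> {{0} \<times> A | A. A \<in> sets (F 0)}"
  have "?G \<subseteq> Pow ({0..} \<times> space M)"
  proof
    fix C assume "C \<in> ?G"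
    then consider s t A where "C = {s<..t} \<times> A" "A \<in> sets (F s)" "0 \<le> s"
      | A where "C = {0} \<times> A" "A \<in> sets (F 0)" by blast
    then show "C \<in> Pow ({0..} \<times> space M)"
      by cases (use sub(2) in \<open>auto intro!: Sigma_mono\<close>)
  qed
  then have "sets (predictable_sigma M F) = sigma_sets ({0..} \<times> space M) ?G"
    unfolding predictable_sigma_def by (rule sets_measure_of)
  also have "\<dots> \<subseteq> sets (lborel \<Otimes>\<^sub>M M)"
  proof (rule sets.sigma_sets_subset')
    show "?G \<subseteq> sets (lborel \<Otimes>\<^sub>M M)"
    proof
      fix C assume "C \<in> ?G"
      then consider s t A where "C = {s<..t} \<times> A" "A \<in> sets (F s)" "0 \<le> s"
        | A where "C = {0} \<times> A" "A \<in> sets (F 0)" by blast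
      then show "C \<in> sets (lborel \<Otimes>\<^sub>M M)"
        by cases (use sub(1) in \<open>auto intro!: pair_measureI\<close>)
    qed
    show "{0::real..} \<times> space M \<in> sets (lborel \<Otimes>\<^sub>M M)" by (auto intro!: pair_measureI)
  qed
  finally show ?thesis .
qed

text \<open>The predictable \<sigma>-algebra lives on \<open>{0..} \<times> space M\<close>, whereas
  Fubini is applied on the whole time line; the indicator removes the arbitrary values at negative
  times.\<close>

lemma predictable_process_measurable:
  fixes X :: "real \<Rightarrow> 'a \<Rightarrow> 'h::{real_normed_vector, second_countable_topology}"
  assumes F: "filtered_prob_space M F" and X: "predictable_process M F X"
  shows "(\<lambda>(s, \<omega>). indicator {0..T} s *\<^sub>R X s \<omega>) \<in> borel_measurable (lborel \<Otimes>\<^sub>M M)"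
proof -
  have D: "{0::real..} \<times> space M \<in> sets (lborel \<Otimes>\<^sub>M M)" by (auto intro!: pair_measureI)
  have "(\<lambda>p. indicator ({0..} \<times> space M) p *\<^sub>R (case p of (s, \<omega>) \<Rightarrow> X s \<omega>)) \<in> borel_measurable (lborel \<Otimes>\<^sub>M M)"
  proof (subst borel_measurable_restrict_space_iff[symmetric])
    show "{0::real..} \<times> space M \<inter> space (lborel \<Otimes>\<^sub>M M) \<in> sets (lborel \<Otimes>\<^sub>M M)" by (rule sets.Int[OF D sets.top])
    show "(\<lambda>(s, \<omega>). X s \<omega>) \<in> borel_measurable (restrict_space (lborel \<Otimes>\<^sub>M M) ({0..} \<times> space M))"
    proof (rule measurableI)
      fix U :: "'h set" assume U: "U \<in> sets borel"
      have "(\<lambda>(s, \<omega>). X s \<omega>) -` U \<inter> ({0..} \<times> space M) \<in> sets (predictable_sigma M F)"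
        using measurable_sets[OF X[unfolded predictable_process_def] U] by (simp add: space_predictable_sigma)
      then have "(\<lambda>(s, \<omega>). X s \<omega>) -` U \<inter> ({0..} \<times> space M) \<in> sets (lborel \<Otimes>\<^sub>M M)"
        using sets_predictable_sigma_subset[OF F] by blast
      moreover have "space (restrict_space (lborel \<Otimes>\<^sub>M M) ({0..} \<times> space M)) = {0..} \<times> space M"
        by (auto simp: space_restrict_space space_pair_measure)
      ultimately show "(\<lambda>(s, \<omega>). X s \<omega>) -` U \<inter> space (restrict_space (lborel \<Otimes>\<^sub>M M) ({0..} \<times> space M)) \<in>
          sets (restrict_space (lborel \<Otimes>\<^sub>M M) ({0..} \<times> space M))"
        using D by (subst sets_restrict_space_iff) auto
    qed simp
  qed
  then have "(\<lambda>p. indicator ({0..T} \<times> UNIV) p *\<^sub>R (indicator ({0..} \<times> space M) p *\<^sub>R (case p of (s, \<omega>) \<Rightarrow> X s \<omega>))) \<in> borel_measurable (lborel \<Otimes>\<^sub>M M)"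
  proof (rule borel_measurable_scaleR[rotated])
    have "(\<lambda>p. indicator {0..T} (fst p) :: real) \<in> borel_measurable (lborel \<Otimes>\<^sub>M M)" by measurable
    moreover have "(\<lambda>p. indicator {0..T} (fst p) :: real) = indicator ({0..T} \<times> (UNIV :: 'a set))"
      by (auto simp: indicator_def fun_eq_iff)
    ultimately show "(indicator ({0..T} \<times> (UNIV :: 'a set)) :: _ \<Rightarrow> real) \<in> borel_measurable (lborel \<Otimes>\<^sub>M M)" by simp
  qed
  then show ?thesis
    by (rule measurable_cong[THEN iffD1, rotated])
       (auto simp: space_pair_measure indicator_def)
qed

section \<open>Strong Bochner integrals of rank-one operators\<close>

lemma norm_tensor_le: "norm (tensor f g) \<le> norm f * norm g"
proof (rule norm_blinfun_bound)
  fix h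
  have "\<bar>f \<bullet> h\<bar> * norm g \<le> (norm f * norm h) * norm g"
    by (intro mult_right_mono Cauchy_Schwarz_ineq2) simp
  then show "norm (tensor f g h) \<le> norm f * norm g * norm h"
    by (simp add: tensor.rep_eq algebra_simps)
qed simp

lemma norm_tensor_self: "norm (tensor z z) = (norm z)\<^sup>2"
proof (rule antisym)
  show "norm (tensor z z) \<le> (norm z)\<^sup>2" using norm_tensor_le[of z z] by (simp add: power2_eq_square)
  show "(norm z)\<^sup>2 \<le> norm (tensor z z)"
  proof (cases "z = 0")
    case False
    have "(norm z)\<^sup>2 * norm z = norm (tensor z z z)" by (simp add: tensor.rep_eq power2_norm_eq_inner)
    also have "\<dots> \<le> norm (tensor z z) * norm z" by (rule norm_blinfun)
    finally show ?thesis using False by simp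
  qed simp
qed

lemma norm_tensor_diff_le:
  "norm (tensor z z - tensor s s) \<le> (norm z + norm s) * norm (z - s)"
proof -
  have "tensor z z - tensor s s = tensor (z - s) z + tensor s (z - s)"
    by (rule blinfun_eqI) (simp add: tensor.rep_eq blinfun.diff_left blinfun.add_left inner_diff_left algebra_simps)
  then have "norm (tensor z z - tensor s s) \<le> norm (z - s) * norm z + norm s * norm (z - s)"
    by (metis norm_triangle_mono norm_tensor_le)
  then show ?thesis by (simp add: algebra_simps)
qed

text \<open>Simple functions are chosen for the vector \<open>z\<close>, whose range is separable,
  and then squared as tensors; this supplies the strong measurability in operator norm that the
  definition demands.\<close>

lemma has_strong_bochner_integral_tensor:
  fixes z :: "'a \<Rightarrow> 'h::{real_inner, complete_space, second_countable_topology}"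
  assumes z[measurable]: "z \<in> borel_measurable M"
    and fin: "(\<integral>\<^sup>+ x. ennreal ((norm (z x))\<^sup>2) \<partial>M) < \<infinity>"
  shows "\<exists>T. has_strong_bochner_integral M (\<lambda>x. tensor (z x) (z x)) T"
proof -
  from borel_measurable_implies_sequence_metric[OF z, of 0] obtain s where
    simp_s: "\<And>i. simple_function M (s i)" and
    lim: "\<And>x. x \<in> space M \<Longrightarrow> (\<lambda>i. s i x) \<longlonglongrightarrow> z x" and
    bound: "\<And>i x. x \<in> space M \<Longrightarrow> norm (s i x) \<le> 2 * norm (z x)"
    by simp metis
  have s[measurable]: "s i \<in> borel_measurable M" for i by (rule borel_measurable_simple_function[OF simp_s])
  define T where "T i x = tensor (s i x) (s i x)" for i x
  have simp_T: "Bochner_Integration.simple_bochner_integrable M (T i)" for i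
  proof (rule simple_bochner_integrableI_bounded)
    show "simple_function M (T i)"
      unfolding T_def by (rule simple_function_compose1[OF simp_s])
    have "(\<integral>\<^sup>+ x. ennreal (norm (T i x)) \<partial>M) \<le> (\<integral>\<^sup>+ x. 4 * ennreal ((norm (z x))\<^sup>2) \<partial>M)"
    proof (intro nn_integral_mono)
      fix x assume "x \<in> space M"
      then have "norm (s i x) * norm (s i x) \<le> (2 * norm (z x)) * (2 * norm (z x))"
        by (intro mult_mono bound) auto
      then have "norm (T i x) \<le> 4 * (norm (z x))\<^sup>2"
        using norm_tensor_le[of "s i x" "s i x"] by (simp add: T_def power2_eq_square)
      then show "ennreal (norm (T i x)) \<le> 4 * ennreal ((norm (z x))\<^sup>2)"
        by (metis ennreal_leI ennreal_mult' ennreal_numeral zero_le_numeral)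
    qed
    also have "\<dots> < \<infinity>" using fin by (simp add: nn_integral_cmult ennreal_mult_less_top)
    finally show "(\<integral>\<^sup>+ x. ennreal (norm (T i x)) \<partial>M) < \<infinity>" .
  qed
  \<comment> \<open>The factor 3 is 1 + 2, since the approximants satisfy
    \<open>norm (s i x) \<le> 2 * norm (z x)\<close>. The same bound gives another 3 for
    \<open>norm (z x - s i x)\<close>, hence the 9 in the dominating function.\<close>
  define u where "u i = (\<integral>\<^sup>+ x. ennreal (3 * norm (z x) * norm (z x - s i x)) \<partial>M)" for i
  have T_le: "norm (tensor (z x) (z x) - T i x) \<le> 3 * norm (z x) * norm (z x - s i x)" if "x \<in> space M" for i x
  proof -
    have "(norm (z x) + norm (s i x)) * norm (z x - s i x) \<le> (3 * norm (z x)) * norm (z x - s i x)"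
      using bound[OF that, of i] by (intro mult_right_mono) auto
    then show ?thesis using norm_tensor_diff_le[of "z x" "s i x"] by (simp add: T_def)
  qed
  have "u \<longlonglongrightarrow> (\<integral>\<^sup>+ x. 0 \<partial>M)"
    unfolding u_def
  proof (rule nn_integral_dominated_convergence[where w="\<lambda>x. 9 * ennreal ((norm (z x))\<^sup>2)"])
    show "(\<integral>\<^sup>+ x. 9 * ennreal ((norm (z x))\<^sup>2) \<partial>M) < \<infinity>"
      using fin by (simp add: nn_integral_cmult ennreal_mult_less_top)
    show "AE x in M. (\<lambda>i. ennreal (3 * norm (z x) * norm (z x - s i x))) \<longlonglongrightarrow> 0"
    proof (rule AE_I2)
      fix x assume "x \<in> space M"
      then have "(\<lambda>i. ennreal (3 * norm (z x) * norm (z x - s i x))) \<longlonglongrightarrow> ennreal (3 * norm (z x) * norm (z x - z x))"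
        by (intro tendsto_intros lim)
      then show "(\<lambda>i. ennreal (3 * norm (z x) * norm (z x - s i x))) \<longlonglongrightarrow> 0" by simp
    qed
    fix j
    show "AE x in M. ennreal (3 * norm (z x) * norm (z x - s j x)) \<le> 9 * ennreal ((norm (z x))\<^sup>2)"
    proof (rule AE_I2)
      fix x assume "x \<in> space M"
      then have "norm (z x - s j x) \<le> 3 * norm (z x)"
        using norm_triangle_ineq4[of "z x" "s j x"] bound[of x j] by linarith
      then have "3 * norm (z x) * norm (z x - s j x) \<le> 3 * norm (z x) * (3 * norm (z x))"
        by (intro mult_left_mono) auto
      also have "\<dots> = 9 * (norm (z x))\<^sup>2" by (simp add: power2_eq_square)
      finally show "ennreal (3 * norm (z x) * norm (z x - s j x)) \<le> 9 * ennreal ((norm (z x))\<^sup>2)"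
        by (metis ennreal_leI ennreal_mult' ennreal_numeral zero_le_numeral)
    qed
  qed measurable
  then have u: "u \<longlonglongrightarrow> 0" by simp
  have "(\<lambda>i. \<integral>\<^sup>+ x. ennreal (norm (tensor (z x) (z x) - T i x)) \<partial>M) \<longlonglongrightarrow> 0"
  proof (rule tendsto_sandwich[OF _ _ tendsto_const u])
    show "\<forall>\<^sub>F i in sequentially. (\<integral>\<^sup>+ x. ennreal (norm (tensor (z x) (z x) - T i x)) \<partial>M) \<le> u i"
      unfolding u_def by (intro always_eventually allI nn_integral_mono ennreal_leI T_le)
  qed simp
  moreover have "AE x in M. (\<lambda>i. T i x) \<longlonglongrightarrow> tensor (z x) (z x)"
  proof (rule AE_I2)
    fix x assume x: "x \<in> space M"
    have "(\<lambda>i. T i x - tensor (z x) (z x)) \<longlonglongrightarrow> 0"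
    proof (rule Lim_null_comparison)
      show "\<forall>\<^sub>F i in sequentially. norm (T i x - tensor (z x) (z x)) \<le> 3 * norm (z x) * norm (z x - s i x)"
        using T_le[OF x] by (simp add: norm_minus_commute)
      have "(\<lambda>i. 3 * norm (z x) * norm (z x - s i x)) \<longlonglongrightarrow> 3 * norm (z x) * norm (z x - z x)"
        by (intro tendsto_intros lim[OF x])
      then show "(\<lambda>i. 3 * norm (z x) * norm (z x - s i x)) \<longlonglongrightarrow> 0" by simp
    qed
    then show "(\<lambda>i. T i x) \<longlonglongrightarrow> tensor (z x) (z x)" by (rule LIM_zero_cancel)
  qed
  \<comment> \<open>The integrals converge because the operators form a complete space and two
    approximants have L1 distance at most \<open>u i + u j\<close>.\<close>
  moreover have "Cauchy (\<lambda>i. Bochner_Integration.simple_bochner_integral M (T i))"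
  proof (rule CauchyI)
    fix e :: real assume "0 < e"
    then have "\<forall>\<^sub>F i in sequentially. u i < ennreal (e / 2)"
      using order_tendstoD(2)[OF u, of "ennreal (e/2)"] by simp
    then obtain N where N: "\<And>i. N \<le> i \<Longrightarrow> u i < ennreal (e / 2)"
      by (auto simp: eventually_sequentially)
    have "norm (Bochner_Integration.simple_bochner_integral M (T i) - Bochner_Integration.simple_bochner_integral M (T j)) < e"
      if "N \<le> i" "N \<le> j" for i j
    proof -
      have "ennreal (norm (Bochner_Integration.simple_bochner_integral M (T i) - Bochner_Integration.simple_bochner_integral M (T j)))
          = ennreal (norm (Bochner_Integration.simple_bochner_integral M (\<lambda>x. T i x - T j x)))"
        using simp_T by (subst simple_bochner_integral_diff) auto
      also have "\<dots> \<le> ennreal (Bochner_Integration.simple_bochner_integral M (\<lambda>x. norm (T i x - T j x)))"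
        using simple_bochner_integrable_compose2[of "(-)" M "T i" "T j"] simp_T
        by (auto intro!: ennreal_leI simple_bochner_integral_norm_bound)
      also have "\<dots> = (\<integral>\<^sup>+ x. ennreal (norm (T i x - T j x)) \<partial>M)"
        using simple_bochner_integrable_compose2[of "\<lambda>x y. norm (x - y)" M "T i" "T j"] simp_T
        by (auto intro!: simple_bochner_integral_eq_nn_integral)
      also have "\<dots> \<le> (\<integral>\<^sup>+ x. ennreal (3 * norm (z x) * norm (z x - s i x)) + ennreal (3 * norm (z x) * norm (z x - s j x)) \<partial>M)"
      proof (rule nn_integral_mono)
        fix x assume x: "x \<in> space M"
        have "norm (T i x - T j x) \<le> norm (tensor (z x) (z x) - T i x) + norm (tensor (z x) (z x) - T j x)"
          by (metis norm_minus_commute norm_triangle_sub dist_norm dist_triangle3 dist_triangle2)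
        also have "\<dots> \<le> 3 * norm (z x) * norm (z x - s i x) + 3 * norm (z x) * norm (z x - s j x)"
          by (intro add_mono T_le x)
        finally show "ennreal (norm (T i x - T j x)) \<le> ennreal (3 * norm (z x) * norm (z x - s i x)) + ennreal (3 * norm (z x) * norm (z x - s j x))"
          by (rule order_trans[OF ennreal_leI]) simp
      qed
      also have "\<dots> = u i + u j" unfolding u_def by (intro nn_integral_add) auto
      also have "\<dots> < ennreal (e / 2) + ennreal (e / 2)" by (intro add_strict_mono N that)
      also have "\<dots> = ennreal e" using \<open>0 < e\<close> by (simp flip: ennreal_plus)
      finally show ?thesis by (simp add: ennreal_less_iff)
    qed
    then show "\<exists>M'. \<forall>m\<ge>M'. \<forall>n\<ge>M'. norm (Bochner_Integration.simple_bochner_integral M (T m) - Bochner_Integration.simple_bochner_integral M (T n)) < e"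
      by blast
  qed
  then obtain x where "(\<lambda>i. Bochner_Integration.simple_bochner_integral M (T i)) \<longlonglongrightarrow> x"
    using Cauchy_blinfun_convergent by blast
  ultimately show ?thesis unfolding has_strong_bochner_integral_def using simp_T by blast
qed

text \<open>Evaluation at \<open>f\<close> followed by pairing with \<open>h\<close> is a bounded
  functional of the operator, so it maps the approximating simple functions to real ones and the
  strong integral to an ordinary one.\<close>

lemma has_strong_bochner_integral_inner:
  fixes g :: "'a \<Rightarrow> 'h::real_inner \<Rightarrow>\<^sub>L 'h"
  assumes g: "has_strong_bochner_integral M g T"
    and meas[measurable]: "(\<lambda>x. g x f \<bullet> h) \<in> borel_measurable M"
  shows "has_bochner_integral M (\<lambda>x. g x f \<bullet> h) (T f \<bullet> h)"
proof -
  interpret \<phi>: bounded_linear "\<lambda>A :: 'h \<Rightarrow>\<^sub>L 'h. A f \<bullet> h"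
    by (intro bounded_linear_inner_left_comp blinfun.bounded_linear_left)
  obtain K where K: "\<And>A. norm (blinfun_apply A f \<bullet> h) \<le> norm A * K" "0 < K"
    using \<phi>.pos_bounded by blast
  from g obtain s where s: "\<And>i. Bochner_Integration.simple_bochner_integrable M (s i)"
    "(\<lambda>i. \<integral>\<^sup>+ y. ennreal (norm (g y - s i y)) \<partial>M) \<longlonglongrightarrow> 0"
    "(\<lambda>i. Bochner_Integration.simple_bochner_integral M (s i)) \<longlonglongrightarrow> T"
    unfolding has_strong_bochner_integral_def by blast
  define r where "r i x = s i x f \<bullet> h" for i x
  have int_r: "Bochner_Integration.simple_bochner_integrable M (r i)" for i
    using simple_bochner_integrable_compose2[of "\<lambda>A _. blinfun_apply A f \<bullet> h" M "s i" "s i"] s(1)[of i]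
    unfolding r_def by (simp add: blinfun.zero_left)
  have [measurable]: "r i \<in> borel_measurable M" for i
    using int_r[of i] by (auto intro: borel_measurable_simple_function elim: simple_bochner_integrable.cases)
  show ?thesis
  proof (rule has_bochner_integral.intros[where s=r])
    show "(\<lambda>i. \<integral>\<^sup>+ x. ennreal (norm (g x f \<bullet> h - r i x)) \<partial>M) \<longlonglongrightarrow> 0"
    proof (rule tendsto_sandwich[OF _ _ tendsto_const])
      show "(\<lambda>i. ennreal K * (\<integral>\<^sup>+ y. ennreal (norm (g y - s i y)) \<partial>M)) \<longlonglongrightarrow> 0"
        using ennreal_tendsto_cmult[OF _ s(2), of "ennreal K"] by simp
      have "(\<integral>\<^sup>+ x. ennreal (norm (g x f \<bullet> h - r i x)) \<partial>M) \<le> ennreal K * (\<integral>\<^sup>+ y. ennreal (norm (g y - s i y)) \<partial>M)" for i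
      proof (rule nn_integral_le_cmultI)
        fix x
        have "norm (g x f \<bullet> h - r i x) \<le> K * norm (g x - s i x)"
          using K(1)[of "g x - s i x"] by (simp add: r_def blinfun.diff_left inner_diff_left mult.commute)
        then show "ennreal (norm (g x f \<bullet> h - r i x)) \<le> ennreal K * ennreal (norm (g x - s i x))"
          using K(2) by (subst ennreal_mult[symmetric]) (auto intro!: ennreal_leI)
      qed (use K(2) in auto)
      then show "\<forall>\<^sub>F i in sequentially. (\<integral>\<^sup>+ x. ennreal (norm (g x f \<bullet> h - r i x)) \<partial>M) \<le>
          ennreal K * (\<integral>\<^sup>+ y. ennreal (norm (g y - s i y)) \<partial>M)" by simp
    qed simp
    have "Bochner_Integration.simple_bochner_integral M (r i) = Bochner_Integration.simple_bochner_integral M (s i) f \<bullet> h" for i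
      unfolding r_def by (rule simple_bochner_integral_linear[OF _ s(1)]) (rule \<phi>.linear_axioms)
    then show "(\<lambda>i. Bochner_Integration.simple_bochner_integral M (r i)) \<longlonglongrightarrow> T f \<bullet> h"
      using \<phi>.tendsto[OF s(3)] by simp
  qed (use int_r in measurable)
qed

text \<open>The value singled out by \<open>THE\<close> is unique because its matrix elements are
  ordinary integrals.\<close>

lemma strong_bochner_integral_eqI:
  fixes g :: "'a \<Rightarrow> 'h::real_inner \<Rightarrow>\<^sub>L 'h"
  assumes g: "has_strong_bochner_integral M g T"
    and meas: "\<And>f h. (\<lambda>x. g x f \<bullet> h) \<in> borel_measurable M"
  shows "strong_bochner_integral M g = T"
proof -
  have "T' = T" if "has_strong_bochner_integral M g T'" for T'
  proof (rule blinfun_eqI)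
    fix f
    show "T' f = T f"
      by (rule inner_eqI)
         (rule has_bochner_integral_eq[OF has_strong_bochner_integral_inner[OF that meas] has_strong_bochner_integral_inner[OF g meas]])
  qed
  then have "(THE x. has_strong_bochner_integral M g x) = T" using g by (rule the_equality[rotated])
  then show ?thesis using g by (auto simp: strong_bochner_integral_def strong_bochner_integrable_def)
qed

text \<open>Used under an integral to split off \<open>b\<close>: the truncated difference is
  measurable even where its majorant is not known to be.\<close>

lemma ennreal_le_diff_add: "(a :: ennreal) \<le> (a - b) + b"
proof (cases "b \<le> a")
  case True
  then show ?thesis by (simp add: diff_add_cancel_ennreal)
next
  case False
  then have "a \<le> b" by simp
  then show ?thesis by (rule order_trans) simp
qed

text \<open>For necessity, a single simple function at L1 distance below 1 suffices: a tensor square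
  has operator norm \<open>(norm (z x))\<^sup>2\<close>, so the reverse triangle inequality applies.
  The equivalence tells for each single path whether the Bochner integral is genuine.\<close>

lemma strong_bochner_integrable_tensor_iff:
  fixes z :: "'a \<Rightarrow> 'h::{real_inner, complete_space, second_countable_topology}"
  assumes z[measurable]: "z \<in> borel_measurable M"
  shows "strong_bochner_integrable M (\<lambda>x. tensor (z x) (z x)) \<longleftrightarrow> (\<integral>\<^sup>+ x. ennreal ((norm (z x))\<^sup>2) \<partial>M) < \<infinity>"
proof
  assume "strong_bochner_integrable M (\<lambda>x. tensor (z x) (z x))"
  then obtain s where s: "\<And>i. Bochner_Integration.simple_bochner_integrable M (s i)"
    and lim: "(\<lambda>i. \<integral>\<^sup>+ x. ennreal (norm (tensor (z x) (z x) - s i x)) \<partial>M) \<longlonglongrightarrow> 0"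
    unfolding strong_bochner_integrable_def has_strong_bochner_integral_def by blast
  from order_tendstoD(2)[OF lim, of 1] obtain i where i: "(\<integral>\<^sup>+ x. ennreal (norm (tensor (z x) (z x) - s i x)) \<partial>M) < 1"
    by (auto simp: eventually_sequentially)
  have norm_s: "Bochner_Integration.simple_bochner_integrable M (\<lambda>x. norm (s i x))"
    using simple_bochner_integrable_compose2[of "\<lambda>a _. norm a" M "s i" "s i"] s[of i] by simp
  have [measurable]: "(\<lambda>x. norm (s i x)) \<in> borel_measurable M"
    using norm_s by (auto intro: borel_measurable_simple_function elim: simple_bochner_integrable.cases)
  have fin_s: "(\<integral>\<^sup>+ x. ennreal (norm (s i x)) \<partial>M) < \<infinity>"
    using simple_bochner_integral_eq_nn_integral[OF norm_s] by (metis ennreal_less_top infinity_ennreal_def norm_ge_zero)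
  have "(\<integral>\<^sup>+ x. ennreal ((norm (z x))\<^sup>2) \<partial>M) \<le>
    (\<integral>\<^sup>+ x. (ennreal ((norm (z x))\<^sup>2) - ennreal (norm (s i x))) + ennreal (norm (s i x)) \<partial>M)"
    by (intro nn_integral_mono ennreal_le_diff_add)
  also have "\<dots> = (\<integral>\<^sup>+ x. ennreal ((norm (z x))\<^sup>2) - ennreal (norm (s i x)) \<partial>M) + (\<integral>\<^sup>+ x. ennreal (norm (s i x)) \<partial>M)"
    by (rule nn_integral_add) measurable
  also have "(\<integral>\<^sup>+ x. ennreal ((norm (z x))\<^sup>2) - ennreal (norm (s i x)) \<partial>M) \<le> (\<integral>\<^sup>+ x. ennreal (norm (tensor (z x) (z x) - s i x)) \<partial>M)"
  proof (rule nn_integral_mono)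
    fix x
    have "(norm (z x))\<^sup>2 - norm (s i x) \<le> norm (tensor (z x) (z x) - s i x)"
      using norm_triangle_ineq2[of "tensor (z x) (z x)" "s i x"] by (simp add: norm_tensor_self)
    then show "ennreal ((norm (z x))\<^sup>2) - ennreal (norm (s i x)) \<le> ennreal (norm (tensor (z x) (z x) - s i x))"
      by (simp add: ennreal_minus ennreal_leI)
  qed
  finally have "(\<integral>\<^sup>+ x. ennreal ((norm (z x))\<^sup>2) \<partial>M) \<le>
    (\<integral>\<^sup>+ x. ennreal (norm (tensor (z x) (z x) - s i x)) \<partial>M) + (\<integral>\<^sup>+ x. ennreal (norm (s i x)) \<partial>M)"
    by (simp add: add_right_mono)
  also have "\<dots> < \<infinity>" using fin_s order.strict_trans[OF i ennreal_one_less_top] by simp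
  finally show "(\<integral>\<^sup>+ x. ennreal ((norm (z x))\<^sup>2) \<partial>M) < \<infinity>" .
next
  assume "(\<integral>\<^sup>+ x. ennreal ((norm (z x))\<^sup>2) \<partial>M) < \<infinity>"
  then show "strong_bochner_integrable M (\<lambda>x. tensor (z x) (z x))"
    unfolding strong_bochner_integrable_def by (rule has_strong_bochner_integral_tensor[OF z])
qed

text \<open>The second branch is the default value of \<open>strong_bochner_integral\<close>; with
  it the quadratic form is known on every path and not only on almost every one.\<close>

lemma strong_bochner_integral_tensor:
  fixes z :: "'a \<Rightarrow> 'h::{real_inner, complete_space, second_countable_topology}"
  assumes z[measurable]: "z \<in> borel_measurable M"
  shows "strong_bochner_integral M (\<lambda>x. tensor (z x) (z x)) f \<bullet> f =
    (if (\<integral>\<^sup>+ x. ennreal ((norm (z x))\<^sup>2) \<partial>M) < \<infinity> then \<integral>x. (z x \<bullet> f)\<^sup>2 \<partial>M else 0)"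
proof (cases "(\<integral>\<^sup>+ x. ennreal ((norm (z x))\<^sup>2) \<partial>M) < \<infinity>")
  case True
  have meas: "(\<lambda>x. tensor (z x) (z x) f \<bullet> h) \<in> borel_measurable M" for f h
    unfolding tensor.rep_eq by measurable
  from has_strong_bochner_integral_tensor[OF z True] obtain T
    where T: "has_strong_bochner_integral M (\<lambda>x. tensor (z x) (z x)) T" by blast
  have "has_bochner_integral M (\<lambda>x. tensor (z x) (z x) f \<bullet> f) (T f \<bullet> f)"
    by (rule has_strong_bochner_integral_inner[OF T meas])
  then have "(\<integral>x. (z x \<bullet> f)\<^sup>2 \<partial>M) = T f \<bullet> f"
    by (simp add: has_bochner_integral_iff tensor.rep_eq power2_eq_square)
  then show ?thesis using True by (simp add: strong_bochner_integral_eqI[OF T meas])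
next
  case False
  then have "\<not> strong_bochner_integrable M (\<lambda>x. tensor (z x) (z x))"
    by (simp add: strong_bochner_integrable_tensor_iff)
  then show ?thesis using False by (simp add: strong_bochner_integral_def blinfun.zero_left)
qed

section \<open>Elementary stochastic integrals\<close>

lemma (in prob_space) indep_var_subalgebraI:
  assumes N: "subalgebra M N" "X \<in> measurable N S"
    and N': "subalgebra M N'" "Y \<in> measurable N' T"
    and indep: "\<And>A C. A \<in> sets N \<Longrightarrow> C \<in> sets N' \<Longrightarrow> prob (A \<inter> C) = prob A * prob C"
  shows "indep_var S X T Y"
proof -
  have sub: "sigma_sets (space M) {X -` A \<inter> space M | A. A \<in> sets S} \<subseteq> sets N"
    if "subalgebra M N" "X \<in> measurable N S" for N S and X :: "'a \<Rightarrow> 'x"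
  proof -
    have "sigma_sets (space N) {X -` A \<inter> space M | A. A \<in> sets S} \<subseteq> sets N"
      using that measurable_sets[OF that(2)] by (intro sets.sigma_sets_subset) (auto simp: subalgebra_def)
    then show ?thesis using that by (simp add: subalgebra_def)
  qed
  show ?thesis
    unfolding indep_var_eq indep_sets2_eq
  proof (intro conjI ballI)
    show "random_variable S X" "random_variable T Y"
      using measurable_from_subalg[OF N] measurable_from_subalg[OF N'] .
    show "sigma_sets (space M) {X -` A \<inter> space M | A. A \<in> sets S} \<subseteq> events"
      by (rule order_trans[OF sub[OF N]]) (use N(1) in \<open>simp add: subalgebra_def\<close>)
    show "sigma_sets (space M) {Y -` A \<inter> space M | A. A \<in> sets T} \<subseteq> events"
      by (rule order_trans[OF sub[OF N']]) (use N'(1) in \<open>simp add: subalgebra_def\<close>)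
  qed (use sub[OF N] sub[OF N'] indep in \<open>simp add: subset_iff\<close>)
qed

section \<open>Moments and characteristic function of a centred Gaussian variable\<close>

lemma (in prob_space) centred_normal:
  assumes \<xi>[measurable]: "\<xi> \<in> borel_measurable M" and "0 \<le> v"
    and distr: "distr M borel \<xi> =
      (if v = 0 then return borel 0 else density lborel (\<lambda>x. ennreal (normal_density 0 (sqrt v) x)))"
  shows centred_normal_square_integrable: "integrable M (\<lambda>\<omega>. (\<xi> \<omega>)\<^sup>2)"
    and centred_normal_expectation: "expectation \<xi> = 0"
    and centred_normal_variance: "expectation (\<lambda>\<omega>. (\<xi> \<omega>)\<^sup>2) = v"
    and centred_normal_char: "(\<integral>\<omega>. iexp (\<xi> \<omega>) \<partial>M) = complex_of_real (exp (- v / 2))"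
proof -
  have "integrable M (\<lambda>\<omega>. (\<xi> \<omega>)\<^sup>2) \<and> expectation \<xi> = 0 \<and> expectation (\<lambda>\<omega>. (\<xi> \<omega>)\<^sup>2) = v \<and>
    (\<integral>\<omega>. iexp (\<xi> \<omega>) \<partial>M) = complex_of_real (exp (- v / 2))"
  proof (cases "v = 0")
    case True
    have "distr M borel \<xi> = return borel 0" using distr True by simp
    moreover have "AE x in return borel (0::real). x = 0" by (subst AE_return) auto
    ultimately have "AE x in distr M borel \<xi>. x = 0" by (simp only:)
    then have AE0: "AE \<omega> in M. \<xi> \<omega> = 0" by (simp add: AE_distr_iff)
    have "integrable M (\<lambda>\<omega>. (\<xi> \<omega>)\<^sup>2)"
      using AE0 by (subst integrable_cong_AE[where g="\<lambda>_. 0"]) auto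
    moreover have "expectation \<xi> = expectation (\<lambda>_. 0)"
      using AE0 by (intro integral_cong_AE) auto
    moreover have "expectation (\<lambda>\<omega>. (\<xi> \<omega>)\<^sup>2) = expectation (\<lambda>_. 0)"
      using AE0 by (intro integral_cong_AE) auto
    moreover have "(\<integral>\<omega>. iexp (\<xi> \<omega>) \<partial>M) = (\<integral>\<omega>. 1 \<partial>M)"
      using AE0 by (intro integral_cong_AE) auto
    ultimately show ?thesis using True by (simp add: prob_space)
  next
    case False
    define \<sigma> where "\<sigma> = sqrt v"
    have \<sigma>: "0 < \<sigma>" "\<sigma>\<^sup>2 = v" using False \<open>0 \<le> v\<close> by (auto simp: \<sigma>_def)
    have D: "distr M borel \<xi> = density lborel (\<lambda>x. ennreal (normal_density 0 \<sigma> x))"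
      using distr False by (simp add: \<sigma>_def)
    have int_iff: "integrable M (\<lambda>\<omega>. g (\<xi> \<omega>)) \<longleftrightarrow> integrable lborel (\<lambda>x. normal_density 0 \<sigma> x * g x)"
      if [measurable]: "g \<in> borel_measurable borel" for g :: "real \<Rightarrow> real"
      by (subst integrable_distr_eq[symmetric, of \<xi> M borel g])
         (auto simp: D integrable_real_density)
    have int_eq: "expectation (\<lambda>\<omega>. g (\<xi> \<omega>)) = (\<integral>x. normal_density 0 \<sigma> x * g x \<partial>lborel)"
      if [measurable]: "g \<in> borel_measurable borel" for g :: "real \<Rightarrow> real"
      by (subst integral_distr[symmetric, of \<xi> M borel g])
         (auto simp: D integral_real_density)
    have "integrable M (\<lambda>\<omega>. (\<xi> \<omega>)\<^sup>2)"
      using int_iff[of "\<lambda>x. x\<^sup>2"] integrable_normal_moment[OF \<sigma>(1), of 0 2] by simp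
    moreover have "expectation \<xi> = 0"
      using int_eq[of "\<lambda>x. x"] integral_normal_moment_nz_1[OF \<sigma>(1), of 0] by simp
    moreover have "expectation (\<lambda>\<omega>. (\<xi> \<omega>)\<^sup>2) = v"
      using int_eq[of "\<lambda>x. x\<^sup>2"] integral_normal_moment_even[OF \<sigma>(1), of 0 1] \<sigma> by (simp add: fact_numeral)
    moreover have "(\<integral>\<omega>. iexp (\<xi> \<omega>) \<partial>M) = complex_of_real (exp (- v / 2))"
    proof -
      have "distributed M lborel \<xi> (normal_density 0 \<sigma>)"
        unfolding distributed_def using D distr_cong[of M M borel lborel \<xi> \<xi>] by simp
      \<comment> \<open>Standardise: the characteristic function of \<xi> at 1 is that of the
        standard normal law at \<sigma>.\<close>
      then have *: "distributed M lborel (\<lambda>x. (\<xi> x - 0) / \<sigma>) std_normal_density"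
        using normal_standard_normal_convert[OF \<sigma>(1)] by blast
      have std: "distr M borel (\<lambda>x. \<xi> x / \<sigma>) = std_normal_distribution"
        using distributed_distr_eq_density[OF *] distr_cong[of M M borel lborel "\<lambda>x. \<xi> x / \<sigma>" "\<lambda>x. \<xi> x / \<sigma>"] by simp
      have "(\<integral>\<omega>. iexp (\<xi> \<omega>) \<partial>M) = (\<integral>\<omega>. iexp (\<sigma> * (\<xi> \<omega> / \<sigma>)) \<partial>M)" using \<sigma> by simp
      also have "\<dots> = char (distr M borel (\<lambda>x. \<xi> x / \<sigma>)) \<sigma>"
        unfolding char_def by (subst integral_distr) auto
      also have "\<dots> = complex_of_real (exp (- v / 2))"
        unfolding std char_std_normal_distribution by (simp add: \<sigma>)
      finally show ?thesis .
    qed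
    ultimately show ?thesis by blast
  qed
  then show "integrable M (\<lambda>\<omega>. (\<xi> \<omega>)\<^sup>2)" "expectation \<xi> = 0" "expectation (\<lambda>\<omega>. (\<xi> \<omega>)\<^sup>2) = v"
    "(\<integral>\<omega>. iexp (\<xi> \<omega>) \<partial>M) = complex_of_real (exp (- v / 2))" by blast+
qed

lemma partition_mono:
  fixes \<tau> :: "nat \<Rightarrow> 'b::preorder"
  assumes "\<And>i. i < n \<Longrightarrow> \<tau> i \<le> \<tau> (Suc i)" and ij: "i \<le> j" "j \<le> n"
  shows "\<tau> i \<le> \<tau> j"
  using ij
proof (induction rule: dec_induct)
  case (step k)
  then have "\<tau> i \<le> \<tau> k" by simp
  also have "\<dots> \<le> \<tau> (Suc k)" using step assms(1) by simp
  finally show ?case .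
qed simp

text \<open>Interpreted for both W and B over the same filtration: for W to place Y in \<sigma>(W),
  for B to treat X(t).\<close>

locale wiener = prob_space M for M :: "'a measure" +
  fixes F :: "real \<Rightarrow> 'a measure"
    and Q :: "'h::{real_inner, complete_space, second_countable_topology} \<Rightarrow>\<^sub>L 'h"
    and W :: "real \<Rightarrow> 'a \<Rightarrow> 'h"
  assumes filtered: "filtered_prob_space M F"
    and wiener_process: "wiener_process M F Q W"
begin

lemma covariance: "covariance_op Q"
  using wiener_process by (simp add: wiener_process_def)

lemma subalgebra_F: "0 \<le> s \<Longrightarrow> subalgebra M (F s)"
  using filtered by (simp add: filtered_prob_space_def)

lemma space_F: "0 \<le> s \<Longrightarrow> space (F s) = space M"
  using subalgebra_F by (auto simp: subalgebra_def)

lemma sets_F_mono: "0 \<le> s \<Longrightarrow> s \<le> t \<Longrightarrow> sets (F s) \<subseteq> sets (F t)"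
  using filtered unfolding filtered_prob_space_def by blast

lemma sets_F: "0 \<le> s \<Longrightarrow> sets (F s) \<subseteq> sets M"
  using subalgebra_F by (auto simp: subalgebra_def)

lemma measurable_F_M: "0 \<le> s \<Longrightarrow> X \<in> measurable (F s) S \<Longrightarrow> X \<in> measurable M S"
  using measurable_from_subalg subalgebra_F by blast

lemma subalgebra_F_F: "0 \<le> s \<Longrightarrow> s \<le> t \<Longrightarrow> subalgebra (F t) (F s)"
  using sets_F_mono[of s t] space_F[of s] space_F[of t] by (auto simp: subalgebra_def)

lemma W_measurable_F: "0 \<le> s \<Longrightarrow> s \<le> t \<Longrightarrow> W s \<in> borel_measurable (F t)"
  using wiener_process measurable_from_subalg[OF subalgebra_F_F] unfolding wiener_process_def adapted_process_def by blast

lemma W_measurable[measurable]: "0 \<le> s \<Longrightarrow> W s \<in> borel_measurable M"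
  using W_measurable_F[of s s] measurable_F_M by blast

section \<open>Increments tested with a vector, and their second moments\<close>

definition incr :: "real \<Rightarrow> real \<Rightarrow> 'h \<Rightarrow> 'a \<Rightarrow> real" where
  "incr s t v \<omega> = v \<bullet> (W t \<omega> - W s \<omega>)"

lemma incr_measurable_F: "0 \<le> s \<Longrightarrow> s \<le> t \<Longrightarrow> t \<le> u \<Longrightarrow> incr s t v \<in> borel_measurable (F u)"
  unfolding incr_def
  by (intro borel_measurable_inner borel_measurable_const borel_measurable_diff W_measurable_F) auto

lemma incr_measurable[measurable]: "0 \<le> s \<Longrightarrow> s \<le> t \<Longrightarrow> incr s t v \<in> borel_measurable M"
  unfolding incr_def
  by (intro borel_measurable_inner borel_measurable_const borel_measurable_diff W_measurable) auto

lemma incr_split: "incr s u v \<omega> = incr s t v \<omega> + incr t u v \<omega>"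
  by (simp add: incr_def inner_diff_right)

lemma Q_nonneg: "0 \<le> Q v \<bullet> v"
  using covariance by (auto simp: covariance_op_def nonnegative_op_def)

lemma Q_sym: "Q v \<bullet> w = Q w \<bullet> v"
  using covariance by (auto simp: covariance_op_def symmetric_op_def inner_commute)

lemma incr_distr:
  assumes "0 \<le> s" "s \<le> t"
  shows "distr M borel (incr s t v) = (if (t - s) * (Q v \<bullet> v) = 0 then return borel 0
    else density lborel (\<lambda>x. ennreal (normal_density 0 (sqrt ((t - s) * (Q v \<bullet> v))) x)))"
proof -
  have "centred_gaussian M (\<lambda>\<omega>. W t \<omega> - W s \<omega>) ((t - s) *\<^sub>R Q)"
    using wiener_process assms unfolding wiener_process_def by blast
  from this[unfolded centred_gaussian_def, THEN conjunct2, THEN spec, of v]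
  show ?thesis
    by (simp only: incr_def[abs_def] inner_commute[of v] blinfun.scaleR_left inner_scaleR_left)
qed

lemma
  assumes "0 \<le> s" "s \<le> t"
  shows incr_square_integrable: "integrable M (\<lambda>\<omega>. (incr s t v \<omega>)\<^sup>2)"
    and incr_expectation: "expectation (incr s t v) = 0"
    and incr_variance: "expectation (\<lambda>\<omega>. (incr s t v \<omega>)\<^sup>2) = (t - s) * (Q v \<bullet> v)"
    and incr_char: "(\<integral>\<omega>. iexp (incr s t v \<omega>) \<partial>M) = complex_of_real (exp (- ((t - s) * (Q v \<bullet> v)) / 2))"
  using centred_normal[OF incr_measurable[OF assms] _ incr_distr[OF assms]] assms Q_nonneg
  by auto

lemma integrable_if_square_integrable:
  fixes X :: "'a \<Rightarrow> real"
  assumes "X \<in> borel_measurable M" "integrable M (\<lambda>\<omega>. (X \<omega>)\<^sup>2)"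
  shows "integrable M X"
  using square_integrable_imp_integrable assms by blast

lemma incr_integrable: "0 \<le> s \<Longrightarrow> s \<le> t \<Longrightarrow> integrable M (incr s t v)"
  by (rule integrable_if_square_integrable[OF incr_measurable incr_square_integrable])

lemma incr_indep:
  assumes s: "0 \<le> s" "s \<le> t" and X: "X \<in> borel_measurable (F s)"
  shows "indep_var borel X borel (incr s t v)"
proof (rule indep_var_subalgebraI[OF subalgebra_F X])
  let ?D = "\<lambda>\<omega>. W t \<omega> - W s \<omega>"
  let ?N = "vimage_algebra (space M) ?D borel"
  have D: "?D \<in> borel_measurable M" using s by (intro borel_measurable_diff W_measurable) auto
  show "subalgebra M ?N"
    using measurable_sets[OF D] by (auto simp: subalgebra_def sets_vimage_algebra2)
  have "?D \<in> measurable ?N borel" by (rule measurable_vimage_algebra1) auto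
  then show "incr s t v \<in> borel_measurable ?N" unfolding incr_def by measurable
  fix A C assume "A \<in> sets (F s)" "C \<in> sets ?N"
  then show "prob (A \<inter> C) = prob A * prob C"
    using wiener_process s unfolding wiener_process_def indep_sets2_eq by (auto simp: sets_vimage_algebra2)
qed (use s in auto)

lemma product_integrable:
  fixes X Y :: "'a \<Rightarrow> real"
  assumes [measurable]: "X \<in> borel_measurable M" "Y \<in> borel_measurable M"
    and "integrable M (\<lambda>\<omega>. (X \<omega>)\<^sup>2)" "integrable M (\<lambda>\<omega>. (Y \<omega>)\<^sup>2)"
  shows "integrable M (\<lambda>\<omega>. X \<omega> * Y \<omega>)"
proof (rule Bochner_Integration.integrable_bound)
  show "integrable M (\<lambda>\<omega>. (X \<omega>)\<^sup>2 + (Y \<omega>)\<^sup>2)" using assms by auto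
  have "\<bar>a * b\<bar> \<le> a\<^sup>2 + b\<^sup>2" for a b :: real
  proof -
    have "2 * \<bar>a\<bar> * \<bar>b\<bar> \<le> \<bar>a\<bar>\<^sup>2 + \<bar>b\<bar>\<^sup>2" by (rule sum_squares_bound)
    moreover have "0 \<le> \<bar>a\<bar> * \<bar>b\<bar>" by simp
    ultimately show ?thesis unfolding abs_mult power2_abs by linarith
  qed
  then show "AE \<omega> in M. norm (X \<omega> * Y \<omega>) \<le> norm ((X \<omega>)\<^sup>2 + (Y \<omega>)\<^sup>2)" by auto
qed measurable

lemma incr_product_integrable:
  assumes "0 \<le> a" "a \<le> b" "0 \<le> c" "c \<le> d" "A \<in> sets M"
  shows "integrable M (\<lambda>\<omega>. indicator A \<omega> * (incr a b v \<omega> * incr c d w \<omega>))"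
proof -
  have "integrable M (\<lambda>\<omega>. incr a b v \<omega> * incr c d w \<omega>)"
    by (rule product_integrable[OF incr_measurable incr_measurable incr_square_integrable incr_square_integrable])
       (use assms in auto)
  from integrable_mult_indicator[OF assms(5) this] show ?thesis by simp
qed

text \<open>Everything except the later increment is known at time \<open>c\<close>; that increment
  is centred and independent of the past.\<close>

lemma expectation_incr_disjoint:
  assumes "0 \<le> a" "a \<le> b" "b \<le> c" "c \<le> d" and A: "A \<in> sets (F c)"
  shows "expectation (\<lambda>\<omega>. indicator A \<omega> * (incr a b v \<omega> * incr c d w \<omega>)) = 0"
proof -
  have c: "0 \<le> c" using assms by linarith
  have AM: "A \<in> sets M" using A sets_F[OF c] by blast
  have 1: "(\<lambda>\<omega>. indicator A \<omega> * incr a b v \<omega>) \<in> borel_measurable (F c)"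
    using A incr_measurable_F[of a b c v] assms by measurable
  have 2: "integrable M (\<lambda>\<omega>. indicator A \<omega> * incr a b v \<omega>)"
    using integrable_mult_indicator[OF AM incr_integrable[of a b v]] assms by simp
  have "expectation (\<lambda>\<omega>. (indicator A \<omega> * incr a b v \<omega>) * incr c d w \<omega>) =
      expectation (\<lambda>\<omega>. indicator A \<omega> * incr a b v \<omega>) * expectation (incr c d w)"
    using assms c by (intro indep_var_lebesgue_integral incr_indep 1 2 incr_integrable)
  then show ?thesis using assms c by (simp add: incr_expectation mult.assoc)
qed

text \<open>Independence of the past settles the squares. Mixed products follow by polarisation,
  since \<open>centred_gaussian\<close> describes the law in one direction at a time.\<close>

lemma expectation_incr_same:
  assumes "0 \<le> s" "s \<le> t" and A: "A \<in> sets (F s)"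
  shows "expectation (\<lambda>\<omega>. indicator A \<omega> * (incr s t v \<omega> * incr s t w \<omega>)) = prob A * ((t - s) * (Q v \<bullet> w))"
proof -
  have AM: "A \<in> sets M" using A sets_F[OF assms(1)] by blast
  have sq: "expectation (\<lambda>\<omega>. indicator A \<omega> * (incr s t v \<omega>)\<^sup>2) = prob A * ((t - s) * (Q v \<bullet> v))" for v
  proof -
    have "indep_var borel (indicator A :: _ \<Rightarrow> real) borel (\<lambda>\<omega>. (incr s t v \<omega>)\<^sup>2)"
      using indep_var_compose[OF incr_indep[OF assms(1,2), of "indicator A" v], of id borel "\<lambda>x. x\<^sup>2" borel] A
      by (simp add: comp_def id_def)
    from indep_var_lebesgue_integral[OF this _ incr_square_integrable[OF assms(1,2)]]
    show ?thesis using AM by (simp add: incr_variance[OF assms(1,2)] integrable_indicator_iff emeasure_eq_measure)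
  qed
  have sqi: "integrable M (\<lambda>\<omega>. indicator A \<omega> * (incr s t v \<omega>)\<^sup>2)" for v
    using integrable_mult_indicator[OF AM incr_square_integrable[OF assms(1,2), of v]] by simp
  have eq: "indicator A \<omega> * (incr s t v \<omega> * incr s t w \<omega>) =
    (indicator A \<omega> * (incr s t (v + w) \<omega>)\<^sup>2 - indicator A \<omega> * (incr s t v \<omega>)\<^sup>2 - indicator A \<omega> * (incr s t w \<omega>)\<^sup>2) / 2" for \<omega>
    by (simp add: incr_def inner_add_left power2_eq_square algebra_simps)
  have "expectation (\<lambda>\<omega>. indicator A \<omega> * (incr s t v \<omega> * incr s t w \<omega>)) =
     (prob A * ((t - s) * (Q (v + w) \<bullet> (v + w))) - prob A * ((t - s) * (Q v \<bullet> v)) - prob A * ((t - s) * (Q w \<bullet> w))) / 2"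
    by (subst eq) (simp add: sq sqi)
  also have "Q (v + w) \<bullet> (v + w) = Q v \<bullet> v + 2 * (Q v \<bullet> w) + Q w \<bullet> w"
    using Q_sym[of w v] by (simp add: blinfun.add_right inner_add_left inner_add_right)
  finally show ?thesis by (simp add: algebra_simps)
qed

text \<open>The length of the intersection of (a, b] and (c, d].\<close>

definition overlap :: "real \<Rightarrow> real \<Rightarrow> real \<Rightarrow> real \<Rightarrow> real" where
  "overlap a b c d = max 0 (min b d - max a c)"

lemma expectation_incr_same_start:
  assumes "0 \<le> s" "s \<le> t" "t \<le> u" and A: "A \<in> sets (F s)"
  shows "expectation (\<lambda>\<omega>. indicator A \<omega> * (incr s t v \<omega> * incr s u w \<omega>)) = prob A * ((t - s) * (Q v \<bullet> w))"
proof -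
  have A': "A \<in> sets (F t)" "A \<in> sets M" using A sets_F_mono[of s t] sets_F[of s] assms by auto
  have "expectation (\<lambda>\<omega>. indicator A \<omega> * (incr s t v \<omega> * incr s u w \<omega>)) =
    expectation (\<lambda>\<omega>. indicator A \<omega> * (incr s t v \<omega> * incr s t w \<omega>) + indicator A \<omega> * (incr s t v \<omega> * incr t u w \<omega>))"
    by (subst incr_split[of s u w _ t]) (simp add: algebra_simps)
  also have "\<dots> = expectation (\<lambda>\<omega>. indicator A \<omega> * (incr s t v \<omega> * incr s t w \<omega>)) +
      expectation (\<lambda>\<omega>. indicator A \<omega> * (incr s t v \<omega> * incr t u w \<omega>))"
    using assms A' by (intro Bochner_Integration.integral_add incr_product_integrable) auto
  finally show ?thesis
    using assms A' by (simp add: expectation_incr_same expectation_incr_disjoint)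
qed

text \<open>Cutting the first increment at \<open>c\<close> removes a part that contributes nothing
  and leaves two increments with a common start.\<close>

lemma expectation_incr_ordered:
  assumes "0 \<le> a" "a \<le> b" "a \<le> c" "c \<le> d" and A: "A \<in> sets (F c)"
  shows "expectation (\<lambda>\<omega>. indicator A \<omega> * (incr a b v \<omega> * incr c d w \<omega>)) = prob A * (overlap a b c d * (Q v \<bullet> w))"
proof (cases "b \<le> c")
  case True
  then show ?thesis using assms by (simp add: expectation_incr_disjoint overlap_def)
next
  case False
  have AM: "A \<in> sets M" using A sets_F[of c] assms by auto
  have "expectation (\<lambda>\<omega>. indicator A \<omega> * (incr a b v \<omega> * incr c d w \<omega>)) =
    expectation (\<lambda>\<omega>. indicator A \<omega> * (incr a c v \<omega> * incr c d w \<omega>) + indicator A \<omega> * (incr c b v \<omega> * incr c d w \<omega>))"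
    by (subst incr_split[of a b v _ c]) (simp add: algebra_simps)
  also have "\<dots> = expectation (\<lambda>\<omega>. indicator A \<omega> * (incr a c v \<omega> * incr c d w \<omega>)) +
      expectation (\<lambda>\<omega>. indicator A \<omega> * (incr c b v \<omega> * incr c d w \<omega>))"
    using assms AM False by (intro Bochner_Integration.integral_add incr_product_integrable) auto
  also have "expectation (\<lambda>\<omega>. indicator A \<omega> * (incr a c v \<omega> * incr c d w \<omega>)) = 0"
    using assms by (intro expectation_incr_disjoint) auto
  also have "expectation (\<lambda>\<omega>. indicator A \<omega> * (incr c b v \<omega> * incr c d w \<omega>)) = prob A * (overlap a b c d * (Q v \<bullet> w))"
  proof (cases "b \<le> d")
    case True
    then show ?thesis using assms False by (simp add: expectation_incr_same_start overlap_def)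
  next
    case False': False
    have "expectation (\<lambda>\<omega>. indicator A \<omega> * (incr c d w \<omega> * incr c b v \<omega>)) = prob A * ((d - c) * (Q w \<bullet> v))"
      using assms False' by (intro expectation_incr_same_start) auto
    then show ?thesis using assms False False' Q_sym[of v w] by (simp add: overlap_def mult.commute)
  qed
  finally show ?thesis by simp
qed

lemma overlap_commute: "overlap a b c d = overlap c d a b"
  by (simp add: overlap_def min.commute max.commute)

lemma expectation_incr:
  assumes "0 \<le> a" "a \<le> b" "0 \<le> c" "c \<le> d" and A: "A \<in> sets (F a)" and C: "C \<in> sets (F c)"
  shows "expectation (\<lambda>\<omega>. indicator (A \<inter> C) \<omega> * (incr a b v \<omega> * incr c d w \<omega>)) = prob (A \<inter> C) * (overlap a b c d * (Q v \<bullet> w))"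
proof (cases "a \<le> c")
  case True
  then have "A \<inter> C \<in> sets (F c)" using A C sets_F_mono[of a c] assms by auto
  then show ?thesis using True assms by (intro expectation_incr_ordered) auto
next
  case False
  then have "A \<inter> C \<in> sets (F a)" using A C sets_F_mono[of c a] assms by auto
  then have "expectation (\<lambda>\<omega>. indicator (A \<inter> C) \<omega> * (incr c d w \<omega> * incr a b v \<omega>)) = prob (A \<inter> C) * (overlap c d a b * (Q w \<bullet> v))"
    using False assms by (intro expectation_incr_ordered) auto
  then show ?thesis using Q_sym[of v w] overlap_commute[of c d a b] by (simp add: mult.commute)
qed

section \<open>Ito isometry for simple integrands\<close>

lemma
  assumes ab: "0 \<le> a" "a \<le> b" "0 \<le> c" "c \<le> d"
    and x: "simple_function (F a) x" and y: "simple_function (F c) y"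
  shows integrable_incr_simple: "integrable M (\<lambda>\<omega>. incr a b (x \<omega>) \<omega> * incr c d (y \<omega>) \<omega>)"
    and integrable_Q_simple: "integrable M (\<lambda>\<omega>. Q (x \<omega>) \<bullet> y \<omega>)"
    and expectation_incr_simple: "expectation (\<lambda>\<omega>. incr a b (x \<omega>) \<omega> * incr c d (y \<omega>) \<omega>) =
      overlap a b c d * expectation (\<lambda>\<omega>. Q (x \<omega>) \<bullet> y \<omega>)"
proof -
  define V where "V = x ` space M"
  define V' where "V' = y ` space M"
  define A where "A v = x -` {v} \<inter> space M" for v
  define C where "C w = y -` {w} \<inter> space M" for w
  have A: "A v \<in> sets (F a)" for v
    using simple_functionD(2)[OF x, of "{v}"] ab by (simp add: A_def space_F)
  have C: "C v \<in> sets (F c)" for v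
    using simple_functionD(2)[OF y, of "{v}"] ab by (simp add: C_def space_F)
  have AC: "A v \<inter> C w \<in> sets M" for v w using A[of v] C[of w] sets_F ab by blast
  have expand: "g (x \<omega>) (y \<omega>) = (\<Sum>v\<in>V. \<Sum>w\<in>V'. indicator (A v \<inter> C w) \<omega> * g v w)"
    if \<omega>: "\<omega> \<in> space M" for g :: "'h \<Rightarrow> 'h \<Rightarrow> real" and \<omega>
  proof -
    have "g (x \<omega>) (y \<omega>) = (\<Sum>v\<in>V. indicator (A v) \<omega> * g v (y \<omega>))"
      using simple_function_sum_indicator[OF x, of \<omega> "\<lambda>v. g v (y \<omega>)"] \<omega> ab by (simp add: V_def A_def space_F)
    also have "\<dots> = (\<Sum>v\<in>V. indicator (A v) \<omega> * (\<Sum>w\<in>V'. indicator (C w) \<omega> * g v w))"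
      using simple_function_sum_indicator[OF y, of \<omega> "\<lambda>w. g _ w"] \<omega> ab by (simp add: V'_def C_def space_F)
    finally show ?thesis by (simp add: sum_distrib_left indicator_inter_arith mult.assoc)
  qed
  note int = incr_product_integrable[OF ab AC]
  have e1: "expectation (\<lambda>\<omega>. incr a b (x \<omega>) \<omega> * incr c d (y \<omega>) \<omega>) =
    expectation (\<lambda>\<omega>. \<Sum>v\<in>V. \<Sum>w\<in>V'. indicator (A v \<inter> C w) \<omega> * (incr a b v \<omega> * incr c d w \<omega>))"
    by (intro Bochner_Integration.integral_cong refl expand[of _ "\<lambda>v w. incr a b v _ * incr c d w _"])
  show "integrable M (\<lambda>\<omega>. incr a b (x \<omega>) \<omega> * incr c d (y \<omega>) \<omega>)"
    by (subst Bochner_Integration.integrable_cong[OF refl expand[of _ "\<lambda>v w. incr a b v _ * incr c d w _"]], assumption)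
       (intro Bochner_Integration.integrable_sum int)
  have intQ: "integrable M (\<lambda>\<omega>. indicator (A v \<inter> C w) \<omega> * (Q v \<bullet> w))" for v w
    using AC by (intro integrable_mult_left integrable_real_indicator) (auto simp: emeasure_eq_measure)
  show "integrable M (\<lambda>\<omega>. Q (x \<omega>) \<bullet> y \<omega>)"
    by (subst Bochner_Integration.integrable_cong[OF refl expand[of _ "\<lambda>v w. Q v \<bullet> w"]], assumption)
       (intro Bochner_Integration.integrable_sum intQ)
  have e2: "expectation (\<lambda>\<omega>. Q (x \<omega>) \<bullet> y \<omega>) = expectation (\<lambda>\<omega>. \<Sum>v\<in>V. \<Sum>w\<in>V'. indicator (A v \<inter> C w) \<omega> * (Q v \<bullet> w))"
    by (intro Bochner_Integration.integral_cong refl expand)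
  have "expectation (\<lambda>\<omega>. incr a b (x \<omega>) \<omega> * incr c d (y \<omega>) \<omega>) =
     (\<Sum>v\<in>V. \<Sum>w\<in>V'. prob (A v \<inter> C w) * (overlap a b c d * (Q v \<bullet> w)))"
    unfolding e1 by (simp add: int expectation_incr[OF ab A C] del: indicator_simps)
  also have "\<dots> = overlap a b c d * (\<Sum>v\<in>V. \<Sum>w\<in>V'. prob (A v \<inter> C w) * (Q v \<bullet> w))"
    by (simp add: sum_distrib_left mult.left_commute)
  also have "(\<Sum>v\<in>V. \<Sum>w\<in>V'. prob (A v \<inter> C w) * (Q v \<bullet> w)) = expectation (\<lambda>\<omega>. Q (x \<omega>) \<bullet> y \<omega>)"
    unfolding e2 using intQ AC by simp
  finally show "expectation (\<lambda>\<omega>. incr a b (x \<omega>) \<omega> * incr c d (y \<omega>) \<omega>) =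
      overlap a b c d * expectation (\<lambda>\<omega>. Q (x \<omega>) \<bullet> y \<omega>)" .
qed

lemma overlap_measure:
  assumes "a \<le> b" "c \<le> d"
  shows "has_bochner_integral lborel (\<lambda>s. indicator {a<..b} s * indicator {c<..d} s) (overlap a b c d)"
proof -
  have emeasure_Ioc_finite: "emeasure lborel {l<..u} < \<infinity>" for l u :: real
    by (cases "l \<le> u") simp_all
  have "{a<..b} \<inter> {c<..d} = {max a c<..min b d}" by auto
  moreover have "measure lborel {l<..u} = max 0 (u - l)" for l u :: real
    by (cases "l \<le> u") (simp_all add: measure_def)
  ultimately have "has_bochner_integral lborel (indicator ({a<..b} \<inter> {c<..d})) (overlap a b c d)"
    using has_bochner_integral_real_indicator[OF _ emeasure_Ioc_finite, of "max a c" "min b d"]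
    by (simp add: overlap_def)
  then show ?thesis unfolding indicator_inter_arith .
qed

text \<open>The intervals may overlap arbitrarily: both sides expand into the same double sum over
  pairs, weighted with \<open>overlap\<close>. So the difference of two elementary processes on
  unrelated grids is covered without a common refinement.\<close>

lemma ito_isometry:
  assumes "finite I" and ab: "\<And>i. i \<in> I \<Longrightarrow> 0 \<le> a i \<and> a i \<le> b i"
    and x: "\<And>i. i \<in> I \<Longrightarrow> simple_function (F (a i)) (x i)"
  shows "(\<integral>\<^sup>+ \<omega>. ennreal ((\<Sum>i\<in>I. x i \<omega> \<bullet> (W (b i) \<omega> - W (a i) \<omega>))\<^sup>2) \<partial>M) =
    (\<integral>\<^sup>+ \<omega>. (\<integral>\<^sup>+ s. ennreal ((norm (sqrt_op Q (\<Sum>i\<in>I. indicator {a i<..b i} s *\<^sub>R x i \<omega>)))\<^sup>2) \<partial>lborel) \<partial>M)"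
proof -
  have int: "integrable M (\<lambda>\<omega>. incr (a i) (b i) (x i \<omega>) \<omega> * incr (a j) (b j) (x j \<omega>) \<omega>)"
    "integrable M (\<lambda>\<omega>. Q (x i \<omega>) \<bullet> x j \<omega>)"
    "expectation (\<lambda>\<omega>. incr (a i) (b i) (x i \<omega>) \<omega> * incr (a j) (b j) (x j \<omega>) \<omega>) =
      overlap (a i) (b i) (a j) (b j) * expectation (\<lambda>\<omega>. Q (x i \<omega>) \<bullet> x j \<omega>)" if "i \<in> I" "j \<in> I" for i j
    using ab[OF that(1)] ab[OF that(2)] x[OF that(1)] x[OF that(2)]
    by (auto intro: integrable_incr_simple integrable_Q_simple expectation_incr_simple)
  define K where "K = (\<Sum>i\<in>I. \<Sum>j\<in>I. overlap (a i) (b i) (a j) (b j) * expectation (\<lambda>\<omega>. Q (x i \<omega>) \<bullet> x j \<omega>))"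
  have sq: "(\<Sum>i\<in>I. x i \<omega> \<bullet> (W (b i) \<omega> - W (a i) \<omega>))\<^sup>2 =
     (\<Sum>i\<in>I. \<Sum>j\<in>I. incr (a i) (b i) (x i \<omega>) \<omega> * incr (a j) (b j) (x j \<omega>) \<omega>)" for \<omega>
    by (simp add: power2_eq_square sum_product incr_def)
  have "has_bochner_integral M (\<lambda>\<omega>. (\<Sum>i\<in>I. x i \<omega> \<bullet> (W (b i) \<omega> - W (a i) \<omega>))\<^sup>2) K"
    unfolding sq K_def
    by (intro has_bochner_integral_sum) (simp add: has_bochner_integral_iff int)
  then have 1: "(\<integral>\<^sup>+ \<omega>. ennreal ((\<Sum>i\<in>I. x i \<omega> \<bullet> (W (b i) \<omega> - W (a i) \<omega>))\<^sup>2) \<partial>M) = ennreal K"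
    by (subst nn_integral_eq_integral) (auto simp: has_bochner_integral_iff)
  define k where "k \<omega> = (\<Sum>i\<in>I. \<Sum>j\<in>I. overlap (a i) (b i) (a j) (b j) * (Q (x i \<omega>) \<bullet> x j \<omega>))" for \<omega>
  have inner: "(\<integral>\<^sup>+ s. ennreal ((norm (sqrt_op Q (\<Sum>i\<in>I. indicator {a i<..b i} s *\<^sub>R x i \<omega>)))\<^sup>2) \<partial>lborel) = ennreal (k \<omega>)"
    and k_nonneg: "0 \<le> k \<omega>" for \<omega>
  proof -
    have norm_eq: "(norm (sqrt_op Q (\<Sum>i\<in>I. indicator {a i<..b i} s *\<^sub>R x i \<omega>)))\<^sup>2 =
      (\<Sum>i\<in>I. \<Sum>j\<in>I. (indicator {a i<..b i} s * indicator {a j<..b j} s) * (Q (x i \<omega>) \<bullet> x j \<omega>))" for s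
      unfolding power2_norm_eq_inner sqrt_op_inner[OF covariance]
      by (simp add: blinfun.sum_right blinfun.scaleR_right inner_sum_left inner_sum_right sum_distrib_left mult.assoc
            del: indicator_simps) (intro sum.cong refl, subst Q_sym, rule refl)
    have "has_bochner_integral lborel (\<lambda>s. (norm (sqrt_op Q (\<Sum>i\<in>I. indicator {a i<..b i} s *\<^sub>R x i \<omega>)))\<^sup>2) (k \<omega>)"
      unfolding norm_eq k_def
      by (intro has_bochner_integral_sum has_bochner_integral_mult_left overlap_measure) (use ab in auto)
    then have k: "integrable lborel (\<lambda>s. (norm (sqrt_op Q (\<Sum>i\<in>I. indicator {a i<..b i} s *\<^sub>R x i \<omega>)))\<^sup>2)"
      "(\<integral>s. (norm (sqrt_op Q (\<Sum>i\<in>I. indicator {a i<..b i} s *\<^sub>R x i \<omega>)))\<^sup>2 \<partial>lborel) = k \<omega>"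
      by (simp_all only: has_bochner_integral_iff)
    show "(\<integral>\<^sup>+ s. ennreal ((norm (sqrt_op Q (\<Sum>i\<in>I. indicator {a i<..b i} s *\<^sub>R x i \<omega>)))\<^sup>2) \<partial>lborel) = ennreal (k \<omega>)"
      by (subst nn_integral_eq_integral[OF k(1)]) (simp_all only: k(2), simp)
    show "0 \<le> k \<omega>" unfolding k(2)[symmetric] by (intro Bochner_Integration.integral_nonneg) simp
  qed
  have "has_bochner_integral M k K"
    unfolding k_def K_def
    by (intro has_bochner_integral_sum has_bochner_integral_mult_right) (simp add: has_bochner_integral_iff int)
  then have "(\<integral>\<^sup>+ \<omega>. ennreal (k \<omega>) \<partial>M) = ennreal K"
    using k_nonneg by (subst nn_integral_eq_integral) (auto simp: has_bochner_integral_iff)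
  then show ?thesis by (simp add: 1 inner)
qed

section \<open>Characteristic functions when the integrand is independent of the process\<close>

lemma subalgebra_generated_sigma: "subalgebra M (generated_sigma M W {0..})"
proof -
  have "(\<Union>s\<in>{0..}. {W s -` A \<inter> space M | A. A \<in> sets borel}) \<subseteq> sets M"
    using measurable_sets[OF W_measurable] by auto
  then show ?thesis
    unfolding generated_sigma_def subalgebra_def
    by (auto simp: space_measure_of_conv sets_measure_of_conv intro: sets.sigma_sets_subset[THEN subsetD])
qed

lemma W_measurable_generated: "0 \<le> s \<Longrightarrow> W s \<in> borel_measurable (generated_sigma M W {0..})"
  unfolding generated_sigma_def
  by (intro measurableI) (auto simp: space_measure_of_conv intro!: sigma_sets.Basic)

text \<open>Induction on the number of intervals: the last increment is independent of the sum of
  the earlier ones, so the characteristic functions at 1 multiply.\<close>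

lemma incr_sum_char:
  assumes \<tau>: "0 \<le> \<tau> 0" "\<And>i. i < n \<Longrightarrow> \<tau> i \<le> \<tau> (Suc i)"
  shows "(\<integral>\<omega>. iexp (\<Sum>i<n. incr (\<tau> i) (\<tau> (Suc i)) (v i) \<omega>) \<partial>M) =
    complex_of_real (exp (- (\<Sum>i<n. (\<tau> (Suc i) - \<tau> i) * (Q (v i) \<bullet> v i)) / 2))"
  using \<tau>(2)
proof (induction n)
  case 0
  then show ?case by (simp add: prob_space)
next
  case (Suc n)
  have mono: "\<tau> i \<le> \<tau> j" if "i \<le> j" "j \<le> Suc n" for i j
    by (rule partition_mono[of "Suc n" \<tau>, OF Suc.prems that])
  have nonneg: "0 \<le> \<tau> i" if "i \<le> Suc n" for i using mono[of 0 i] that \<tau>(1) by simp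
  define X where "X \<omega> = (\<Sum>i<n. incr (\<tau> i) (\<tau> (Suc i)) (v i) \<omega>)" for \<omega>
  define Y where "Y = incr (\<tau> n) (\<tau> (Suc n)) (v n)"
  have "X \<in> borel_measurable (F (\<tau> n))"
    unfolding X_def by (intro borel_measurable_sum incr_measurable_F) (auto intro: mono nonneg)
  then have "indep_var borel X borel Y"
    unfolding Y_def by (intro incr_indep) (auto intro: mono nonneg)
  then have "char (distr M borel (\<lambda>\<omega>. X \<omega> + Y \<omega>)) 1 = char (distr M borel X) 1 * char (distr M borel Y) 1"
    by (rule char_distr_add)
  moreover have [measurable]: "X \<in> borel_measurable M" "Y \<in> borel_measurable M"
    using \<open>indep_var borel X borel Y\<close> by (auto elim: indep_var_rv1 indep_var_rv2)
  ultimately have "(\<integral>\<omega>. iexp (X \<omega> + Y \<omega>) \<partial>M) = (\<integral>\<omega>. iexp (X \<omega>) \<partial>M) * (\<integral>\<omega>. iexp (Y \<omega>) \<partial>M)"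
    by (simp add: char_def integral_distr)
  also have "(\<integral>\<omega>. iexp (X \<omega>) \<partial>M) = complex_of_real (exp (- (\<Sum>i<n. (\<tau> (Suc i) - \<tau> i) * (Q (v i) \<bullet> v i)) / 2))"
    unfolding X_def by (rule Suc.IH) (simp add: Suc.prems)
  also have "(\<integral>\<omega>. iexp (Y \<omega>) \<partial>M) = complex_of_real (exp (- ((\<tau> (Suc n) - \<tau> n) * (Q (v n) \<bullet> v n)) / 2))"
    unfolding Y_def by (rule incr_char) (auto intro: mono nonneg)
  finally show ?case
    by (simp add: X_def Y_def add_divide_distrib exp_add[symmetric] flip: of_real_mult exp_minus)
qed

text \<open>The whole path of \<open>W\<close> is independent of \<open>N\<close>, so all values of
  the integrand can be frozen at once; independence takes the place of adaptedness in time. On each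
  event where the integrand is constant, \<open>incr_sum_char\<close> applies.\<close>

lemma char_simple_integral:
  assumes N: "subalgebra M N"
    and indep: "\<And>A C. A \<in> sets N \<Longrightarrow> C \<in> sets (generated_sigma M W {0..}) \<Longrightarrow> prob (A \<inter> C) = prob A * prob C"
    and \<tau>: "0 \<le> \<tau> 0" "\<And>i. i < n \<Longrightarrow> \<tau> i \<le> \<tau> (Suc i)"
    and x: "\<And>i. i < n \<Longrightarrow> simple_function N (x i)"
  shows "(\<integral>\<omega>. iexp (\<Sum>i<n. x i \<omega> \<bullet> (W (\<tau> (Suc i)) \<omega> - W (\<tau> i) \<omega>)) \<partial>M) =
    complex_of_real (\<integral>\<omega>. exp (- (\<Sum>i<n. (\<tau> (Suc i) - \<tau> i) * (Q (x i \<omega>) \<bullet> x i \<omega>)) / 2) \<partial>M)"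
proof -
  have mono: "\<tau> i \<le> \<tau> j" if "i \<le> j" "j \<le> n" for i j
    by (rule partition_mono[of n \<tau>, OF \<tau>(2) that])
  have nonneg: "0 \<le> \<tau> i" if "i \<le> n" for i using mono[of 0 i] that \<tau>(1) by simp
  have space_N: "space N = space M" using N by (simp add: subalgebra_def)
  \<comment> \<open>All coordinates are collected in one simple function; \<open>restrict\<close>
    makes it extensional, so that its range lies in a finite product.\<close>
  define g where "g \<omega> = restrict (\<lambda>i. x i \<omega>) {..<n}" for \<omega>
  have g: "simple_function N g"
    unfolding simple_function_def
  proof (intro conjI ballI)
    have "g ` space N \<subseteq> PiE {..<n} (\<lambda>i. x i ` space N)" by (auto simp: g_def split: if_splits)
    moreover have "finite (PiE {..<n} (\<lambda>i. x i ` space N))"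
      by (intro finite_PiE) (use x in \<open>auto intro: simple_functionD(1)\<close>)
    ultimately show "finite (g ` space N)" by (rule finite_subset)
    fix v assume "v \<in> g ` space N"
    then have "v \<in> extensional {..<n}" by (auto simp: g_def)
    then have "g -` {v} \<inter> space N = {\<omega> \<in> space N. \<forall>i\<in>{..<n}. x i \<omega> = v i}"
      by (auto simp: g_def fun_eq_iff extensional_def)
    also have "\<dots> \<in> sets N"
    proof (rule sets.sets_Collect_finite_All)
      fix i assume "i \<in> {..<n}"
      then have "x i -` {v i} \<inter> space N \<in> sets N" using x by (intro simple_functionD(2)) auto
      moreover have "x i -` {v i} \<inter> space N = {\<omega> \<in> space N. x i \<omega> = v i}" by auto
      ultimately show "{\<omega> \<in> space N. x i \<omega> = v i} \<in> sets N" by simp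
    qed simp
    finally show "g -` {v} \<inter> space N \<in> sets N" .
  qed
  define A where "A v = g -` {v} \<inter> space M" for v
  have A: "A v \<in> sets N" for v using simple_functionD(2)[OF g, of "{v}"] by (simp add: A_def space_N)
  have AM: "A v \<in> sets M" for v using A N by (auto simp: subalgebra_def)
  define V where "V = g ` space M"
  have V: "finite V" using simple_functionD(1)[OF g] by (simp add: V_def space_N)
  define S where "S v \<omega> = (\<Sum>i<n. incr (\<tau> i) (\<tau> (Suc i)) (v i) \<omega>)" for v \<omega>
  define q where "q v = (\<Sum>i<n. (\<tau> (Suc i) - \<tau> i) * (Q (v i) \<bullet> v i))" for v
  have W_gen: "W (\<tau> i) \<in> borel_measurable (generated_sigma M W {0..})" if "i \<le> n" for i
    using W_measurable_generated nonneg that by blast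
  have S_gen: "S v \<in> borel_measurable (generated_sigma M W {0..})" for v
    unfolding S_def incr_def by (intro borel_measurable_sum borel_measurable_inner borel_measurable_const
        borel_measurable_diff W_gen) auto
  have S_meas[measurable]: "S v \<in> borel_measurable M" for v
    using S_gen measurable_from_subalg[OF subalgebra_generated_sigma] by blast
  have expand: "h (g \<omega>) = (\<Sum>v\<in>V. indicator (A v) \<omega> *\<^sub>R h v)" if "\<omega> \<in> space M" for \<omega> and h :: "(nat \<Rightarrow> 'h) \<Rightarrow> 'z::real_vector"
    using simple_function_sum_indicator[OF g, of \<omega> h] that by (simp add: V_def A_def space_N)
  have iexp_int: "integrable M (\<lambda>\<omega>. iexp (S v \<omega>))" for v
    by (rule integrable_iexp) auto
  have block: "(\<integral>\<omega>. indicator (A v) \<omega> *\<^sub>R iexp (S v \<omega>) \<partial>M) = complex_of_real (prob (A v) * exp (- q v / 2))" for v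
  proof -
    have ind: "indep_var borel (indicator (A v) :: _ \<Rightarrow> real) borel (S v)"
      using A by (intro indep_var_subalgebraI[OF N _ subalgebra_generated_sigma S_gen indep]) auto
    have "indep_var borel (complex_of_real \<circ> indicator (A v)) borel ((\<lambda>x. iexp x) \<circ> S v)"
      by (rule indep_var_compose[OF ind]) measurable
    then have "(\<integral>\<omega>. complex_of_real (indicator (A v) \<omega>) * iexp (S v \<omega>) \<partial>M) =
      (\<integral>\<omega>. complex_of_real (indicator (A v) \<omega>) \<partial>M) * (\<integral>\<omega>. iexp (S v \<omega>) \<partial>M)"
      using AM iexp_int
      by (intro indep_var_lebesgue_integral) (auto simp: comp_def emeasure_eq_measure)
    also have "(\<integral>\<omega>. iexp (S v \<omega>) \<partial>M) = complex_of_real (exp (- q v / 2))"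
      unfolding S_def q_def by (rule incr_sum_char[OF \<tau>])
    also have "(\<integral>\<omega>. complex_of_real (indicator (A v) \<omega>) \<partial>M) = complex_of_real (prob (A v))"
      using AM by simp
    finally show ?thesis by (simp add: scaleR_conv_of_real)
  qed
  have "(\<integral>\<omega>. iexp (\<Sum>i<n. x i \<omega> \<bullet> (W (\<tau> (Suc i)) \<omega> - W (\<tau> i) \<omega>)) \<partial>M) = (\<integral>\<omega>. iexp (S (g \<omega>) \<omega>) \<partial>M)"
    by (simp add: S_def g_def incr_def)
  also have "\<dots> = (\<integral>\<omega>. (\<Sum>v\<in>V. indicator (A v) \<omega> *\<^sub>R iexp (S v \<omega>)) \<partial>M)"
    by (intro Bochner_Integration.integral_cong refl expand[of _ "\<lambda>v. iexp (S v _)"])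
  also have "\<dots> = (\<Sum>v\<in>V. complex_of_real (prob (A v) * exp (- q v / 2)))"
    using AM iexp_int
    by (subst Bochner_Integration.integral_sum) (auto simp: block intro!: integrable_mult_indicator)
  also have "\<dots> = complex_of_real (\<Sum>v\<in>V. prob (A v) * exp (- q v / 2))" by simp
  also have "(\<Sum>v\<in>V. prob (A v) * exp (- q v / 2)) = (\<integral>\<omega>. (\<Sum>v\<in>V. indicator (A v) \<omega> *\<^sub>R exp (- q v / 2)) \<partial>M)"
    using AM by (subst Bochner_Integration.integral_sum) (auto simp: emeasure_eq_measure)
  also have "\<dots> = (\<integral>\<omega>. exp (- q (g \<omega>) / 2) \<partial>M)"
    by (intro Bochner_Integration.integral_cong refl expand[symmetric, of _ "\<lambda>v. exp (- q v / 2)"])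
  also have "\<dots> = (\<integral>\<omega>. exp (- (\<Sum>i<n. (\<tau> (Suc i) - \<tau> i) * (Q (x i \<omega>) \<bullet> x i \<omega>)) / 2) \<partial>M)"
    by (simp add: q_def g_def)
  finally show ?thesis .
qed

end

section \<open>Approximation by sampled step processes\<close>

text \<open>The average over the offset \<open>\<theta>\<close> of the Riemann sums is the integral.\<close>

lemma ex_grid_offset:
  fixes g :: "real \<Rightarrow> ennreal"
  assumes [measurable]: "g \<in> borel_measurable borel" and C: "(\<integral>\<^sup>+ s. g s \<partial>lborel) < C" and \<delta>: "0 < \<delta>"
  shows "\<exists>\<theta>. 0 \<le> \<theta> \<and> \<theta> < \<delta> \<and> ennreal \<delta> * (\<Sum>j<N. g (\<theta> + real j * \<delta>)) \<le> C"
proof (rule ccontr)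
  assume "\<not> ?thesis"
  then have big: "C \<le> ennreal \<delta> * (\<Sum>j<N. g (\<theta> + real j * \<delta>))" if "0 \<le> \<theta>" "\<theta> < \<delta>" for \<theta>
    using that by (meson linear)
  \<comment> \<open>Integrate the supposed lower bound over all offsets: the translates of [0,
    \<delta>) are disjoint, so the right side is at most \<delta> times the integral of
    \<open>g\<close>, which is below \<delta> times \<open>C\<close>.\<close>
  have "C * ennreal \<delta> = (\<integral>\<^sup>+ \<theta>. C * indicator {0..<\<delta>} \<theta> \<partial>lborel)"
    using \<delta> by (subst nn_integral_cmult_indicator) auto
  also have "\<dots> \<le> (\<integral>\<^sup>+ \<theta>. ennreal \<delta> * (\<Sum>j<N. g (\<theta> + real j * \<delta>) * indicator {0..<\<delta>} \<theta>) \<partial>lborel)"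
    using big by (intro nn_integral_mono) (auto simp: indicator_def)
  also have "\<dots> = ennreal \<delta> * (\<Sum>j<N. \<integral>\<^sup>+ \<theta>. g (\<theta> + real j * \<delta>) * indicator {0..<\<delta>} \<theta> \<partial>lborel)"
    by (subst nn_integral_cmult, measurable, subst nn_integral_sum, measurable)
  also have "(\<Sum>j<N. \<integral>\<^sup>+ \<theta>. g (\<theta> + real j * \<delta>) * indicator {0..<\<delta>} \<theta> \<partial>lborel) =
      (\<Sum>j<N. \<integral>\<^sup>+ s. g s * indicator {real j * \<delta>..<real (Suc j) * \<delta>} s \<partial>lborel)"
  proof (rule sum.cong[OF refl])
    fix j
    show "(\<integral>\<^sup>+ \<theta>. g (\<theta> + real j * \<delta>) * indicator {0..<\<delta>} \<theta> \<partial>lborel) =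
      (\<integral>\<^sup>+ s. g s * indicator {real j * \<delta>..<real (Suc j) * \<delta>} s \<partial>lborel)"
      by (subst (2) nn_integral_real_affine[where c=1 and t="real j * \<delta>"])
         (auto intro!: nn_integral_cong simp: indicator_def algebra_simps)
  qed
  also have "\<dots> = (\<integral>\<^sup>+ s. (\<Sum>j<N. g s * indicator {real j * \<delta>..<real (Suc j) * \<delta>} s) \<partial>lborel)"
    by (rule nn_integral_sum[symmetric]) measurable
  also have "\<dots> = (\<integral>\<^sup>+ s. g s * (\<Sum>j<N. indicator {real j * \<delta>..<real (Suc j) * \<delta>} s) \<partial>lborel)"
    by (simp only: sum_distrib_left)
  also have "\<dots> \<le> (\<integral>\<^sup>+ s. g s \<partial>lborel)"
  proof (rule nn_integral_mono)
    fix s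
    have "disjoint_family_on (\<lambda>j. {real j * \<delta>..<real (Suc j) * \<delta>}) {..<N}"
      unfolding disjoint_family_on_def
    proof (intro ballI impI)
      fix i j :: nat assume "i \<noteq> j"
      then consider "real (Suc i) \<le> real j" | "real (Suc j) \<le> real i" by linarith
      then show "{real i * \<delta>..<real (Suc i) * \<delta>} \<inter> {real j * \<delta>..<real (Suc j) * \<delta>} = {}"
        by cases (use \<delta> in \<open>force dest: mult_right_mono[of _ _ \<delta>]\<close>)+
    qed
    then have "(\<Sum>j<N. indicator {real j * \<delta>..<real (Suc j) * \<delta>} s) = (indicator (\<Union>j<N. {real j * \<delta>..<real (Suc j) * \<delta>}) s :: ennreal)"
      by (intro indicator_UN_disjoint[symmetric]) auto
    then have "(\<Sum>j<N. indicator {real j * \<delta>..<real (Suc j) * \<delta>} s) \<le> (1 :: ennreal)"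
      by (simp only:) (auto simp: indicator_def)
    then have "g s * (\<Sum>j<N. indicator {real j * \<delta>..<real (Suc j) * \<delta>} s) \<le> g s * 1" by (rule mult_left_mono) simp
    then show "g s * (\<Sum>j<N. indicator {real j * \<delta>..<real (Suc j) * \<delta>} s) \<le> g s" by simp
  qed
  finally have "C * ennreal \<delta> \<le> ennreal \<delta> * (\<integral>\<^sup>+ s. g s \<partial>lborel)"
    by (simp add: mult_left_mono)
  moreover have "(\<integral>\<^sup>+ s. g s \<partial>lborel) * ennreal \<delta> < C * ennreal \<delta>"
    using C \<delta> by (intro ennreal_mult_strict_right_mono) auto
  ultimately show False by (simp add: mult.commute)
qed

lemma step_sum_eq:
  fixes \<tau> :: "nat \<Rightarrow> real"
  assumes \<tau>: "\<And>i. i < n \<Longrightarrow> \<tau> i \<le> \<tau> (Suc i)" and j: "j < n" "s \<in> {\<tau> j<..\<tau> (Suc j)}"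
  shows "(\<Sum>i<n. indicator {\<tau> i<..\<tau> (Suc i)} s *\<^sub>R (y i :: 'b::real_vector)) = y j"
proof -
  have uniq: "s \<notin> {\<tau> i<..\<tau> (Suc i)}" if "i < n" "i \<noteq> j" for i
  proof
    assume s: "s \<in> {\<tau> i<..\<tau> (Suc i)}"
    from \<open>i \<noteq> j\<close> consider "Suc i \<le> j" | "Suc j \<le> i" by linarith
    then show False
    proof cases
      case 1
      then have "\<tau> (Suc i) \<le> \<tau> j" using partition_mono[of n \<tau> "Suc i" j] \<tau> j by auto
      then show False using s j by auto
    next
      case 2
      then have "\<tau> (Suc j) \<le> \<tau> i" using partition_mono[of n \<tau> "Suc j" i] \<tau> that by auto
      then show False using s j by auto
    qed
  qed
  have "(\<Sum>i<n. indicator {\<tau> i<..\<tau> (Suc i)} s *\<^sub>R y i) = (\<Sum>i<n. if i = j then y j else 0)"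
  proof (rule sum.cong[OF refl])
    fix i assume "i \<in> {..<n}"
    then show "indicator {\<tau> i<..\<tau> (Suc i)} s *\<^sub>R y i = (if i = j then y j else 0)"
      using j(2) uniq[of i] by (cases "i = j") (simp_all add: indicator_def)
  qed
  then show ?thesis using j by simp
qed

text \<open>At most one of the intervals contains \<open>s\<close>, so even a nonlinear map such as
  a squared norm passes through the sum.\<close>

lemma step_sum_map:
  fixes \<tau> :: "nat \<Rightarrow> real" and y :: "nat \<Rightarrow> 'b::real_vector" and h :: "'b \<Rightarrow> 'c::real_vector"
  assumes \<tau>: "\<And>i. i < n \<Longrightarrow> \<tau> i \<le> \<tau> (Suc i)" and "h 0 = 0"
  shows "h (\<Sum>i<n. indicator {\<tau> i<..\<tau> (Suc i)} s *\<^sub>R y i) = (\<Sum>i<n. indicator {\<tau> i<..\<tau> (Suc i)} s *\<^sub>R h (y i))"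
proof (cases "\<exists>j<n. s \<in> {\<tau> j<..\<tau> (Suc j)}")
  case True
  then obtain j where j: "j < n" "s \<in> {\<tau> j<..\<tau> (Suc j)}" by blast
  show ?thesis
    using step_sum_eq[of n \<tau>, OF \<tau> j, where y=y] step_sum_eq[of n \<tau>, OF \<tau> j, where y="\<lambda>i. h (y i)"] by simp
next
  case False
  then have "indicator {\<tau> i<..\<tau> (Suc i)} s *\<^sub>R y i = 0" "indicator {\<tau> i<..\<tau> (Suc i)} s *\<^sub>R h (y i) = 0" if "i < n" for i
    using that by (auto simp: indicator_def)
  then have "(\<Sum>i<n. indicator {\<tau> i<..\<tau> (Suc i)} s *\<^sub>R y i) = 0"
    "(\<Sum>i<n. indicator {\<tau> i<..\<tau> (Suc i)} s *\<^sub>R h (y i)) = 0"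
    by (intro sum.neutral ballI, simp only: lessThan_iff)+
  then show ?thesis by (simp only: \<open>h 0 = 0\<close>)
qed

abbreviation step :: "nat \<Rightarrow> (nat \<Rightarrow> real) \<Rightarrow> (nat \<Rightarrow> 'a \<Rightarrow> 'b::real_vector) \<Rightarrow> real \<Rightarrow> 'a \<Rightarrow> 'b" where
  "step n \<tau> y s \<omega> \<equiv> \<Sum>i<n. indicator {\<tau> i<..\<tau> (Suc i)} s *\<^sub>R y i \<omega>"

context wiener
begin

section \<open>The Ito energy of an integrand\<close>

abbreviation step_integral :: "nat \<Rightarrow> (nat \<Rightarrow> real) \<Rightarrow> (nat \<Rightarrow> 'a \<Rightarrow> 'h) \<Rightarrow> 'a \<Rightarrow> real" where
  "step_integral n \<tau> y \<omega> \<equiv> \<Sum>i<n. y i \<omega> \<bullet> (W (\<tau> (Suc i)) \<omega> - W (\<tau> i) \<omega>)"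

abbreviation jointly_measurable :: "(real \<Rightarrow> 'a \<Rightarrow> 'h) \<Rightarrow> bool" where
  "jointly_measurable \<psi> \<equiv> (\<lambda>p. \<psi> (fst p) (snd p)) \<in> borel_measurable (lborel \<Otimes>\<^sub>M M)"

definition slice_energy :: "('a \<Rightarrow> 'h) \<Rightarrow> ennreal" where
  "slice_energy X = (\<integral>\<^sup>+ \<omega>. ennreal ((norm (sqrt_op Q (X \<omega>)))\<^sup>2) \<partial>M)"

text \<open>The squared norm of the Ito isometry. The time integral stands outside, so that
  \<open>ex_grid_offset\<close> can act on the slice energies; \<open>energy_swap\<close> provides
  the other order, in which paths are treated one by one.\<close>

definition energy :: "(real \<Rightarrow> 'a \<Rightarrow> 'h) \<Rightarrow> ennreal" where
  "energy \<psi> = (\<integral>\<^sup>+ s. slice_energy (\<psi> s) \<partial>lborel)"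

lemma norm_sqrt_measurable:
  "X \<in> borel_measurable N \<Longrightarrow> (\<lambda>\<omega>. ennreal ((norm (sqrt_op Q (X \<omega>)))\<^sup>2)) \<in> borel_measurable N"
  using borel_measurable_blinfun_apply[of X N "sqrt_op Q"] by measurable

lemma jointly_measurable_slice:
  assumes "jointly_measurable \<psi>"
  shows "\<psi> s \<in> borel_measurable M"
  using measurable_compose[OF measurable_Pair1'[of s lborel M] assms] by simp

lemma slice_energy_measurable:
  assumes "jointly_measurable \<psi>"
  shows "(\<lambda>s. slice_energy (\<psi> s)) \<in> borel_measurable borel"
proof -
  have "(\<lambda>s. slice_energy (\<psi> s)) \<in> borel_measurable lborel"
    unfolding slice_energy_def
    by (rule borel_measurable_nn_integral) (use norm_sqrt_measurable[OF assms] in \<open>simp add: case_prod_beta'\<close>)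
  then show ?thesis by simp
qed

lemma energy_swap:
  assumes "jointly_measurable \<psi>"
  shows "(\<integral>\<^sup>+ \<omega>. (\<integral>\<^sup>+ s. ennreal ((norm (sqrt_op Q (\<psi> s \<omega>)))\<^sup>2) \<partial>lborel) \<partial>M) = energy \<psi>"
proof -
  interpret pair_sigma_finite lborel M ..
  show ?thesis
    unfolding energy_def slice_energy_def
    by (rule Fubini') (use norm_sqrt_measurable[OF assms] in \<open>simp add: case_prod_beta'\<close>)
qed

lemma norm_sqrt_add_le:
  "ennreal ((norm (sqrt_op Q (x + y)))\<^sup>2) \<le> 2 * ennreal ((norm (sqrt_op Q x))\<^sup>2) + 2 * ennreal ((norm (sqrt_op Q y))\<^sup>2)"
proof -
  let ?x = "norm (sqrt_op Q x)" and ?y = "norm (sqrt_op Q y)"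
  have "(norm (sqrt_op Q (x + y)))\<^sup>2 \<le> (?x + ?y)\<^sup>2"
    by (intro power_mono) (simp_all add: blinfun.add_right norm_triangle_ineq)
  also have "\<dots> \<le> 2 * ?x\<^sup>2 + 2 * ?y\<^sup>2"
    using sum_squares_bound[of ?x ?y] unfolding power2_sum by linarith
  finally have "ennreal ((norm (sqrt_op Q (x + y)))\<^sup>2) \<le> ennreal (2 * ?x\<^sup>2 + 2 * ?y\<^sup>2)" by (rule ennreal_leI)
  then show ?thesis by (simp add: ennreal_plus ennreal_mult)
qed

lemma slice_energy_add:
  assumes "X \<in> borel_measurable M" "Y \<in> borel_measurable M"
  shows "slice_energy (\<lambda>\<omega>. X \<omega> + Y \<omega>) \<le> 2 * slice_energy X + 2 * slice_energy Y"
proof -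
  have "slice_energy (\<lambda>\<omega>. X \<omega> + Y \<omega>) \<le>
    (\<integral>\<^sup>+ \<omega>. 2 * ennreal ((norm (sqrt_op Q (X \<omega>)))\<^sup>2) + 2 * ennreal ((norm (sqrt_op Q (Y \<omega>)))\<^sup>2) \<partial>M)"
    unfolding slice_energy_def by (intro nn_integral_mono norm_sqrt_add_le)
  also have "\<dots> = 2 * slice_energy X + 2 * slice_energy Y"
    unfolding slice_energy_def using norm_sqrt_measurable[OF assms(1)] norm_sqrt_measurable[OF assms(2)]
    by (simp add: nn_integral_add nn_integral_cmult)
  finally show ?thesis .
qed

lemma energy_add:
  assumes "jointly_measurable \<psi>" "jointly_measurable \<phi>"
  shows "energy (\<lambda>s \<omega>. \<psi> s \<omega> + \<phi> s \<omega>) \<le> 2 * energy \<psi> + 2 * energy \<phi>"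
proof -
  note [measurable] = slice_energy_measurable[OF assms(1)] slice_energy_measurable[OF assms(2)]
  have "energy (\<lambda>s \<omega>. \<psi> s \<omega> + \<phi> s \<omega>) \<le> (\<integral>\<^sup>+ s. 2 * slice_energy (\<psi> s) + 2 * slice_energy (\<phi> s) \<partial>lborel)"
    unfolding energy_def by (intro nn_integral_mono slice_energy_add jointly_measurable_slice assms)
  then show ?thesis by (simp add: energy_def nn_integral_add nn_integral_cmult)
qed

lemma slice_energy_minus_commute: "slice_energy (\<lambda>\<omega>. X \<omega> - Y \<omega>) = slice_energy (\<lambda>\<omega>. Y \<omega> - X \<omega>)"
  by (simp add: slice_energy_def blinfun.diff_right norm_minus_commute)

lemma energy_minus_commute: "energy (\<lambda>s \<omega>. \<psi> s \<omega> - \<phi> s \<omega>) = energy (\<lambda>s \<omega>. \<phi> s \<omega> - \<psi> s \<omega>)"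
  unfolding energy_def by (intro nn_integral_cong slice_energy_minus_commute)

lemma energy_triangle:
  assumes "jointly_measurable \<psi>" "jointly_measurable \<phi>" "jointly_measurable \<zeta>"
  shows "energy (\<lambda>s \<omega>. \<psi> s \<omega> - \<zeta> s \<omega>) \<le> 2 * energy (\<lambda>s \<omega>. \<psi> s \<omega> - \<phi> s \<omega>) + 2 * energy (\<lambda>s \<omega>. \<phi> s \<omega> - \<zeta> s \<omega>)"
proof -
  note [measurable] = assms
  have "energy (\<lambda>s \<omega>. (\<psi> s \<omega> - \<phi> s \<omega>) + (\<phi> s \<omega> - \<zeta> s \<omega>)) \<le>
      2 * energy (\<lambda>s \<omega>. \<psi> s \<omega> - \<phi> s \<omega>) + 2 * energy (\<lambda>s \<omega>. \<phi> s \<omega> - \<zeta> s \<omega>)"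
    by (intro energy_add) measurable
  then show ?thesis by simp
qed

lemma jointly_measurable_elementary:
  assumes "\<And>i. i \<in> I \<Longrightarrow> x i \<in> borel_measurable M"
  shows "jointly_measurable (\<lambda>s \<omega>. \<Sum>i\<in>I. indicator {a i<..b i} s *\<^sub>R x i \<omega>)"
proof (rule borel_measurable_sum)
  fix i assume "i \<in> I"
  note [measurable] = assms[OF this]
  show "(\<lambda>p. indicator {a i<..b i} (fst p) *\<^sub>R x i (snd p)) \<in> borel_measurable (lborel \<Otimes>\<^sub>M M)" by measurable
qed

lemma energy_step:
  fixes \<tau> :: "nat \<Rightarrow> real"
  assumes \<tau>: "\<And>i. i < n \<Longrightarrow> \<tau> i \<le> \<tau> (Suc i)"
  shows "energy (\<lambda>s \<omega>. \<Sum>i<n. indicator {\<tau> i<..\<tau> (Suc i)} s *\<^sub>R x i \<omega>) =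
    (\<Sum>i<n. ennreal (\<tau> (Suc i) - \<tau> i) * slice_energy (x i))"
proof -
  have "slice_energy (\<lambda>\<omega>. \<Sum>i<n. indicator {\<tau> i<..\<tau> (Suc i)} s *\<^sub>R x i \<omega>) =
    (\<Sum>i<n. slice_energy (x i) * indicator {\<tau> i<..\<tau> (Suc i)} s)" for s
  proof (cases "\<exists>j<n. s \<in> {\<tau> j<..\<tau> (Suc j)}")
    case True
    then obtain j where j: "j < n" "s \<in> {\<tau> j<..\<tau> (Suc j)}" by blast
    have uniq: "s \<notin> {\<tau> i<..\<tau> (Suc i)}" if "i < n" "i \<noteq> j" for i
      using step_sum_eq[of n \<tau>, OF \<tau> j, of "\<lambda>k. real k"] step_sum_eq[of n \<tau>, OF \<tau> that(1), of s "\<lambda>k. real k"] that(2) by auto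
    have "(\<Sum>i<n. slice_energy (x i) * indicator {\<tau> i<..\<tau> (Suc i)} s) = (\<Sum>i<n. if i = j then slice_energy (x j) else 0)"
      using uniq j by (intro sum.cong refl) (auto simp: indicator_def)
    then show ?thesis
      using j step_sum_eq[of n \<tau>, OF \<tau> j, where y="\<lambda>i. x i _"] by simp
  next
    case False
    then have "indicator {\<tau> i<..\<tau> (Suc i)} s = (0::real)" "indicator {\<tau> i<..\<tau> (Suc i)} s = (0::ennreal)" if "i < n" for i
      using that by (auto simp: indicator_def)
    then show ?thesis by (simp add: slice_energy_def blinfun.zero_right)
  qed
  then have "energy (\<lambda>s \<omega>. \<Sum>i<n. indicator {\<tau> i<..\<tau> (Suc i)} s *\<^sub>R x i \<omega>) =
    (\<integral>\<^sup>+ s. (\<Sum>i<n. slice_energy (x i) * indicator {\<tau> i<..\<tau> (Suc i)} s) \<partial>lborel)"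
    by (simp add: energy_def)
  also have "\<dots> = (\<Sum>i<n. \<integral>\<^sup>+ s. slice_energy (x i) * indicator {\<tau> i<..\<tau> (Suc i)} s \<partial>lborel)"
    by (rule nn_integral_sum) simp
  also have "\<dots> = (\<Sum>i<n. ennreal (\<tau> (Suc i) - \<tau> i) * slice_energy (x i))"
    by (intro sum.cong refl) (simp add: nn_integral_cmult_indicator \<tau> mult.commute)
  finally show ?thesis .
qed

section \<open>Sampling on a grid with a free offset\<close>

lemma simple_bounded:
  assumes "simple_function N x"
  shows "\<exists>C\<ge>0. \<forall>\<omega>\<in>space N. norm (sqrt_op Q (x \<omega>)) \<le> C"
proof -
  have "finite ((\<lambda>v. norm (sqrt_op Q v)) ` (x ` space N))" using simple_functionD(1)[OF assms] by simp
  then have "norm (sqrt_op Q (x \<omega>)) \<le> Max (insert 0 ((\<lambda>v. norm (sqrt_op Q v)) ` (x ` space N)))" if "\<omega> \<in> space N" for \<omega>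
    using that by (intro Max_ge) auto
  moreover have "0 \<le> Max (insert 0 ((\<lambda>v. norm (sqrt_op Q v)) ` (x ` space N)))"
    using \<open>finite ((\<lambda>v. norm (sqrt_op Q v)) ` (x ` space N))\<close> by (intro Max_ge) auto
  ultimately show ?thesis by blast
qed

text \<open>A sampled elementary process differs from the original only shortly after a jump or
  before the first grid point. \<open>K\<close> depends on neither mesh nor offset, so that the mesh
  can be fixed first and the offset chosen afterwards.\<close>

lemma elementary_grid_error:
  assumes I: "finite I" and ab: "\<And>i. i \<in> I \<Longrightarrow> 0 \<le> a i \<and> b i \<le> T" and x: "\<And>i. i \<in> I \<Longrightarrow> simple_function M (x i)"
  defines "e \<equiv> \<lambda>s \<omega>. \<Sum>i\<in>I. indicator {a i<..b i} s *\<^sub>R x i \<omega>"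
  shows "\<exists>K\<ge>0. \<forall>\<theta> \<delta> N. 0 \<le> \<theta> \<longrightarrow> \<theta> < \<delta> \<longrightarrow> real N * \<delta> = T \<longrightarrow>
    energy (\<lambda>s \<omega>. (\<Sum>j<N. indicator {\<theta> + real j * \<delta><..\<theta> + real (Suc j) * \<delta>} s *\<^sub>R e (\<theta> + real j * \<delta>) \<omega>) - e s \<omega>)
      \<le> ennreal (K * \<delta>)"
proof -
  have "\<forall>i. \<exists>C\<ge>0. i \<in> I \<longrightarrow> (\<forall>\<omega>\<in>space M. norm (sqrt_op Q (x i \<omega>)) \<le> C)"
    using simple_bounded x by (metis order_refl)
  then obtain C where C0: "\<And>i. 0 \<le> C i" and C: "\<And>i \<omega>. i \<in> I \<Longrightarrow> \<omega> \<in> space M \<Longrightarrow> norm (sqrt_op Q (x i \<omega>)) \<le> C i"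
    by metis
  define B where "B = (\<Sum>i\<in>I. C i)"
  have B0: "0 \<le> B" unfolding B_def by (intro sum_nonneg C0)
  have e_bound: "norm (sqrt_op Q (e s \<omega>)) \<le> B" if "\<omega> \<in> space M" for s \<omega>
  proof -
    have "norm (sqrt_op Q (e s \<omega>)) \<le> (\<Sum>i\<in>I. norm (indicator {a i<..b i} s *\<^sub>R sqrt_op Q (x i \<omega>)))"
      unfolding e_def blinfun.sum_right blinfun.scaleR_right by (rule norm_sum)
    also have "\<dots> \<le> B"
      unfolding B_def using C C0 that by (intro sum_mono) (auto simp: indicator_def)
    finally show ?thesis .
  qed
  \<comment> \<open>The squared error is at most the square of 2B, and the set where it can be
    nonzero has measure at most (1 + 2 card I) \<delta>.\<close>
  define K where "K = (2 * B)\<^sup>2 * (1 + 2 * real (card I))"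
  have "energy (\<lambda>s \<omega>. (\<Sum>j<N. indicator {\<theta> + real j * \<delta><..\<theta> + real (Suc j) * \<delta>} s *\<^sub>R e (\<theta> + real j * \<delta>) \<omega>) - e s \<omega>)
      \<le> ennreal (K * \<delta>)" if \<theta>: "0 \<le> \<theta>" "\<theta> < \<delta>" and N: "real N * \<delta> = T" for \<theta> \<delta> N
  proof -
    have \<delta>: "0 < \<delta>" using \<theta> by linarith
    define \<tau> where "\<tau> j = \<theta> + real j * \<delta>" for j
    have \<tau>: "\<tau> i \<le> \<tau> (Suc i)" for i using \<delta> by (simp add: \<tau>_def algebra_simps)
    define G where "G s \<omega> = (\<Sum>j<N. indicator {\<tau> j<..\<tau> (Suc j)} s *\<^sub>R e (\<tau> j) \<omega>)" for s \<omega>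
    \<comment> \<open>\<open>{0..\<delta>}\<close> covers the times before the first grid point
      \<theta> < \<delta>; the other pieces follow the jump times, because sampling looks back by at
      most \<delta>.\<close>
    define D where "D = {0..\<delta>} \<union> (\<Union>i\<in>I. {a i<..a i + \<delta>} \<union> {b i<..b i + \<delta>})"
    have eq: "G s \<omega> = e s \<omega>" if "s \<notin> D" for s \<omega>
    proof (cases "\<exists>j<N. s \<in> {\<tau> j<..\<tau> (Suc j)}")
      case True
      then obtain j where j: "j < N" "s \<in> {\<tau> j<..\<tau> (Suc j)}" by blast
      then have s: "\<tau> j < s" "s \<le> \<tau> j + \<delta>" by (auto simp: \<tau>_def algebra_simps)
      have "G s \<omega> = e (\<tau> j) \<omega>" unfolding G_def by (rule step_sum_eq[OF \<tau> j])
      also have "\<dots> = e s \<omega>"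
        unfolding e_def
      proof (intro sum.cong refl)
        fix i assume i: "i \<in> I"
        then have "s \<notin> {a i<..a i + \<delta>}" "s \<notin> {b i<..b i + \<delta>}" using that by (auto simp: D_def)
        then have "\<tau> j \<in> {a i<..b i} \<longleftrightarrow> s \<in> {a i<..b i}" using s by auto
        then show "indicator {a i<..b i} (\<tau> j) *\<^sub>R x i \<omega> = indicator {a i<..b i} s *\<^sub>R x i \<omega>"
          by (simp add: indicator_def)
      qed
      finally show ?thesis .
    next
      case False
      then have "G s \<omega> = 0" unfolding G_def by (intro sum.neutral) (auto simp: indicator_def)
      \<comment> \<open>Off the grid the sampled process vanishes, and outside \<open>D\<close> so
        does \<open>e\<close>: it lives on (0, T], while the grid reaches from \<theta> to \<theta>
        + T.\<close>
      moreover have "s \<le> \<tau> 0 \<or> \<tau> N < s"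
      proof (rule ccontr)
        assume *: "\<not> ?thesis"
        have "s \<le> \<tau> k \<longrightarrow> k \<le> N \<longrightarrow> False" for k
        proof (induction k)
          case (Suc k)
          then show ?case using False by (metis Suc_le_lessD greaterThanAtMost_iff less_imp_le_nat not_le)
        qed (use * in simp)
        from this[of N] show False using * by auto
      qed
      then have "s < 0 \<or> T < s"
        using that \<theta> N \<delta> unfolding D_def \<tau>_def by auto
      then have "e s \<omega> = 0" unfolding e_def using ab by (intro sum.neutral) (force simp: indicator_def)
      ultimately show ?thesis by simp
    qed
    have G_bound: "norm (sqrt_op Q (G s \<omega>)) \<le> B" if "\<omega> \<in> space M" for s \<omega>
    proof (cases "\<exists>j<N. s \<in> {\<tau> j<..\<tau> (Suc j)}")
      case True
      then obtain j where j: "j < N" "s \<in> {\<tau> j<..\<tau> (Suc j)}" by blast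
      have "G s \<omega> = e (\<tau> j) \<omega>" unfolding G_def by (rule step_sum_eq[OF \<tau> j])
      then show ?thesis using e_bound[OF that] by simp
    next
      case False
      then have "G s \<omega> = 0" unfolding G_def by (intro sum.neutral) (auto simp: indicator_def)
      then show ?thesis using B0 by (simp add: blinfun.zero_right)
    qed
    have [measurable]: "D \<in> sets borel" unfolding D_def by (intro sets.Un sets.finite_UN I) auto
    have "slice_energy (\<lambda>\<omega>. G s \<omega> - e s \<omega>) \<le> ennreal ((2 * B)\<^sup>2) * indicator D s" for s
    proof (cases "s \<in> D")
      case True
      have "slice_energy (\<lambda>\<omega>. G s \<omega> - e s \<omega>) \<le> (\<integral>\<^sup>+ \<omega>. ennreal ((2 * B)\<^sup>2) \<partial>M)"
        unfolding slice_energy_def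
      proof (intro nn_integral_mono ennreal_leI power_mono norm_ge_zero)
        fix \<omega> assume \<omega>: "\<omega> \<in> space M"
        show "norm (sqrt_op Q (G s \<omega> - e s \<omega>)) \<le> 2 * B"
          using norm_triangle_ineq4[of "sqrt_op Q (G s \<omega>)" "sqrt_op Q (e s \<omega>)"] G_bound[OF \<omega>, of s] e_bound[OF \<omega>, of s]
          by (simp add: blinfun.diff_right)
      qed
      then show ?thesis using True by (simp add: emeasure_space_1)
    next
      case False
      then show ?thesis using eq by (simp add: slice_energy_def blinfun.zero_right)
    qed
    then have "energy (\<lambda>s \<omega>. G s \<omega> - e s \<omega>) \<le> (\<integral>\<^sup>+ s. ennreal ((2 * B)\<^sup>2) * indicator D s \<partial>lborel)"
      unfolding energy_def by (rule nn_integral_mono)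
    also have "\<dots> = ennreal ((2 * B)\<^sup>2) * emeasure lborel D"
      by (rule nn_integral_cmult_indicator) simp
    also have "emeasure lborel D \<le> ennreal \<delta> + (\<Sum>i\<in>I. ennreal (2 * \<delta>))"
    proof -
      have "emeasure lborel D \<le> emeasure lborel {0..\<delta>} + emeasure lborel (\<Union>i\<in>I. {a i<..a i + \<delta>} \<union> {b i<..b i + \<delta>})"
        unfolding D_def using I by (intro emeasure_subadditive) auto
      also have "emeasure lborel (\<Union>i\<in>I. {a i<..a i + \<delta>} \<union> {b i<..b i + \<delta>}) \<le>
          (\<Sum>i\<in>I. emeasure lborel ({a i<..a i + \<delta>} \<union> {b i<..b i + \<delta>}))"
        using I by (intro emeasure_subadditive_finite) auto
      also have "\<dots> \<le> (\<Sum>i\<in>I. ennreal (2 * \<delta>))"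
      proof (rule sum_mono)
        fix i
        have "emeasure lborel ({a i<..a i + \<delta>} \<union> {b i<..b i + \<delta>}) \<le>
           emeasure lborel {a i<..a i + \<delta>} + emeasure lborel {b i<..b i + \<delta>}"
          by (intro emeasure_subadditive) auto
        also have "\<dots> = ennreal (2 * \<delta>)" using \<delta> by (simp flip: ennreal_plus)
        finally show "emeasure lborel ({a i<..a i + \<delta>} \<union> {b i<..b i + \<delta>}) \<le> ennreal (2 * \<delta>)" .
      qed
      finally show ?thesis using \<delta> by (simp add: add_left_mono)
    qed
    also have "ennreal \<delta> + (\<Sum>i\<in>I. ennreal (2 * \<delta>)) = ennreal ((1 + 2 * real (card I)) * \<delta>)"
    proof -
      have "(\<Sum>i\<in>I. ennreal (2 * \<delta>)) = ennreal (\<Sum>i\<in>I. 2 * \<delta>)"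
        using \<delta> by (intro sum_ennreal) simp
      then have "ennreal \<delta> + (\<Sum>i\<in>I. ennreal (2 * \<delta>)) = ennreal (\<delta> + (\<Sum>i\<in>I. 2 * \<delta>))"
        using \<delta> by (simp add: sum_nonneg)
      also have "\<delta> + (\<Sum>i\<in>I. 2 * \<delta>) = (1 + 2 * real (card I)) * \<delta>" by (simp add: algebra_simps)
      finally show ?thesis .
    qed
    also have "ennreal ((2 * B)\<^sup>2) * ennreal ((1 + 2 * real (card I)) * \<delta>) = ennreal (K * \<delta>)"
      using \<delta> by (simp add: K_def mult.assoc flip: ennreal_mult)
    finally have "energy (\<lambda>s \<omega>. G s \<omega> - e s \<omega>) \<le> ennreal (K * \<delta>)" by (simp add: mult_left_mono)
    then show ?thesis by (simp add: G_def \<tau>_def)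
  qed
  moreover have "0 \<le> K" by (simp add: K_def)
  ultimately show ?thesis by blast
qed

text \<open>Three moves lead from the samples of \<open>\<psi>\<close> to \<open>\<psi>\<close>: to
  the samples of the nearby elementary process, to that process itself, and to
  \<open>\<psi>\<close>. The offset controls the first, the mesh the second, and
  \<open>close\<close> the third.\<close>

lemma grid_approximation:
  assumes \<psi>: "jointly_measurable \<psi>" and T: "0 \<le> T" and supp: "\<And>s \<omega>. s \<notin> {0..T} \<Longrightarrow> \<psi> s \<omega> = 0"
    and I: "finite I" and ab: "\<And>i. i \<in> I \<Longrightarrow> 0 \<le> a i \<and> b i \<le> T" and x: "\<And>i. i \<in> I \<Longrightarrow> simple_function M (x i)"
    and \<epsilon>: "0 < \<epsilon>"
    and close: "energy (\<lambda>s \<omega>. \<psi> s \<omega> - (\<Sum>i\<in>I. indicator {a i<..b i} s *\<^sub>R x i \<omega>)) < ennreal \<epsilon>"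
  shows "\<exists>N (\<tau> :: nat \<Rightarrow> real). 0 \<le> \<tau> 0 \<and> (\<forall>j<N. \<tau> j \<le> \<tau> (Suc j) \<and> \<tau> j \<in> {0..T} \<and> slice_energy (\<psi> (\<tau> j)) < \<infinity>) \<and>
    energy (\<lambda>s \<omega>. (\<Sum>j<N. indicator {\<tau> j<..\<tau> (Suc j)} s *\<^sub>R \<psi> (\<tau> j) \<omega>) - \<psi> s \<omega>) \<le> ennreal (10 * \<epsilon>)"
proof (cases "T = 0")
  \<comment> \<open>For T = 0 there is no positive mesh; the empty grid serves, since
    \<open>\<psi>\<close> then lives on a null set of times.\<close>
  case True
  have "AE s in lborel. s \<noteq> (0::real)" by (rule AE_lborel_singleton)
  then have "AE s in lborel. slice_energy (\<lambda>\<omega>. - \<psi> s \<omega>) = 0"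
  proof eventually_elim
    case (elim s)
    then have "\<psi> s \<omega> = 0" for \<omega> using supp[of s \<omega>] True by auto
    then show ?case by (simp add: slice_energy_def blinfun.zero_right)
  qed
  then have "energy (\<lambda>s \<omega>. - \<psi> s \<omega>) = (\<integral>\<^sup>+ s. 0 \<partial>(lborel :: real measure))"
    unfolding energy_def by (rule nn_integral_cong_AE)
  then show ?thesis by (intro exI[of _ 0] exI[of _ "\<lambda>_. 0"]) simp
next
  case False
  with T have T: "0 < T" by simp
  define e where "e s \<omega> = (\<Sum>i\<in>I. indicator {a i<..b i} s *\<^sub>R x i \<omega>)" for s \<omega>
  have x_meas: "x i \<in> borel_measurable M" if "i \<in> I" for i
    by (rule borel_measurable_simple_function[OF x[OF that]])
  have e: "jointly_measurable e"
    unfolding e_def[abs_def] by (rule jointly_measurable_elementary[OF x_meas])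
  obtain K where K: "0 \<le> K" "\<And>\<theta> \<delta> N. 0 \<le> \<theta> \<Longrightarrow> \<theta> < \<delta> \<Longrightarrow> real N * \<delta> = T \<Longrightarrow>
    energy (\<lambda>s \<omega>. (\<Sum>j<N. indicator {\<theta> + real j * \<delta><..\<theta> + real (Suc j) * \<delta>} s *\<^sub>R e (\<theta> + real j * \<delta>) \<omega>) - e s \<omega>)
      \<le> ennreal (K * \<delta>)"
    using elementary_grid_error[where a=a and b=b and I=I and x=x and T=T, OF I ab x, folded e_def] by blast
  \<comment> \<open>The first summand makes \<open>K * \<delta> \<le> \<epsilon>\<close>; the second
    keeps \<open>N\<close> positive even when \<open>K = 0\<close>.\<close>
  obtain N :: nat where N: "K * T / \<epsilon> + 1 < real N" using reals_Archimedean2 by blast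
  then have N0: "0 < real N" using K(1) T \<epsilon> by (smt (verit) divide_nonneg_pos mult_nonneg_nonneg)
  define \<delta> where "\<delta> = T / real N"
  have \<delta>: "0 < \<delta>" "real N * \<delta> = T" using N0 T by (auto simp: \<delta>_def)
  have "K * T < real N * \<epsilon>" using N \<epsilon> by (simp add: field_simps)
  then have K\<delta>: "K * \<delta> \<le> \<epsilon>" using N0 by (simp add: \<delta>_def field_simps)
  define d where "d s \<omega> = \<psi> s \<omega> - e s \<omega>" for s \<omega>
  have d: "jointly_measurable d" unfolding d_def using \<psi> e by measurable
  have "(\<integral>\<^sup>+ s. slice_energy (d s) \<partial>lborel) < ennreal \<epsilon>"
    using close unfolding energy_def d_def[abs_def] e_def[abs_def] .
  from ex_grid_offset[OF slice_energy_measurable[OF d] this \<delta>(1), of N]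
  obtain \<theta> where \<theta>: "0 \<le> \<theta>" "\<theta> < \<delta>" "ennreal \<delta> * (\<Sum>j<N. slice_energy (d (\<theta> + real j * \<delta>))) \<le> ennreal \<epsilon>" by blast
  define \<tau> where "\<tau> j = \<theta> + real j * \<delta>" for j
  have \<tau>: "\<tau> j \<le> \<tau> (Suc j)" for j using \<delta> by (simp add: \<tau>_def algebra_simps)
  \<comment> \<open>Only left endpoints are claimed to lie in [0, T]; the last right endpoint is
    \<theta> + T and may lie beyond.\<close>
  have \<tau>_in: "\<tau> j \<in> {0..T}" if "j < N" for j
  proof -
    have "(real j + 1) * \<delta> \<le> real N * \<delta>" using that \<delta> by (intro mult_right_mono) auto
    then have "\<theta> + real j * \<delta> \<le> T" using \<theta>(2) \<delta>(2) by (simp add: algebra_simps)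
    then show ?thesis using \<theta>(1) \<delta>(1) by (simp add: \<tau>_def)
  qed
  define samp where "samp f s \<omega> = (\<Sum>j<N. indicator {\<tau> j<..\<tau> (Suc j)} s *\<^sub>R f (\<tau> j) \<omega>)" for f :: "real \<Rightarrow> 'a \<Rightarrow> 'h" and s \<omega>
  have samp: "jointly_measurable (samp f)" if "jointly_measurable f" for f
    unfolding samp_def[abs_def] by (rule jointly_measurable_elementary) (rule jointly_measurable_slice[OF that])
  have width: "\<tau> (Suc j) - \<tau> j = \<delta>" for j by (simp add: \<tau>_def algebra_simps)
  have "energy (\<lambda>s \<omega>. samp \<psi> s \<omega> - samp e s \<omega>) = energy (samp d)"
    by (simp add: samp_def[abs_def] d_def sum_subtractf[symmetric] scaleR_diff_right)
  also have "\<dots> = (\<Sum>j<N. ennreal (\<tau> (Suc j) - \<tau> j) * slice_energy (d (\<tau> j)))"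
    unfolding samp_def[abs_def] by (rule energy_step[of N \<tau>, OF \<tau>])
  also have "\<dots> \<le> ennreal \<epsilon>"
    unfolding width using \<theta>(3) by (simp only: sum_distrib_left \<tau>_def)
  finally have 1: "energy (\<lambda>s \<omega>. samp \<psi> s \<omega> - samp e s \<omega>) \<le> ennreal \<epsilon>" .
  have "energy (\<lambda>s \<omega>. samp e s \<omega> - e s \<omega>) \<le> ennreal (K * \<delta>)"
    using K(2)[OF \<theta>(1,2) \<delta>(2)] by (simp only: samp_def \<tau>_def)
  also have "\<dots> \<le> ennreal \<epsilon>" using K\<delta> by (rule ennreal_leI)
  finally have 2: "energy (\<lambda>s \<omega>. samp e s \<omega> - e s \<omega>) \<le> ennreal \<epsilon>" .
  have 3: "energy (\<lambda>s \<omega>. e s \<omega> - \<psi> s \<omega>) \<le> ennreal \<epsilon>"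
    using close energy_minus_commute[of \<psi> e] by (simp add: e_def)
  have "energy (\<lambda>s \<omega>. samp \<psi> s \<omega> - \<psi> s \<omega>) \<le>
      2 * energy (\<lambda>s \<omega>. samp \<psi> s \<omega> - samp e s \<omega>) + 2 * energy (\<lambda>s \<omega>. samp e s \<omega> - \<psi> s \<omega>)"
    by (intro energy_triangle samp \<psi> e)
  \<comment> \<open>Two quadratic triangle inequalities, each with factor 2: 2 + 2 (2 + 2) =
    10.\<close>
  also have "\<dots> \<le> 2 * ennreal \<epsilon> + 2 * (2 * ennreal \<epsilon> + 2 * ennreal \<epsilon>)"
    by (intro add_mono mult_left_mono 1 order_trans[OF energy_triangle[of "samp e" e \<psi>]] 2 3 samp \<psi> e) auto
  also have "\<dots> = ennreal (10 * \<epsilon>)"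
    using \<epsilon> by (simp flip: ennreal_plus ennreal_mult' ennreal_numeral)
  finally have "energy (\<lambda>s \<omega>. samp \<psi> s \<omega> - \<psi> s \<omega>) \<le> ennreal (10 * \<epsilon>)" .
  \<comment> \<open>The same choice of offset makes the samples square integrable: the Riemann sum
    for \<open>d\<close> is finite, and \<open>e\<close> is bounded.\<close>
  moreover have "slice_energy (\<psi> (\<tau> j)) < \<infinity>" if "j < N" for j
  proof -
    have "ennreal \<delta> * slice_energy (d (\<tau> j)) \<le> ennreal \<delta> * (\<Sum>j<N. slice_energy (d (\<tau> j)))"
      using that by (intro mult_left_mono member_le_sum) auto
    also have "\<dots> \<le> ennreal \<epsilon>" using \<theta>(3) by (simp add: \<tau>_def)
    finally have "ennreal \<delta> * slice_energy (d (\<tau> j)) < \<infinity>" by (simp add: le_less_trans)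
    then have fin_d: "slice_energy (d (\<tau> j)) < \<infinity>" using \<delta> by (auto simp: ennreal_mult_less_top)
    have "simple_function M (e (\<tau> j))"
      unfolding e_def[abs_def] using x by (intro simple_function_sum) (auto intro!: simple_function_compose1[of M _ "\<lambda>v. _ *\<^sub>R v"])
    from simple_bounded[OF this] obtain C where C: "0 \<le> C" "\<And>\<omega>. \<omega> \<in> space M \<Longrightarrow> norm (sqrt_op Q (e (\<tau> j) \<omega>)) \<le> C" by blast
    have "slice_energy (e (\<tau> j)) \<le> (\<integral>\<^sup>+ \<omega>. ennreal (C\<^sup>2) \<partial>M)"
      unfolding slice_energy_def by (intro nn_integral_mono ennreal_leI power_mono C norm_ge_zero)
    also have "\<dots> < \<infinity>" by (simp add: emeasure_space_1)
    finally have fin_e: "slice_energy (e (\<tau> j)) < \<infinity>" .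
    have "slice_energy (\<psi> (\<tau> j)) = slice_energy (\<lambda>\<omega>. d (\<tau> j) \<omega> + e (\<tau> j) \<omega>)" by (simp add: d_def)
    also have "\<dots> \<le> 2 * slice_energy (d (\<tau> j)) + 2 * slice_energy (e (\<tau> j))"
      by (intro slice_energy_add jointly_measurable_slice d e)
    also have "\<dots> < \<infinity>" using fin_d fin_e by (simp add: ennreal_mult_less_top)
    finally show ?thesis .
  qed
  moreover have "0 \<le> \<tau> 0" using \<theta> by (simp add: \<tau>_def)
  ultimately show ?thesis
    using \<tau> \<tau>_in unfolding samp_def by (intro exI[of _ N] exI[of _ \<tau>]) auto
qed

text \<open>\<open>X\<close> is known to be square integrable only after applying the root of Q, so
  a bound on the norms of simple approximants gives no dominating function. Resetting them to 0
  where their image under the root is too large does.\<close>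

lemma simple_approximation:
  assumes N: "subalgebra M N" and X[measurable]: "X \<in> borel_measurable N"
    and fin: "slice_energy X < \<infinity>" and \<epsilon>: "0 < \<epsilon>"
  shows "\<exists>X'. simple_function N X' \<and> slice_energy (\<lambda>\<omega>. X' \<omega> - X \<omega>) \<le> ennreal \<epsilon>"
proof -
  have space_N: "space N = space M" using N by (simp add: subalgebra_def)
  let ?R = "sqrt_op Q"
  from borel_measurable_implies_sequence_metric[OF X, of 0] obtain s where
    s: "\<And>i. simple_function N (s i)" and lim: "\<And>\<omega>. \<omega> \<in> space M \<Longrightarrow> (\<lambda>i. s i \<omega>) \<longlonglongrightarrow> X \<omega>"
    by (auto simp: space_N)
  define x where "x i \<omega> = indicator {\<omega>\<in>space N. norm (?R (s i \<omega>)) \<le> 2 * norm (?R (X \<omega>))} \<omega> *\<^sub>R s i \<omega>" for i \<omega>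
  have x: "simple_function N (x i)" for i
  proof -
    have [measurable]: "(\<lambda>\<omega>. ?R (s i \<omega>)) \<in> borel_measurable N" "(\<lambda>\<omega>. ?R (X \<omega>)) \<in> borel_measurable N"
      by (intro borel_measurable_blinfun_apply X borel_measurable_simple_function s)+
    have "{\<omega>\<in>space N. norm (?R (s i \<omega>)) \<le> 2 * norm (?R (X \<omega>))} \<in> sets N" by measurable
    then show ?thesis unfolding x_def
      by (intro simple_function_compose2[of N _ _ "(*\<^sub>R)"] simple_function_indicator s)
  qed
  have bound: "norm (?R (x i \<omega>)) \<le> 2 * norm (?R (X \<omega>))" for i \<omega>
    by (auto simp: x_def indicator_def blinfun.zero_right)
  have conv: "(\<lambda>i. ?R (x i \<omega>)) \<longlonglongrightarrow> ?R (X \<omega>)" if \<omega>: "\<omega> \<in> space M" for \<omega>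
  \<comment> \<open>Where the image of \<open>X\<close> vanishes, the truncation forces that of
    every approximant to vanish; elsewhere the truncation is eventually inactive.\<close>
  proof (cases "?R (X \<omega>) = 0")
    case True
    then have "?R (x i \<omega>) = 0" for i using bound[of i \<omega>] by simp
    then show ?thesis using True by simp
  next
    case False
    have R: "(\<lambda>i. ?R (s i \<omega>)) \<longlonglongrightarrow> ?R (X \<omega>)" by (intro tendsto_intros lim \<omega>)
    have "norm (?R (X \<omega>)) < 2 * norm (?R (X \<omega>))" using False by simp
    from order_tendstoD(2)[OF tendsto_norm[OF R] this]
    have "\<forall>\<^sub>F i in sequentially. ?R (s i \<omega>) = ?R (x i \<omega>)"
      by eventually_elim (use \<omega> in \<open>simp add: x_def space_N\<close>)
    then show ?thesis by (rule Lim_transform_eventually[OF R])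
  qed
  have [measurable]: "(\<lambda>\<omega>. ?R (X \<omega>)) \<in> borel_measurable M" "\<And>i. (\<lambda>\<omega>. ?R (x i \<omega>)) \<in> borel_measurable M"
    by (intro borel_measurable_blinfun_apply measurable_from_subalg[OF N] X borel_measurable_simple_function[OF x])+
  have "(\<lambda>i. slice_energy (\<lambda>\<omega>. x i \<omega> - X \<omega>)) \<longlonglongrightarrow> (\<integral>\<^sup>+ \<omega>. 0 \<partial>M)"
    unfolding slice_energy_def blinfun.diff_right
  proof (rule nn_integral_dominated_convergence[where w="\<lambda>\<omega>. 9 * ennreal ((norm (?R (X \<omega>)))\<^sup>2)"])
    show "(\<integral>\<^sup>+ \<omega>. 9 * ennreal ((norm (?R (X \<omega>)))\<^sup>2) \<partial>M) < \<infinity>"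
      using fin by (simp add: nn_integral_cmult ennreal_mult_less_top slice_energy_def)
    show "AE \<omega> in M. (\<lambda>i. ennreal ((norm (?R (x i \<omega>) - ?R (X \<omega>)))\<^sup>2)) \<longlonglongrightarrow> 0"
    proof (rule AE_I2)
      fix \<omega> assume "\<omega> \<in> space M"
      then have "(\<lambda>i. ennreal ((norm (?R (x i \<omega>) - ?R (X \<omega>)))\<^sup>2)) \<longlonglongrightarrow> ennreal ((norm (?R (X \<omega>) - ?R (X \<omega>)))\<^sup>2)"
        by (intro tendsto_intros conv)
      then show "(\<lambda>i. ennreal ((norm (?R (x i \<omega>) - ?R (X \<omega>)))\<^sup>2)) \<longlonglongrightarrow> 0" by simp
    qed
    fix j
    show "AE \<omega> in M. ennreal ((norm (?R (x j \<omega>) - ?R (X \<omega>)))\<^sup>2) \<le> 9 * ennreal ((norm (?R (X \<omega>)))\<^sup>2)"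
    proof (rule AE_I2)
      fix \<omega>
      have "norm (?R (x j \<omega>) - ?R (X \<omega>)) \<le> 3 * norm (?R (X \<omega>))"
        using norm_triangle_ineq4[of "?R (x j \<omega>)" "?R (X \<omega>)"] bound[of j \<omega>] by linarith
      then have "(norm (?R (x j \<omega>) - ?R (X \<omega>)))\<^sup>2 \<le> (3 * norm (?R (X \<omega>)))\<^sup>2"
        by (intro power_mono norm_ge_zero)
      then have "ennreal ((norm (?R (x j \<omega>) - ?R (X \<omega>)))\<^sup>2) \<le> ennreal (9 * (norm (?R (X \<omega>)))\<^sup>2)"
        by (intro ennreal_leI) (simp add: power_mult_distrib)
      then show "ennreal ((norm (?R (x j \<omega>) - ?R (X \<omega>)))\<^sup>2) \<le> 9 * ennreal ((norm (?R (X \<omega>)))\<^sup>2)"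
        by (simp add: ennreal_mult)
    qed
  qed measurable
  then have "(\<lambda>i. slice_energy (\<lambda>\<omega>. x i \<omega> - X \<omega>)) \<longlonglongrightarrow> 0" by simp
  from order_tendstoD(2)[OF this, of "ennreal \<epsilon>"] \<epsilon>
  have "\<forall>\<^sub>F i in sequentially. slice_energy (\<lambda>\<omega>. x i \<omega> - X \<omega>) < ennreal \<epsilon>" by simp
  then obtain i where "slice_energy (\<lambda>\<omega>. x i \<omega> - X \<omega>) < ennreal \<epsilon>"
    by (auto simp: eventually_sequentially)
  then show ?thesis using x by (intro exI[of _ "x i"]) (simp add: less_imp_le)
qed

text \<open>The \<sigma>-algebras \<open>G\<close> are unrelated to the given elementary process,
  which enters only through its distance from \<open>\<psi>\<close>. This is what allows a change of
  filtration.\<close>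

lemma adapted_approximation:
  assumes \<psi>: "jointly_measurable \<psi>" and T: "0 \<le> T" and supp: "\<And>s \<omega>. s \<notin> {0..T} \<Longrightarrow> \<psi> s \<omega> = 0"
    and I: "finite I" and ab: "\<And>i. i \<in> I \<Longrightarrow> 0 \<le> a i \<and> b i \<le> T" and x: "\<And>i. i \<in> I \<Longrightarrow> simple_function M (x i)"
    and \<epsilon>: "0 < \<epsilon>"
    and close: "energy (\<lambda>s \<omega>. \<psi> s \<omega> - (\<Sum>i\<in>I. indicator {a i<..b i} s *\<^sub>R x i \<omega>)) < ennreal \<epsilon>"
    and G: "\<And>s. s \<in> {0..T} \<Longrightarrow> subalgebra M (G s)" "\<And>s. s \<in> {0..T} \<Longrightarrow> \<psi> s \<in> borel_measurable (G s)"
  shows "\<exists>N (\<tau> :: nat \<Rightarrow> real) y. 0 \<le> \<tau> 0 \<and> (\<forall>j<N. \<tau> j \<le> \<tau> (Suc j) \<and> \<tau> j \<in> {0..T} \<and> simple_function (G (\<tau> j)) (y j)) \<and>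
    energy (\<lambda>s \<omega>. step N \<tau> y s \<omega> - \<psi> s \<omega>) \<le> ennreal (22 * \<epsilon>)"
proof -
  from grid_approximation[OF \<psi> T supp I ab x \<epsilon> close] obtain N and \<tau> :: "nat \<Rightarrow> real"
    where \<tau>0: "0 \<le> \<tau> 0" and \<tau>: "\<And>j. j < N \<Longrightarrow> \<tau> j \<le> \<tau> (Suc j)" "\<And>j. j < N \<Longrightarrow> \<tau> j \<in> {0..T}"
      and fin: "\<And>j. j < N \<Longrightarrow> slice_energy (\<psi> (\<tau> j)) < \<infinity>"
      and err: "energy (\<lambda>s \<omega>. (\<Sum>j<N. indicator {\<tau> j<..\<tau> (Suc j)} s *\<^sub>R \<psi> (\<tau> j) \<omega>) - \<psi> s \<omega>) \<le> ennreal (10 * \<epsilon>)"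
    by blast
  \<comment> \<open>Each grid value is allowed the error \<epsilon> / L, which adds up to at most
    \<epsilon> over the grid; the summand 1 keeps \<open>L\<close> positive for an empty
    grid.\<close>
  define L where "L = 1 + (\<Sum>j<N. \<tau> (Suc j) - \<tau> j)"
  have L: "0 < L" unfolding L_def using \<tau>(1) by (intro add_pos_nonneg sum_nonneg) auto
  have "\<forall>j. \<exists>y. j < N \<longrightarrow> simple_function (G (\<tau> j)) y \<and> slice_energy (\<lambda>\<omega>. y \<omega> - \<psi> (\<tau> j) \<omega>) \<le> ennreal (\<epsilon> / L)"
  proof
    fix j
    show "\<exists>y. j < N \<longrightarrow> simple_function (G (\<tau> j)) y \<and> slice_energy (\<lambda>\<omega>. y \<omega> - \<psi> (\<tau> j) \<omega>) \<le> ennreal (\<epsilon> / L)"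
    proof (cases "j < N")
      case True
      then show ?thesis
        using simple_approximation[OF G(1)[OF \<tau>(2)[OF True]] G(2)[OF \<tau>(2)[OF True]] fin[OF True], of "\<epsilon> / L"] \<epsilon> L
        by auto
    qed simp
  qed
  then obtain y where y: "\<And>j. j < N \<Longrightarrow> simple_function (G (\<tau> j)) (y j)"
    "\<And>j. j < N \<Longrightarrow> slice_energy (\<lambda>\<omega>. y j \<omega> - \<psi> (\<tau> j) \<omega>) \<le> ennreal (\<epsilon> / L)"
    by metis
  have y_meas: "y j \<in> borel_measurable M" if "j < N" for j
    using measurable_from_subalg[OF G(1)[OF \<tau>(2)[OF that]] borel_measurable_simple_function[OF y(1)[OF that]]] .
  define P where "P s \<omega> = step N \<tau> y s \<omega>" for s \<omega>
  define P' where "P' s \<omega> = (\<Sum>j<N. indicator {\<tau> j<..\<tau> (Suc j)} s *\<^sub>R \<psi> (\<tau> j) \<omega>)" for s \<omega>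
  have P: "jointly_measurable P" unfolding P_def[abs_def]
    by (rule jointly_measurable_elementary) (simp add: y_meas)
  have P': "jointly_measurable P'" unfolding P'_def[abs_def]
    by (rule jointly_measurable_elementary) (rule jointly_measurable_slice[OF \<psi>])
  have "energy (\<lambda>s \<omega>. P s \<omega> - P' s \<omega>) =
      energy (\<lambda>s \<omega>. \<Sum>j<N. indicator {\<tau> j<..\<tau> (Suc j)} s *\<^sub>R (y j \<omega> - \<psi> (\<tau> j) \<omega>))"
    by (simp only: P_def P'_def sum_subtractf[symmetric] scaleR_diff_right)
  also have "\<dots> = (\<Sum>j<N. ennreal (\<tau> (Suc j) - \<tau> j) * slice_energy (\<lambda>\<omega>. y j \<omega> - \<psi> (\<tau> j) \<omega>))"
    by (rule energy_step[of N \<tau>, OF \<tau>(1)])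
  also have "\<dots> \<le> (\<Sum>j<N. ennreal ((\<tau> (Suc j) - \<tau> j) * (\<epsilon> / L)))"
  proof (rule sum_mono)
    fix j assume "j \<in> {..<N}"
    then show "ennreal (\<tau> (Suc j) - \<tau> j) * slice_energy (\<lambda>\<omega>. y j \<omega> - \<psi> (\<tau> j) \<omega>) \<le> ennreal ((\<tau> (Suc j) - \<tau> j) * (\<epsilon> / L))"
      using \<tau>(1)[of j] \<epsilon> L y(2)[of j] by (subst ennreal_mult) (auto intro!: mult_left_mono)
  qed
  also have "\<dots> = ennreal (\<Sum>j<N. (\<tau> (Suc j) - \<tau> j) * (\<epsilon> / L))"
    using \<tau>(1) \<epsilon> L by (intro sum_ennreal mult_nonneg_nonneg) auto
  also have "\<dots> \<le> ennreal \<epsilon>"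
  proof (rule ennreal_leI)
    have "(\<Sum>j<N. (\<tau> (Suc j) - \<tau> j) * (\<epsilon> / L)) = (L - 1) * (\<epsilon> / L)"
      by (simp only: sum_distrib_right[symmetric]) (simp add: L_def)
    also have "\<dots> \<le> \<epsilon>" using L \<epsilon> by (simp add: field_simps)
    finally show "(\<Sum>j<N. (\<tau> (Suc j) - \<tau> j) * (\<epsilon> / L)) \<le> \<epsilon>" .
  qed
  finally have 1: "energy (\<lambda>s \<omega>. P s \<omega> - P' s \<omega>) \<le> ennreal \<epsilon>" .
  have "energy (\<lambda>s \<omega>. P s \<omega> - \<psi> s \<omega>) \<le>
      2 * energy (\<lambda>s \<omega>. P s \<omega> - P' s \<omega>) + 2 * energy (\<lambda>s \<omega>. P' s \<omega> - \<psi> s \<omega>)"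
    by (intro energy_triangle P P' \<psi>)
  \<comment> \<open>2 * 1 + 2 * 10 = 22, with 10 from \<open>grid_approximation\<close>.\<close>
  also have "\<dots> \<le> 2 * ennreal \<epsilon> + 2 * ennreal (10 * \<epsilon>)"
    using err by (intro add_mono mult_left_mono 1) (auto simp: P'_def)
  also have "\<dots> = ennreal (22 * \<epsilon>)"
    using \<epsilon> by (simp flip: ennreal_plus ennreal_mult' ennreal_numeral)
  finally show ?thesis
    using \<tau>0 \<tau> y(1) unfolding P_def by (intro exI[of _ N] exI[of _ \<tau>] exI[of _ y]) auto
qed

section \<open>Approximating a given stochastic integral\<close>

lemma energy_elementary:
  assumes I: "finite I" and ab: "\<And>i. i \<in> I \<Longrightarrow> 0 \<le> a i \<and> a i \<le> b i"
    and x: "\<And>i. i \<in> I \<Longrightarrow> simple_function (F (a i)) (x i)"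
  shows "(\<integral>\<^sup>+ \<omega>. ennreal ((\<Sum>i\<in>I. x i \<omega> \<bullet> (W (b i) \<omega> - W (a i) \<omega>))\<^sup>2) \<partial>M) =
    energy (\<lambda>s \<omega>. \<Sum>i\<in>I. indicator {a i<..b i} s *\<^sub>R x i \<omega>)"
proof -
  have "x i \<in> borel_measurable M" if "i \<in> I" for i
    using borel_measurable_simple_function[OF x[OF that]] ab[OF that] measurable_F_M by blast
  from energy_swap[OF jointly_measurable_elementary[OF this]] show ?thesis
    using ito_isometry[OF I ab x] by simp
qed

text \<open>Predictability is given for \<open>\<Phi>\<close> at each fixed vector, which makes the
  adjoint weakly measurable; separability upgrades this to Borel measurability.\<close>

lemma jointly_measurable_adjoint:
  fixes \<Phi> :: "real \<Rightarrow> 'a \<Rightarrow> 'h \<Rightarrow>\<^sub>L 'h"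
  assumes "\<And>h. predictable_process M F (\<lambda>s \<omega>. indicator {0..T} s *\<^sub>R \<Phi> s \<omega> h)"
  shows "jointly_measurable (\<lambda>s \<omega>. indicator {0..T} s *\<^sub>R adjoint_op (\<Phi> s \<omega>) f)"
proof (rule borel_measurable_innerI)
  fix h
  have "(\<lambda>p. indicator {0..T} (fst p) *\<^sub>R (indicator {0..T} (fst p) *\<^sub>R \<Phi> (fst p) (snd p) h)) \<in> borel_measurable (lborel \<Otimes>\<^sub>M M)"
    using predictable_process_measurable[OF filtered assms[of h], of T] by (simp add: case_prod_beta')
  then have "(\<lambda>p. f \<bullet> (indicator {0..T} (fst p) *\<^sub>R (indicator {0..T} (fst p) *\<^sub>R \<Phi> (fst p) (snd p) h))) \<in> borel_measurable (lborel \<Otimes>\<^sub>M M)"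
    by (intro borel_measurable_inner borel_measurable_const)
  moreover have "(\<lambda>p. f \<bullet> (indicator {0..T} (fst p) *\<^sub>R (indicator {0..T} (fst p) *\<^sub>R \<Phi> (fst p) (snd p) h))) =
    (\<lambda>p. (indicator {0..T} (fst p) *\<^sub>R adjoint_op (\<Phi> (fst p) (snd p)) f) \<bullet> h)"
    by (auto simp: indicator_def adjoint_op_inner)
  ultimately show "(\<lambda>p. (indicator {0..T} (fst p) *\<^sub>R adjoint_op (\<Phi> (fst p) (snd p)) f) \<bullet> h) \<in> borel_measurable (lborel \<Otimes>\<^sub>M M)"
    by simp
qed

text \<open>Testing with \<open>f\<close> costs at most the factor \<open>(norm f)\<^sup>2\<close>,
  both for the energies, where the Hilbert-Schmidt norm is the majorant, and for the integrals, by
  Cauchy-Schwarz.\<close>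

lemma stochastic_integral_elementary_approximation:
  fixes \<Phi> :: "real \<Rightarrow> 'a \<Rightarrow> 'h \<Rightarrow>\<^sub>L 'h" and f :: 'h
  assumes int: "has_stochastic_integral M F Q W T \<Phi> I" and \<epsilon>: "0 < \<epsilon>"
  defines "\<psi> \<equiv> \<lambda>s \<omega>. indicator {0..T} s *\<^sub>R adjoint_op (\<Phi> s \<omega>) f"
  shows "\<exists>(n :: nat) \<tau> x. (\<forall>i<n. 0 \<le> \<tau> i \<and> \<tau> i \<le> \<tau> (Suc i) \<and> \<tau> (Suc i) \<le> T \<and> simple_function (F (\<tau> i)) (x i)) \<and>
    energy (\<lambda>s \<omega>. \<psi> s \<omega> - step n \<tau> x s \<omega>) < ennreal \<epsilon> \<and>
    (\<integral>\<^sup>+ \<omega>. ennreal ((step_integral n \<tau> x \<omega> - I \<omega> \<bullet> f)\<^sup>2) \<partial>M) < ennreal \<epsilon>"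
proof -
  from int have pred: "\<And>h. predictable_process M F (\<lambda>s \<omega>. indicator {0..T} s *\<^sub>R \<Phi> s \<omega> h)"
    and I[measurable]: "I \<in> borel_measurable M"
    unfolding has_stochastic_integral_def by blast+
  from int obtain n \<tau> A where el: "\<And>k. elementary_data F T (n k) (\<tau> k) (A k)"
    and lim1: "(\<lambda>k. \<integral>\<^sup>+ \<omega>. (\<integral>\<^sup>+ s. hs_norm_sq ((elementary_integrand (n k) (\<tau> k) (A k) s \<omega> - \<Phi> s \<omega>) o\<^sub>L sqrt_op Q) *
            indicator {0..T} s \<partial>lborel) \<partial>M) \<longlonglongrightarrow> 0"
    and lim2: "(\<lambda>k. \<integral>\<^sup>+ \<omega>. ennreal ((norm (elementary_integral W (n k) (\<tau> k) (A k) \<omega> - I \<omega>))\<^sup>2) \<partial>M) \<longlonglongrightarrow> 0"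
    unfolding has_stochastic_integral_def by blast
  \<comment> \<open>The summand 1 keeps \<open>c\<close> positive when f = 0, so that \<epsilon> / c
    is a legitimate tolerance.\<close>
  define c where "c = (norm f)\<^sup>2 + 1"
  have c: "0 < c" "(norm f)\<^sup>2 \<le> c" by (auto simp: c_def add_nonneg_pos)
  have "0 < ennreal (\<epsilon> / c)" using \<epsilon> c by simp
  from eventually_conj[OF order_tendstoD(2)[OF lim1 this] order_tendstoD(2)[OF lim2 this]]
  obtain k where k1: "(\<integral>\<^sup>+ \<omega>. (\<integral>\<^sup>+ s. hs_norm_sq ((elementary_integrand (n k) (\<tau> k) (A k) s \<omega> - \<Phi> s \<omega>) o\<^sub>L sqrt_op Q) *
            indicator {0..T} s \<partial>lborel) \<partial>M) < ennreal (\<epsilon> / c)"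
    and k2: "(\<integral>\<^sup>+ \<omega>. ennreal ((norm (elementary_integral W (n k) (\<tau> k) (A k) \<omega> - I \<omega>))\<^sup>2) \<partial>M) < ennreal (\<epsilon> / c)"
    by (auto simp: eventually_sequentially)
  have c\<epsilon>: "ennreal c * r < ennreal \<epsilon>" if "r < ennreal (\<epsilon> / c)" for r
  proof -
    have "r * ennreal c < ennreal (\<epsilon> / c) * ennreal c"
      using c that by (intro ennreal_mult_strict_right_mono) auto
    also have "\<dots> = ennreal \<epsilon>" using c \<epsilon> by (simp flip: ennreal_mult)
    finally show ?thesis by (simp add: mult.commute)
  qed
  let ?n = "n k" and ?\<tau> = "\<tau> k" and ?A = "A k"
  define x where "x i \<omega> = adjoint_op (?A i \<omega>) f" for i \<omega>
  have mono: "?\<tau> i \<le> ?\<tau> (Suc i)" if "i < ?n" for i using el[of k] that by (simp add: elementary_data_def)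
  have \<tau>0: "0 \<le> ?\<tau> i" if "i \<le> ?n" for i
    using partition_mono[of ?n ?\<tau> 0 i] mono that el[of k] by (force simp: elementary_data_def)
  have \<tau>T: "?\<tau> i \<le> T" if "i \<le> ?n" for i
    using partition_mono[of ?n ?\<tau> i ?n] mono that el[of k] by (force simp: elementary_data_def)
  have x: "simple_function (F (?\<tau> i)) (x i)" if "i < ?n" for i
    unfolding x_def using el[of k] that by (intro simple_function_compose1[where g="\<lambda>A. adjoint_op A f"]) (simp add: elementary_data_def)
  have x_meas: "x i \<in> borel_measurable M" if "i \<in> {..<?n}" for i
    using borel_measurable_simple_function[OF x, of i] \<tau>0[of i] that measurable_F_M by auto
  define e where "e s \<omega> = step ?n ?\<tau> x s \<omega>" for s \<omega>
  have e: "jointly_measurable e" unfolding e_def[abs_def] by (rule jointly_measurable_elementary[OF x_meas])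
  have \<psi>: "jointly_measurable \<psi>" unfolding \<psi>_def by (rule jointly_measurable_adjoint[OF pred])
  have d: "jointly_measurable (\<lambda>s \<omega>. \<psi> s \<omega> - e s \<omega>)" using e \<psi> by measurable
  have pointwise: "ennreal ((norm (sqrt_op Q (\<psi> s \<omega> - e s \<omega>)))\<^sup>2) \<le> ennreal c *
      (hs_norm_sq ((elementary_integrand ?n ?\<tau> ?A s \<omega> - \<Phi> s \<omega>) o\<^sub>L sqrt_op Q) * indicator {0..T} s)" for s \<omega>
  proof (cases "s \<in> {0..T}")
    case True
    have "e s \<omega> - \<psi> s \<omega> = adjoint_op (elementary_integrand ?n ?\<tau> ?A s \<omega> - \<Phi> s \<omega>) f"
      unfolding \<psi>_def e_def x_def adjoint_op_diff elementary_integrand_def adjoint_op_sum using True by simp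
    then have "ennreal ((norm (sqrt_op Q (e s \<omega> - \<psi> s \<omega>)))\<^sup>2) \<le>
        ennreal ((norm f)\<^sup>2) * hs_norm_sq ((elementary_integrand ?n ?\<tau> ?A s \<omega> - \<Phi> s \<omega>) o\<^sub>L sqrt_op Q)"
      using norm_sqrt_op_adjoint_le_hs_norm_sq[OF covariance] by simp
    also have "\<dots> \<le> ennreal c * hs_norm_sq ((elementary_integrand ?n ?\<tau> ?A s \<omega> - \<Phi> s \<omega>) o\<^sub>L sqrt_op Q)"
      using c by (intro mult_right_mono ennreal_leI) auto
    finally show ?thesis using True by (simp add: blinfun.diff_right norm_minus_commute)
  next
    case False
    have "indicator {?\<tau> i<..?\<tau> (Suc i)} s *\<^sub>R x i \<omega> = 0" if "i < ?n" for i
      using False \<tau>0[of i] \<tau>T[of "Suc i"] that by (auto simp: indicator_def)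
    then have "e s \<omega> = 0" unfolding e_def by (intro sum.neutral) auto
    then show ?thesis using False by (simp add: \<psi>_def blinfun.zero_right)
  qed
  have d_meas: "(\<lambda>s. ennreal ((norm (sqrt_op Q (\<psi> s \<omega> - e s \<omega>)))\<^sup>2)) \<in> borel_measurable lborel" if "\<omega> \<in> space M" for \<omega>
    using norm_sqrt_measurable[OF measurable_compose[OF measurable_Pair2'[OF that] d]] by simp
  have d_meas': "(\<lambda>\<omega>. \<integral>\<^sup>+ s. ennreal ((norm (sqrt_op Q (\<psi> s \<omega> - e s \<omega>)))\<^sup>2) \<partial>lborel) \<in> borel_measurable M"
  proof (rule lborel.borel_measurable_nn_integral)
    show "(\<lambda>(\<omega>, s). ennreal ((norm (sqrt_op Q (\<psi> s \<omega> - e s \<omega>)))\<^sup>2)) \<in> borel_measurable (M \<Otimes>\<^sub>M lborel)"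
      using measurable_compose[OF measurable_pair_swap' norm_sqrt_measurable[OF d]] by (simp add: case_prod_beta')
  qed
  have "energy (\<lambda>s \<omega>. \<psi> s \<omega> - e s \<omega>) = (\<integral>\<^sup>+ \<omega>. (\<integral>\<^sup>+ s. ennreal ((norm (sqrt_op Q (\<psi> s \<omega> - e s \<omega>)))\<^sup>2) \<partial>lborel) \<partial>M)"
    by (rule energy_swap[OF d, symmetric])
  also have "\<dots> \<le> ennreal c * (\<integral>\<^sup>+ \<omega>. (\<integral>\<^sup>+ s. hs_norm_sq ((elementary_integrand ?n ?\<tau> ?A s \<omega> - \<Phi> s \<omega>) o\<^sub>L sqrt_op Q) *
            indicator {0..T} s \<partial>lborel) \<partial>M)"
    using c by (intro nn_integral_le_cmultI d_meas d_meas' pointwise) auto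
  also have "\<dots> < ennreal \<epsilon>" by (rule c\<epsilon>[OF k1])
  finally have E: "energy (\<lambda>s \<omega>. \<psi> s \<omega> - e s \<omega>) < ennreal \<epsilon>" .
  define J where "J \<omega> = step_integral ?n ?\<tau> x \<omega>" for \<omega>
  have J: "J \<omega> = elementary_integral W ?n ?\<tau> ?A \<omega> \<bullet> f" for \<omega>
    by (simp add: J_def x_def elementary_integral_def inner_sum_left adjoint_op_inner inner_commute[of f])
  have [measurable]: "J \<in> borel_measurable M"
    unfolding J_def[abs_def] using \<tau>0 by (intro borel_measurable_sum borel_measurable_inner borel_measurable_diff W_measurable x_meas) auto
  have "(\<integral>\<^sup>+ \<omega>. ennreal ((J \<omega> - I \<omega> \<bullet> f)\<^sup>2) \<partial>M) \<le>
      ennreal c * (\<integral>\<^sup>+ \<omega>. ennreal ((norm (elementary_integral W ?n ?\<tau> ?A \<omega> - I \<omega>))\<^sup>2) \<partial>M)"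
  proof (rule nn_integral_le_cmultI)
    fix \<omega>
    have "(J \<omega> - I \<omega> \<bullet> f)\<^sup>2 \<le> (norm (elementary_integral W ?n ?\<tau> ?A \<omega> - I \<omega>) * norm f)\<^sup>2"
      unfolding J inner_diff_left[symmetric] using Cauchy_Schwarz_ineq2 by (rule power2_le_iff_abs_le[THEN iffD2, rotated]) simp
    also have "\<dots> \<le> c * (norm (elementary_integral W ?n ?\<tau> ?A \<omega> - I \<omega>))\<^sup>2"
      unfolding power_mult_distrib using c by (subst mult.commute) (intro mult_right_mono, auto)
    finally show "ennreal ((J \<omega> - I \<omega> \<bullet> f)\<^sup>2) \<le> ennreal c * ennreal ((norm (elementary_integral W ?n ?\<tau> ?A \<omega> - I \<omega>))\<^sup>2)"
      using c by (simp add: ennreal_leI flip: ennreal_mult)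
  qed (use c in \<open>auto\<close>)
  also have "\<dots> < ennreal \<epsilon>" by (rule c\<epsilon>[OF k2])
  finally have "(\<integral>\<^sup>+ \<omega>. ennreal ((J \<omega> - I \<omega> \<bullet> f)\<^sup>2) \<partial>M) < ennreal \<epsilon>" .
  with E show ?thesis unfolding e_def J_def
    by (intro exI[of _ ?n] exI[of _ ?\<tau>] exI[of _ x]) (use mono \<tau>0 \<tau>T x in auto)
qed

text \<open>The approximants adapted to \<open>F\<close> are exchanged for ones measurable for
  \<open>G\<close>: both are close to \<open>\<psi>\<close> in energy, and the isometry for their
  difference shows that their integrals are close too. It applies because \<open>G s\<close> lies in
  \<open>F s\<close>, so that the sampled process is adapted to \<open>F\<close> as well.\<close>

lemma stochastic_integral_approximation:
  fixes \<Phi> :: "real \<Rightarrow> 'a \<Rightarrow> 'h \<Rightarrow>\<^sub>L 'h" and f :: 'h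
  assumes int: "has_stochastic_integral M F Q W T \<Phi> I" and T: "0 \<le> T" and \<epsilon>: "0 < \<epsilon>"
  defines "\<psi> \<equiv> \<lambda>s \<omega>. indicator {0..T} s *\<^sub>R adjoint_op (\<Phi> s \<omega>) f"
  assumes G: "\<And>s. s \<in> {0..T} \<Longrightarrow> subalgebra (F s) (G s)" "\<And>s. s \<in> {0..T} \<Longrightarrow> \<psi> s \<in> borel_measurable (G s)"
  shows "\<exists>(N :: nat) \<tau> y. 0 \<le> \<tau> 0 \<and> (\<forall>j<N. \<tau> j \<le> \<tau> (Suc j) \<and> \<tau> j \<in> {0..T} \<and> simple_function (G (\<tau> j)) (y j)) \<and>
    energy (\<lambda>s \<omega>. step N \<tau> y s \<omega> - \<psi> s \<omega>) \<le> ennreal \<epsilon> \<and>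
    (\<integral>\<^sup>+ \<omega>. ennreal ((step_integral N \<tau> y \<omega> - I \<omega> \<bullet> f)\<^sup>2) \<partial>M) \<le> ennreal \<epsilon>"
proof -
  \<comment> \<open>94 = 2 (2 * 22 + 2 * 1) + 2 * 1. The bracket bounds the energy between the two
    step processes, with 22 from \<open>adapted_approximation\<close>; the last term is the distance
    of the elementary integral from \<open>I\<close>.\<close>
  define \<epsilon>' where "\<epsilon>' = \<epsilon> / 94"
  have \<epsilon>': "0 < \<epsilon>'" using \<epsilon> by (simp add: \<epsilon>'_def)
  from int have pred: "\<And>h. predictable_process M F (\<lambda>s \<omega>. indicator {0..T} s *\<^sub>R \<Phi> s \<omega> h)"
    and I[measurable]: "I \<in> borel_measurable M"
    unfolding has_stochastic_integral_def by blast+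
  have \<psi>: "jointly_measurable \<psi>" unfolding \<psi>_def by (rule jointly_measurable_adjoint[OF pred])
  have supp: "\<psi> s \<omega> = 0" if "s \<notin> {0..T}" for s \<omega> using that by (simp add: \<psi>_def)
  obtain n :: nat and \<sigma> x where \<sigma>: "\<And>i. i < n \<Longrightarrow> 0 \<le> \<sigma> i" "\<And>i. i < n \<Longrightarrow> \<sigma> i \<le> \<sigma> (Suc i)" "\<And>i. i < n \<Longrightarrow> \<sigma> (Suc i) \<le> T"
    and x: "\<And>i. i < n \<Longrightarrow> simple_function (F (\<sigma> i)) (x i)"
    and close: "energy (\<lambda>s \<omega>. \<psi> s \<omega> - step n \<sigma> x s \<omega>) < ennreal \<epsilon>'"
    and closeI: "(\<integral>\<^sup>+ \<omega>. ennreal ((step_integral n \<sigma> x \<omega> - I \<omega> \<bullet> f)\<^sup>2) \<partial>M) < ennreal \<epsilon>'"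
    using stochastic_integral_elementary_approximation[OF int \<epsilon>', of f] unfolding \<psi>_def by blast
  have xM: "simple_function M (x i)" if "i < n" for i
    using x[OF that] subalgebra_F[OF \<sigma>(1)[OF that]] unfolding simple_function_def subalgebra_def by auto
  have GM: "subalgebra M (G s)" if "s \<in> {0..T}" for s
    using G(1)[OF that] subalgebra_F[of s] that unfolding subalgebra_def by auto
  have ab': "0 \<le> \<sigma> i \<and> \<sigma> (Suc i) \<le> T" and xM': "simple_function M (x i)" if "i \<in> {..<n}" for i
    using that \<sigma> xM by auto
  obtain N and \<tau> :: "nat \<Rightarrow> real" and y where \<tau>0: "0 \<le> \<tau> 0"
    and \<tau>: "\<And>j. j < N \<Longrightarrow> \<tau> j \<le> \<tau> (Suc j)" "\<And>j. j < N \<Longrightarrow> \<tau> j \<in> {0..T}"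
    and y: "\<And>j. j < N \<Longrightarrow> simple_function (G (\<tau> j)) (y j)"
    and err: "energy (\<lambda>s \<omega>. step N \<tau> y s \<omega> - \<psi> s \<omega>) \<le> ennreal (22 * \<epsilon>')"
    using adapted_approximation[of \<psi> T "{..<n}" \<sigma> "\<lambda>i. \<sigma> (Suc i)" x \<epsilon>' G,
        OF \<psi> T supp finite_lessThan ab' xM' \<epsilon>' close GM G(2)] by blast
  have yF: "simple_function (F (\<tau> j)) (y j)" if "j < N" for j
    using y[OF that] G(1)[OF \<tau>(2)[OF that]] unfolding simple_function_def subalgebra_def by auto
  define P where "P s \<omega> = step N \<tau> y s \<omega>" for s \<omega>
  define e where "e s \<omega> = step n \<sigma> x s \<omega>" for s \<omega>
  define JP where "JP \<omega> = step_integral N \<tau> y \<omega>" for \<omega>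
  define Je where "Je \<omega> = step_integral n \<sigma> x \<omega>" for \<omega>
  have y_meas: "y j \<in> borel_measurable M" if "j < N" for j
    using borel_measurable_simple_function[OF yF[OF that]] \<tau>(2)[OF that] measurable_F_M by auto
  have x_meas: "x i \<in> borel_measurable M" if "i < n" for i by (rule borel_measurable_simple_function[OF xM[OF that]])
  have P: "jointly_measurable P" unfolding P_def[abs_def] by (rule jointly_measurable_elementary) (simp add: y_meas)
  have e: "jointly_measurable e" unfolding e_def[abs_def] by (rule jointly_measurable_elementary) (simp add: x_meas)
  have \<tau>_Suc: "0 \<le> \<tau> (Suc j)" if "j < N" for j using \<tau>[OF that] by auto
  have \<sigma>_Suc: "0 \<le> \<sigma> (Suc i)" if "i < n" for i using \<sigma>(1,2)[OF that] by auto
  have [measurable]: "JP \<in> borel_measurable M" "Je \<in> borel_measurable M"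
    unfolding JP_def[abs_def] Je_def[abs_def] using \<tau>(2) \<tau>_Suc \<sigma>(1) \<sigma>_Suc
    by (intro borel_measurable_sum borel_measurable_inner borel_measurable_diff W_measurable x_meas y_meas, auto)+
  \<comment> \<open>The two grids are joined over a disjoint sum of index sets, with a sign on the
    second, so that one application of the isometry covers the difference.\<close>
  define a where "a = case_sum \<tau> \<sigma>"
  define b where "b = case_sum (\<lambda>j. \<tau> (Suc j)) (\<lambda>i. \<sigma> (Suc i))"
  define z where "z = case_sum y (\<lambda>i \<omega>. - x i \<omega>)"
  have sum_Plus: "(\<Sum>i\<in>{..<N} <+> {..<n}. h i) = (\<Sum>j<N. h (Inl j)) + (\<Sum>i<n. h (Inr i))"
    for h :: "nat + nat \<Rightarrow> 'z::comm_monoid_add"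
    by (simp add: sum.Plus)
  have "(\<integral>\<^sup>+ \<omega>. ennreal ((\<Sum>i\<in>{..<N} <+> {..<n}. z i \<omega> \<bullet> (W (b i) \<omega> - W (a i) \<omega>))\<^sup>2) \<partial>M) =
      energy (\<lambda>s \<omega>. \<Sum>i\<in>{..<N} <+> {..<n}. indicator {a i<..b i} s *\<^sub>R z i \<omega>)"
  proof (rule energy_elementary)
    fix i assume "i \<in> {..<N} <+> {..<n}"
    then show "0 \<le> a i \<and> a i \<le> b i" "simple_function (F (a i)) (z i)"
      using \<tau> \<sigma> yF simple_function_compose1[OF x, where g=uminus] by (auto simp: a_def b_def z_def)
  qed simp
  then have iso: "(\<integral>\<^sup>+ \<omega>. ennreal ((JP \<omega> - Je \<omega>)\<^sup>2) \<partial>M) = energy (\<lambda>s \<omega>. P s \<omega> - e s \<omega>)"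
    unfolding sum_Plus by (simp add: a_def b_def z_def JP_def Je_def P_def e_def sum_negf del: indicator_simps)
  have "energy (\<lambda>s \<omega>. P s \<omega> - e s \<omega>) \<le> 2 * energy (\<lambda>s \<omega>. P s \<omega> - \<psi> s \<omega>) + 2 * energy (\<lambda>s \<omega>. \<psi> s \<omega> - e s \<omega>)"
    by (intro energy_triangle P e \<psi>)
  also have "\<dots> \<le> 2 * ennreal (22 * \<epsilon>') + 2 * ennreal \<epsilon>'"
    using err less_imp_le[OF close] by (intro add_mono mult_left_mono) (auto simp: P_def e_def)
  finally have Pe: "energy (\<lambda>s \<omega>. P s \<omega> - e s \<omega>) \<le> 2 * ennreal (22 * \<epsilon>') + 2 * ennreal \<epsilon>'" .
  have "(\<integral>\<^sup>+ \<omega>. ennreal ((JP \<omega> - I \<omega> \<bullet> f)\<^sup>2) \<partial>M) \<le>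
    (\<integral>\<^sup>+ \<omega>. 2 * ennreal ((JP \<omega> - Je \<omega>)\<^sup>2) + 2 * ennreal ((Je \<omega> - I \<omega> \<bullet> f)\<^sup>2) \<partial>M)"
  proof (rule nn_integral_mono)
    fix \<omega>
    have "(u + v)\<^sup>2 \<le> 2 * u\<^sup>2 + 2 * v\<^sup>2" for u v :: real
      using sum_squares_bound[of u v] unfolding power2_sum by linarith
    from this[of "JP \<omega> - Je \<omega>" "Je \<omega> - I \<omega> \<bullet> f"]
    have "ennreal ((JP \<omega> - I \<omega> \<bullet> f)\<^sup>2) \<le> ennreal (2 * (JP \<omega> - Je \<omega>)\<^sup>2 + 2 * (Je \<omega> - I \<omega> \<bullet> f)\<^sup>2)"
      by (intro ennreal_leI) simp
    then show "ennreal ((JP \<omega> - I \<omega> \<bullet> f)\<^sup>2) \<le> 2 * ennreal ((JP \<omega> - Je \<omega>)\<^sup>2) + 2 * ennreal ((Je \<omega> - I \<omega> \<bullet> f)\<^sup>2)"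
      by (simp add: ennreal_plus ennreal_mult)
  qed
  also have "\<dots> = 2 * energy (\<lambda>s \<omega>. P s \<omega> - e s \<omega>) + 2 * (\<integral>\<^sup>+ \<omega>. ennreal ((Je \<omega> - I \<omega> \<bullet> f)\<^sup>2) \<partial>M)"
    by (simp add: nn_integral_add nn_integral_cmult iso)
  also have "\<dots> \<le> 2 * (2 * ennreal (22 * \<epsilon>') + 2 * ennreal \<epsilon>') + 2 * ennreal \<epsilon>'"
    using less_imp_le[OF closeI] by (intro add_mono mult_left_mono Pe) (auto simp: Je_def)
  also have "\<dots> = ennreal (94 * \<epsilon>')"
    using \<epsilon>' by (simp flip: ennreal_plus ennreal_mult' ennreal_numeral)
  also have "94 * \<epsilon>' = \<epsilon>" by (simp add: \<epsilon>'_def)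
  finally have "(\<integral>\<^sup>+ \<omega>. ennreal ((JP \<omega> - I \<omega> \<bullet> f)\<^sup>2) \<partial>M) \<le> ennreal \<epsilon>" .
  moreover have "energy (\<lambda>s \<omega>. P s \<omega> - \<psi> s \<omega>) \<le> ennreal \<epsilon>"
    by (rule order_trans[OF err[folded P_def]]) (use \<epsilon> in \<open>auto simp: \<epsilon>'_def intro!: ennreal_leI\<close>)
  ultimately show ?thesis
    using \<tau>0 \<tau> y unfolding P_def JP_def by (intro exI[of _ N] exI[of _ \<tau>] exI[of _ y]) auto
qed

end

section \<open>Integrals of deterministic integrands\<close>

definition ae_completion :: "'a measure \<Rightarrow> 'a measure \<Rightarrow> 'a measure" where
  "ae_completion M N = sigma (space M) {A \<in> sets M. \<exists>A'\<in>sets N. AE \<omega> in M. \<omega> \<in> A \<longleftrightarrow> \<omega> \<in> A'}"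

lemma sigma_algebra_ae_completion:
  assumes N: "subalgebra M N"
  shows "sigma_algebra (space M) {A \<in> sets M. \<exists>A'\<in>sets N. AE \<omega> in M. \<omega> \<in> A \<longleftrightarrow> \<omega> \<in> A'}" (is "sigma_algebra _ ?S")
  unfolding sigma_algebra_iff2
proof (intro conjI ballI allI impI)
  show "?S \<subseteq> Pow (space M)" using sets.sets_into_space by auto
  show "{} \<in> ?S" by (auto intro!: bexI[of _ "{}"])
next
  fix A assume "A \<in> ?S"
  then obtain A' where A: "A \<in> sets M" "A' \<in> sets N" "AE \<omega> in M. \<omega> \<in> A \<longleftrightarrow> \<omega> \<in> A'" by blast
  have "space M - A' \<in> sets N" using A(2) N sets.compl_sets[of A' N] by (simp add: subalgebra_def)
  moreover have "AE \<omega> in M. \<omega> \<in> space M - A \<longleftrightarrow> \<omega> \<in> space M - A'" using A(3) by eventually_elim auto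
  ultimately show "space M - A \<in> ?S" using A(1) by blast
next
  fix A :: "nat \<Rightarrow> 'a set" assume "range A \<subseteq> ?S"
  then have "\<forall>i. \<exists>A'. A' \<in> sets N \<and> (AE \<omega> in M. \<omega> \<in> A i \<longleftrightarrow> \<omega> \<in> A')" and A: "\<And>i. A i \<in> sets M" by blast+
  then obtain A' where A': "\<And>i. A' i \<in> sets N" "\<And>i. AE \<omega> in M. \<omega> \<in> A i \<longleftrightarrow> \<omega> \<in> A' i" by metis
  have "AE \<omega> in M. \<forall>i. \<omega> \<in> A i \<longleftrightarrow> \<omega> \<in> A' i" using A'(2) by (simp add: AE_all_countable)
  then have "AE \<omega> in M. \<omega> \<in> (\<Union>i. A i) \<longleftrightarrow> \<omega> \<in> (\<Union>i. A' i)" by eventually_elim auto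
  moreover have "(\<Union>i. A' i) \<in> sets N" using A'(1) by auto
  ultimately show "(\<Union>i. A i) \<in> ?S" using A by blast
qed

lemma space_ae_completion: "space (ae_completion M N) = space M"
  by (simp add: ae_completion_def space_measure_of_conv)

lemma sets_ae_completion:
  assumes "subalgebra M N"
  shows "sets (ae_completion M N) = {A \<in> sets M. \<exists>A'\<in>sets N. AE \<omega> in M. \<omega> \<in> A \<longleftrightarrow> \<omega> \<in> A'}"
  unfolding ae_completion_def
  by (rule sigma_algebra.sets_measure_of_eq[OF sigma_algebra_ae_completion[OF assms]])

lemma subalgebra_ae_completion: "subalgebra M N \<Longrightarrow> subalgebra M (ae_completion M N)"
  by (auto simp: subalgebra_def sets_ae_completion space_ae_completion)

lemma subalgebra_ae_completion_base: "subalgebra M N \<Longrightarrow> subalgebra (ae_completion M N) N"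
  by (auto simp: subalgebra_def sets_ae_completion space_ae_completion)

lemma measurable_ae_completion_AE_eq:
  assumes N: "subalgebra M N" and X: "X \<in> measurable M L" and Y: "Y \<in> measurable (ae_completion M N) L"
    and eq: "AE \<omega> in M. X \<omega> = Y \<omega>"
  shows "X \<in> measurable (ae_completion M N) L"
proof (rule measurableI)
  fix \<omega> assume "\<omega> \<in> space (ae_completion M N)"
  then show "X \<omega> \<in> space L" using measurable_space[OF X] by (simp add: space_ae_completion)
next
  fix U assume U: "U \<in> sets L"
  have "Y -` U \<inter> space M \<in> sets (ae_completion M N)" using measurable_sets[OF Y U] by (simp add: space_ae_completion)
  then obtain A' where A': "A' \<in> sets N" "AE \<omega> in M. \<omega> \<in> Y -` U \<inter> space M \<longleftrightarrow> \<omega> \<in> A'"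
    unfolding sets_ae_completion[OF N] by blast
  have "AE \<omega> in M. \<omega> \<in> X -` U \<inter> space M \<longleftrightarrow> \<omega> \<in> A'" using A'(2) eq by eventually_elim auto
  then show "X -` U \<inter> space (ae_completion M N) \<in> sets (ae_completion M N)"
    using A'(1) measurable_sets[OF X U] unfolding sets_ae_completion[OF N] space_ae_completion by blast
qed

lemma (in prob_space) ae_completion_indep:
  assumes N: "subalgebra M N" and indep: "\<And>A. A \<in> sets N \<Longrightarrow> prob (A \<inter> C) = prob A * prob C"
    and C: "C \<in> events" and A: "A \<in> sets (ae_completion M N)"
  shows "prob (A \<inter> C) = prob A * prob C"
proof -
  from A obtain A' where A': "A \<in> events" "A' \<in> sets N" "AE \<omega> in M. \<omega> \<in> A \<longleftrightarrow> \<omega> \<in> A'"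
    unfolding sets_ae_completion[OF N] by blast
  then have [measurable]: "A' \<in> events" "A \<in> events" using N by (auto simp: subalgebra_def)
  have "prob (A \<inter> C) = prob (A' \<inter> C)"
    using A'(3) C by (intro finite_measure_eq_AE) auto
  moreover have "prob A = prob A'" using A'(3) by (intro finite_measure_eq_AE) auto
  ultimately show ?thesis using indep[OF A'(2)] by simp
qed

text \<open>The squared errors have summable expectations, so their sum is finite almost surely and
  its terms tend to 0.\<close>

lemma AE_LIMSEQ_of_summable_square_errors:
  fixes J :: "nat \<Rightarrow> 'a \<Rightarrow> real"
  assumes [measurable]: "\<And>k. J k \<in> borel_measurable M" "X \<in> borel_measurable M"
    and err: "\<And>k. (\<integral>\<^sup>+ \<omega>. ennreal ((J k \<omega> - X \<omega>)\<^sup>2) \<partial>M) \<le> ennreal ((1/2) ^ k)"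
  shows "AE \<omega> in M. (\<lambda>k. J k \<omega>) \<longlonglongrightarrow> X \<omega>"
proof -
  have "(\<integral>\<^sup>+ \<omega>. (\<Sum>k. ennreal ((J k \<omega> - X \<omega>)\<^sup>2)) \<partial>M) = (\<Sum>k. \<integral>\<^sup>+ \<omega>. ennreal ((J k \<omega> - X \<omega>)\<^sup>2) \<partial>M)"
    by (rule nn_integral_suminf) measurable
  also have "\<dots> \<le> (\<Sum>k. ennreal ((1/2) ^ k))" by (intro suminf_le err) auto
  also have "\<dots> = ennreal (\<Sum>k. (1/2) ^ k)" by (rule suminf_ennreal2) (auto intro: summable_geometric)
  finally have "(\<integral>\<^sup>+ \<omega>. (\<Sum>k. ennreal ((J k \<omega> - X \<omega>)\<^sup>2)) \<partial>M) \<noteq> \<infinity>" by (auto simp: top_unique)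
  then have "AE \<omega> in M. (\<Sum>k. ennreal ((J k \<omega> - X \<omega>)\<^sup>2)) \<noteq> \<infinity>"
    by (intro nn_integral_noteq_infinite) measurable
  then show ?thesis
  proof eventually_elim
    case (elim \<omega>)
    then have "summable (\<lambda>k. (J k \<omega> - X \<omega>)\<^sup>2)" by (intro summable_suminf_not_top) auto
    then have "(\<lambda>k. (J k \<omega> - X \<omega>)\<^sup>2) \<longlonglongrightarrow> 0" by (rule summable_LIMSEQ_zero)
    then have "(\<lambda>k. sqrt ((J k \<omega> - X \<omega>)\<^sup>2)) \<longlonglongrightarrow> sqrt 0" by (rule tendsto_real_sqrt)
    then have "(\<lambda>k. J k \<omega> - X \<omega>) \<longlonglongrightarrow> 0" by (simp add: tendsto_rabs_zero_iff)
    then show ?case by (rule LIM_zero_cancel)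
  qed
qed

text \<open>A deterministic integrand is measurable for the trivial \<sigma>-algebra, which may
  therefore serve as \<open>G\<close>. Simple functions for it are constant, so the step integrals
  involve nothing random but increments of \<open>W\<close>.\<close>

lemma (in wiener) deterministic_integral_measurable:
  fixes D :: "real \<Rightarrow> 'h \<Rightarrow>\<^sub>L 'h"
  assumes int: "has_stochastic_integral M F Q W T (\<lambda>s \<omega>. D s) I" and T: "0 \<le> T"
  shows "I \<in> borel_measurable (ae_completion M (generated_sigma M W {0..}))"
proof (rule borel_measurable_innerI)
  fix h
  let ?N = "generated_sigma M W {0..}"
  let ?C = "ae_completion M ?N"
  let ?G = "\<lambda>s :: real. sigma (space M) {} :: 'a measure"
  have I[measurable]: "I \<in> borel_measurable M" using int by (simp add: has_stochastic_integral_def)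
  have G_sub: "subalgebra L (?G s)" if "space L = space M" for L s
    using that sets.top[of L] by (auto simp: subalgebra_def space_measure_of_conv sets_measure_of_conv sigma_sets_empty_eq)
  have const: "(\<lambda>\<omega>. indicator {0..T} s *\<^sub>R adjoint_op (D s) h) \<in> borel_measurable (?G s)" for s by simp
  have WC: "W s \<in> borel_measurable ?C" if "0 \<le> s" for s
    using W_measurable_generated[OF that] measurable_from_subalg[OF subalgebra_ae_completion_base[OF subalgebra_generated_sigma]] by blast
  have "\<exists>J. J \<in> borel_measurable ?C \<and> (\<integral>\<^sup>+ \<omega>. ennreal ((J \<omega> - I \<omega> \<bullet> h)\<^sup>2) \<partial>M) \<le> ennreal ((1/2) ^ k)" for k :: nat
  proof -
    have "0 < (1/2 :: real) ^ k" by simp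
    from stochastic_integral_approximation[OF int T this, of ?G h, OF G_sub const]
    obtain n :: nat and \<tau> y where \<tau>: "\<And>j. j < n \<Longrightarrow> \<tau> j \<le> \<tau> (Suc j)" "\<And>j. j < n \<Longrightarrow> \<tau> j \<in> {0..T}"
      and y: "\<And>j. j < n \<Longrightarrow> simple_function (?G (\<tau> j)) (y j)"
      and err: "(\<integral>\<^sup>+ \<omega>. ennreal ((step_integral n \<tau> y \<omega> - I \<omega> \<bullet> h)\<^sup>2) \<partial>M) \<le> ennreal ((1/2) ^ k)"
      by (auto simp: space_F)
    have "(\<lambda>\<omega>. \<Sum>j<n. y j \<omega> \<bullet> (W (\<tau> (Suc j)) \<omega> - W (\<tau> j) \<omega>)) \<in> borel_measurable ?C"
    proof (intro borel_measurable_sum borel_measurable_inner borel_measurable_diff WC)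
      fix j assume j: "j \<in> {..<n}"
      show "y j \<in> borel_measurable ?C"
        by (rule measurable_from_subalg[OF G_sub[OF space_ae_completion] borel_measurable_simple_function[OF y]]) (use j in simp)
      show "0 \<le> \<tau> j" "0 \<le> \<tau> (Suc j)" using \<tau>[of j] j by auto
    qed
    then show ?thesis using err by blast
  qed
  then have "\<forall>k. \<exists>J. J \<in> borel_measurable ?C \<and> (\<integral>\<^sup>+ \<omega>. ennreal ((J \<omega> - I \<omega> \<bullet> h)\<^sup>2) \<partial>M) \<le> ennreal ((1/2) ^ k)" by blast
  from choice[OF this] obtain J where J: "\<And>k. J k \<in> borel_measurable ?C"
    and err: "\<And>k. (\<integral>\<^sup>+ \<omega>. ennreal ((J k \<omega> - I \<omega> \<bullet> h)\<^sup>2) \<partial>M) \<le> ennreal ((1/2) ^ k)" by blast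
  have [measurable]: "J k \<in> borel_measurable M" for k
    using J measurable_from_subalg[OF subalgebra_ae_completion[OF subalgebra_generated_sigma]] by blast
  have "AE \<omega> in M. (\<lambda>k. J k \<omega>) \<longlonglongrightarrow> I \<omega> \<bullet> h"
    by (rule AE_LIMSEQ_of_summable_square_errors[OF _ _ err]) measurable
  then have eq: "AE \<omega> in M. I \<omega> \<bullet> h = lim (\<lambda>k. J k \<omega>)" by eventually_elim (simp add: limI)
  show "(\<lambda>\<omega>. I \<omega> \<bullet> h) \<in> borel_measurable ?C"
    by (rule measurable_ae_completion_AE_eq[OF subalgebra_generated_sigma
          borel_measurable_inner[OF I borel_measurable_const] borel_measurable_lim_metric[OF J] eq])
qed

section \<open>Conditionally Gaussian integrals\<close>

lemma norm_iexp_diff_le: "norm (iexp a - iexp b) \<le> \<bar>a - b\<bar>"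
proof -
  have "iexp a - iexp b = iexp b * (iexp (a - b) - 1)"
    by (simp add: algebra_simps flip: exp_add)
  then have "norm (iexp a - iexp b) = norm (iexp (a - b) - 1)" by (simp add: norm_mult)
  also have "\<dots> \<le> \<bar>a - b\<bar>" using iexp_approx1[of "a - b" 0] by simp
  finally show ?thesis .
qed

lemma exp_minus_half_lipschitz:
  assumes "0 \<le> a" "0 \<le> b"
  shows "\<bar>exp (- a / 2) - exp (- b / 2)\<bar> \<le> \<bar>a - b\<bar> / (2 :: real)"
proof -
  have *: "exp (- a / 2) - exp (- b / 2) \<le> (b - a) / 2" if "0 \<le> a" "a \<le> b" for a b :: real
  proof -
    have "exp (- a / 2) - exp (- b / 2) = exp (- a / 2) * (1 - exp (- ((b - a) / 2)))"
      by (simp add: algebra_simps diff_divide_distrib flip: exp_add)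
    also have "\<dots> \<le> 1 * ((b - a) / 2)"
    proof (rule mult_mono)
      show "1 - exp (- ((b - a) / 2)) \<le> (b - a) / 2" using exp_ge_add_one_self[of "- ((b - a) / 2)"] by argo
    qed (use that in auto)
    finally show ?thesis by simp
  qed
  show ?thesis
  proof (cases "a \<le> b")
    case True
    then show ?thesis using *[of a b] assms by simp
  next
    case False
    then show ?thesis using *[of b a] assms by simp
  qed
qed

text \<open>Young's inequality with weight \<eta>: the norm of \<open>q\<close> is fixed in the
  limit and carries the small factor, the vanishing distance carries the large one.\<close>

lemma norm_square_diff_le:
  fixes p q :: "'b::real_normed_vector"
  assumes \<eta>: "0 < \<eta>"
  shows "\<bar>(norm p)\<^sup>2 - (norm q)\<^sup>2\<bar> \<le> (1 + 1 / \<eta>) * (norm (p - q))\<^sup>2 + \<eta> * (norm q)\<^sup>2"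
proof -
  let ?d = "norm (p - q)"
  have d: "\<bar>norm p - norm q\<bar> \<le> ?d" by (rule norm_triangle_ineq3)
  have young: "2 * ?d * norm q \<le> ?d\<^sup>2 / \<eta> + \<eta> * (norm q)\<^sup>2"
  proof -
    have "0 \<le> (?d - \<eta> * norm q)\<^sup>2 / \<eta>" using \<eta> by simp
    also have "\<dots> = ?d\<^sup>2 / \<eta> + \<eta> * (norm q)\<^sup>2 - 2 * ?d * norm q"
      using \<eta> by (simp add: power2_diff power2_eq_square field_simps)
    finally show ?thesis by simp
  qed
  have "(norm p)\<^sup>2 - (norm q)\<^sup>2 = (norm p - norm q)\<^sup>2 + 2 * (norm p - norm q) * norm q"
    by (simp add: power2_eq_square algebra_simps)
  then have "\<bar>(norm p)\<^sup>2 - (norm q)\<^sup>2\<bar> \<le> \<bar>norm p - norm q\<bar>\<^sup>2 + 2 * \<bar>norm p - norm q\<bar> * norm q"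
    using abs_triangle_ineq[of "(norm p - norm q)\<^sup>2" "2 * (norm p - norm q) * norm q"] unfolding abs_mult by simp
  also have "\<dots> \<le> ?d\<^sup>2 + 2 * ?d * norm q"
    using d by (intro add_mono power_mono mult_right_mono mult_left_mono) auto
  also have "\<dots> \<le> (1 + 1 / \<eta>) * ?d\<^sup>2 + \<eta> * (norm q)\<^sup>2"
    using young by (simp add: algebra_simps)
  finally show ?thesis .
qed

context wiener
begin

lemma norm_integral_diff_le:
  fixes g g' :: "'a \<Rightarrow> 'b::{banach, second_countable_topology}"
  assumes "integrable M g" "integrable M g'"
  shows "ennreal (norm ((\<integral>\<omega>. g \<omega> \<partial>M) - (\<integral>\<omega>. g' \<omega> \<partial>M))) \<le> (\<integral>\<^sup>+ \<omega>. ennreal (norm (g \<omega> - g' \<omega>)) \<partial>M)"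
  using integral_norm_bound_ennreal[OF Bochner_Integration.integrable_diff[OF assms]] assms by simp

text \<open>\<open>G s\<close> lies in \<open>F s\<close>, so the sampled integrands obey the
  isometry, and in \<open>N\<close>, so their integrals are Gaussian given \<open>N\<close>. The
  formula passes to the limit because the left side is Lipschitz in the integral and the right side
  in the nonnegative accumulated variance.\<close>

lemma char_stochastic_integral:
  fixes \<Phi> :: "real \<Rightarrow> 'a \<Rightarrow> 'h \<Rightarrow>\<^sub>L 'h" and f :: 'h
  assumes int: "has_stochastic_integral M F Q W T \<Phi> I" and T: "0 \<le> T"
  defines "\<psi> \<equiv> \<lambda>s \<omega>. indicator {0..T} s *\<^sub>R adjoint_op (\<Phi> s \<omega>) f"
  assumes G: "\<And>s. s \<in> {0..T} \<Longrightarrow> subalgebra (F s) (G s)" "\<And>s. s \<in> {0..T} \<Longrightarrow> \<psi> s \<in> borel_measurable (G s)"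
    and N: "subalgebra M N" "\<And>s. s \<in> {0..T} \<Longrightarrow> sets (G s) \<subseteq> sets N"
    and indep: "\<And>A C. A \<in> sets N \<Longrightarrow> C \<in> sets (generated_sigma M W {0..}) \<Longrightarrow> prob (A \<inter> C) = prob A * prob C"
    and fin: "energy \<psi> < \<infinity>"
  shows "(\<integral>\<omega>. iexp (I \<omega> \<bullet> f) \<partial>M) =
    complex_of_real (\<integral>\<omega>. exp (- (\<integral>s. (norm (sqrt_op Q (\<psi> s \<omega>)))\<^sup>2 \<partial>lborel) / 2) \<partial>M)"
proof -
  have I[measurable]: "I \<in> borel_measurable M" and pred: "\<And>h. predictable_process M F (\<lambda>s \<omega>. indicator {0..T} s *\<^sub>R \<Phi> s \<omega> h)"
    using int unfolding has_stochastic_integral_def by blast+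
  have \<psi>: "jointly_measurable \<psi>" unfolding \<psi>_def by (rule jointly_measurable_adjoint[OF pred])
  let ?R = "sqrt_op Q"
  define V where "V \<omega> = (\<integral>s. (norm (?R (\<psi> s \<omega>)))\<^sup>2 \<partial>lborel)" for \<omega>
  have swap_measurable: "(\<lambda>p. ennreal ((norm (?R (\<chi>' (snd p) (fst p))))\<^sup>2)) \<in> borel_measurable (M \<Otimes>\<^sub>M lborel)"
    "(\<lambda>p. (norm (?R (\<chi>' (snd p) (fst p))))\<^sup>2) \<in> borel_measurable (M \<Otimes>\<^sub>M lborel)"
    if "jointly_measurable \<chi>'" for \<chi>'
  proof -
    have "(\<lambda>p. \<chi>' (snd p) (fst p)) \<in> borel_measurable (M \<Otimes>\<^sub>M lborel)"
      using measurable_compose[OF measurable_pair_swap' that] by (simp add: case_prod_beta')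
    note [measurable] = borel_measurable_blinfun_apply[OF this, of ?R]
    show "(\<lambda>p. ennreal ((norm (?R (\<chi>' (snd p) (fst p))))\<^sup>2)) \<in> borel_measurable (M \<Otimes>\<^sub>M lborel)"
      "(\<lambda>p. (norm (?R (\<chi>' (snd p) (fst p))))\<^sup>2) \<in> borel_measurable (M \<Otimes>\<^sub>M lborel)"
      by measurable
  qed
  have V[measurable]: "V \<in> borel_measurable M"
    unfolding V_def by (rule lborel.borel_measurable_lebesgue_integral) (use swap_measurable(2)[OF \<psi>] in \<open>simp add: case_prod_beta'\<close>)
  have V0: "0 \<le> V \<omega>" for \<omega> unfolding V_def by (intro Bochner_Integration.integral_nonneg) simp
  have slice: "(\<lambda>s. (norm (?R (\<chi>' s \<omega>)))\<^sup>2) \<in> borel_measurable lborel" if "jointly_measurable \<chi>'" "\<omega> \<in> space M" for \<chi>' \<omega>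
  proof -
    have "(\<lambda>s. ?R (\<chi>' s \<omega>)) \<in> borel_measurable lborel"
      by (intro borel_measurable_blinfun_apply) (use measurable_compose[OF measurable_Pair2'[OF that(2)] that(1)] in simp)
    then show ?thesis by measurable
  qed
  \<comment> \<open>Almost every path has finite accumulated variance; this excludes the default
    value of the Lebesgue integral in \<open>V\<close> before \<open>V\<close> is compared with
    \<open>VP\<close>.\<close>
  have "AE \<omega> in M. (\<integral>\<^sup>+ s. ennreal ((norm (?R (\<psi> s \<omega>)))\<^sup>2) \<partial>lborel) \<noteq> \<infinity>"
  proof (rule nn_integral_noteq_infinite)
    show "(\<lambda>\<omega>. \<integral>\<^sup>+ s. ennreal ((norm (?R (\<psi> s \<omega>)))\<^sup>2) \<partial>lborel) \<in> borel_measurable M"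
      by (rule lborel.borel_measurable_nn_integral) (use swap_measurable(1)[OF \<psi>] in \<open>simp add: case_prod_beta'\<close>)
    show "(\<integral>\<^sup>+ \<omega>. (\<integral>\<^sup>+ s. ennreal ((norm (?R (\<psi> s \<omega>)))\<^sup>2) \<partial>lborel) \<partial>M) \<noteq> \<infinity>"
      using fin by (simp add: energy_swap[OF \<psi>])
  qed
  then have int_\<psi>: "AE \<omega> in M. integrable lborel (\<lambda>s. (norm (?R (\<psi> s \<omega>)))\<^sup>2)"
    using AE_space
  proof eventually_elim
    case (elim \<omega>)
    then show ?case using slice[OF \<psi>, of \<omega>] by (intro integrableI_bounded) (auto simp: top.not_eq_extremum)
  qed
  define K where "K = enn2real (energy \<psi>)"
  have K: "energy \<psi> = ennreal K" "0 \<le> K" using fin by (auto simp: K_def)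
  define L where "L = (\<integral>\<omega>. iexp (I \<omega> \<bullet> f) \<partial>M)"
  define R' where "R' = (\<integral>\<omega>. exp (- V \<omega> / 2) \<partial>M)"
  \<comment> \<open>With mean square errors at most \<open>\<eta>\<^sup>2\<close>, the exponential
    of the integral contributes \<eta> and the variance
    \<open>\<eta>\<^sup>2 + \<eta> + \<eta> * K\<close>, where \<open>K\<close> is the energy of
    \<open>\<psi>\<close>.\<close>
  have bound: "norm (L - complex_of_real R') \<le> \<eta> * (2 + K) + \<eta>\<^sup>2" if \<eta>: "0 < \<eta>" for \<eta>
  proof -
    have "0 < \<eta>\<^sup>2" using \<eta> by simp
    have "\<exists>(N :: nat) \<tau> y. 0 \<le> \<tau> 0 \<and> (\<forall>j<N. \<tau> j \<le> \<tau> (Suc j) \<and> \<tau> j \<in> {0..T} \<and> simple_function (G (\<tau> j)) (y j)) \<and>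
      energy (\<lambda>s \<omega>. step N \<tau> y s \<omega> - \<psi> s \<omega>) \<le> ennreal (\<eta>\<^sup>2) \<and>
      (\<integral>\<^sup>+ \<omega>. ennreal ((step_integral N \<tau> y \<omega> - I \<omega> \<bullet> f)\<^sup>2) \<partial>M) \<le> ennreal (\<eta>\<^sup>2)"
      unfolding \<psi>_def by (rule stochastic_integral_approximation[OF int T \<open>0 < \<eta>\<^sup>2\<close> G[unfolded \<psi>_def]])
    then obtain n :: nat and \<tau> y where \<tau>0: "0 \<le> \<tau> 0"
      and \<tau>: "\<And>j. j < n \<Longrightarrow> \<tau> j \<le> \<tau> (Suc j)" "\<And>j. j < n \<Longrightarrow> \<tau> j \<in> {0..T}"
      and y: "\<And>j. j < n \<Longrightarrow> simple_function (G (\<tau> j)) (y j)"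
      and close: "energy (\<lambda>s \<omega>. step n \<tau> y s \<omega> - \<psi> s \<omega>) \<le> ennreal (\<eta>\<^sup>2)"
      and err: "(\<integral>\<^sup>+ \<omega>. ennreal ((step_integral n \<tau> y \<omega> - I \<omega> \<bullet> f)\<^sup>2) \<partial>M) \<le> ennreal (\<eta>\<^sup>2)"
      by blast
    define P where "P s \<omega> = step n \<tau> y s \<omega>" for s \<omega>
    define J where "J \<omega> = step_integral n \<tau> y \<omega>" for \<omega>
    define VP where "VP \<omega> = (\<Sum>j<n. (\<tau> (Suc j) - \<tau> j) * (Q (y j \<omega>) \<bullet> y j \<omega>))" for \<omega>
    have yN: "simple_function N (y j)" if "j < n" for j
    proof -
      have "space (G (\<tau> j)) = space N"
        using G(1)[OF \<tau>(2)[OF that]] N(1) space_F[of "\<tau> j"] \<tau>(2)[OF that] by (simp add: subalgebra_def)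
      then show ?thesis
        using y[OF that] N(2)[OF \<tau>(2)[OF that]] unfolding simple_function_def by auto
    qed
    have y_meas: "y j \<in> borel_measurable M" if "j < n" for j
      using measurable_from_subalg[OF N(1) borel_measurable_simple_function[OF yN[OF that]]] .
    have P: "jointly_measurable P" unfolding P_def[abs_def] by (rule jointly_measurable_elementary) (simp add: y_meas)
    have d: "jointly_measurable (\<lambda>s \<omega>. P s \<omega> - \<psi> s \<omega>)" using P \<psi> by measurable
    have \<tau>_Suc: "0 \<le> \<tau> (Suc j)" if "j < n" for j using \<tau>[OF that] by auto
    have J[measurable]: "J \<in> borel_measurable M"
      unfolding J_def[abs_def] using \<tau>(2) \<tau>_Suc
      by (intro borel_measurable_sum borel_measurable_inner borel_measurable_diff W_measurable y_meas) auto
    have VP[measurable]: "VP \<in> borel_measurable M"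
      unfolding VP_def[abs_def]
      by (intro borel_measurable_sum borel_measurable_times borel_measurable_inner borel_measurable_const
          borel_measurable_blinfun_apply y_meas) auto
    have VP0: "0 \<le> VP \<omega>" for \<omega>
      unfolding VP_def using \<tau>(1) Q_nonneg by (intro sum_nonneg mult_nonneg_nonneg) auto
    have VP_int: "has_bochner_integral lborel (\<lambda>s. (norm (?R (P s \<omega>)))\<^sup>2) (VP \<omega>)" for \<omega>
    proof -
      have "(norm (?R (P s \<omega>)))\<^sup>2 = (\<Sum>j<n. indicator {\<tau> j<..\<tau> (Suc j)} s *\<^sub>R (norm (?R (y j \<omega>)))\<^sup>2)" for s
        unfolding P_def by (rule step_sum_map[where h="\<lambda>v. (norm (?R v))\<^sup>2"]) (auto simp: \<tau> blinfun.zero_right)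
      moreover have "(norm (?R (y j \<omega>)))\<^sup>2 = Q (y j \<omega>) \<bullet> y j \<omega>" for j
        by (simp add: power2_norm_eq_inner sqrt_op_inner[OF covariance])
      moreover have "has_bochner_integral lborel (\<lambda>s. indicator {\<tau> j<..\<tau> (Suc j)} s *\<^sub>R c) ((\<tau> (Suc j) - \<tau> j) * c)"
        if "j < n" for j and c :: real
        using has_bochner_integral_scaleR_left[OF has_bochner_integral_real_indicator[of "{\<tau> j<..\<tau> (Suc j)}" lborel], of c] \<tau>(1)[OF that]
        by simp
      ultimately show ?thesis unfolding VP_def by (simp only:) (intro has_bochner_integral_sum, simp)
    qed
    have "ennreal (norm (L - (\<integral>\<omega>. iexp (J \<omega>) \<partial>M))) \<le> (\<integral>\<^sup>+ \<omega>. ennreal (norm (iexp (I \<omega> \<bullet> f) - iexp (J \<omega>))) \<partial>M)"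
      unfolding L_def by (intro norm_integral_diff_le integrable_iexp) auto
    also have "\<dots> \<le> (\<integral>\<^sup>+ \<omega>. ennreal (\<eta> / 2) + ennreal (1 / (2 * \<eta>)) * ennreal ((J \<omega> - I \<omega> \<bullet> f)\<^sup>2) \<partial>M)"
    proof (rule nn_integral_mono)
      fix \<omega>
      let ?d = "J \<omega> - I \<omega> \<bullet> f"
      \<comment> \<open>The arithmetic-geometric mean inequality turns a mean square error of at
        most \<open>\<eta>\<^sup>2\<close> into a mean error of at most \<eta>.\<close>
      have "0 \<le> (\<bar>?d\<bar> - \<eta>)\<^sup>2 / (2 * \<eta>)" using \<eta> by simp
      also have "\<dots> = ?d\<^sup>2 / (2 * \<eta>) + \<eta> / 2 - \<bar>?d\<bar>" using \<eta> by (simp add: power2_diff power2_eq_square field_simps)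
      finally have "norm (iexp (I \<omega> \<bullet> f) - iexp (J \<omega>)) \<le> \<eta> / 2 + 1 / (2 * \<eta>) * ?d\<^sup>2"
        using norm_iexp_diff_le[of "I \<omega> \<bullet> f" "J \<omega>"] by (simp add: abs_minus_commute)
      then have "ennreal (norm (iexp (I \<omega> \<bullet> f) - iexp (J \<omega>))) \<le> ennreal (\<eta> / 2 + 1 / (2 * \<eta>) * ?d\<^sup>2)" by (rule ennreal_leI)
      also have "\<dots> = ennreal (\<eta> / 2) + ennreal (1 / (2 * \<eta>)) * ennreal (?d\<^sup>2)"
        using \<eta> by (subst ennreal_plus) (auto simp: ennreal_mult[symmetric])
      finally show "ennreal (norm (iexp (I \<omega> \<bullet> f) - iexp (J \<omega>))) \<le> ennreal (\<eta> / 2) + ennreal (1 / (2 * \<eta>)) * ennreal (?d\<^sup>2)" .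
    qed
    also have "\<dots> = ennreal (\<eta> / 2) + ennreal (1 / (2 * \<eta>)) * (\<integral>\<^sup>+ \<omega>. ennreal ((J \<omega> - I \<omega> \<bullet> f)\<^sup>2) \<partial>M)"
      by (simp add: nn_integral_add nn_integral_cmult emeasure_space_1)
    also have "\<dots> \<le> ennreal (\<eta> / 2) + ennreal (1 / (2 * \<eta>)) * ennreal (\<eta>\<^sup>2)"
      using err by (intro add_left_mono mult_left_mono) (auto simp: J_def)
    also have "\<dots> = ennreal (\<eta> / 2 + 1 / (2 * \<eta>) * \<eta>\<^sup>2)"
      using \<eta> by (subst ennreal_plus) (auto simp: ennreal_mult[symmetric])
    also have "\<eta> / 2 + 1 / (2 * \<eta>) * \<eta>\<^sup>2 = \<eta>" using \<eta> by (simp add: power2_eq_square field_simps)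
    finally have 1: "norm (L - (\<integral>\<omega>. iexp (J \<omega>) \<partial>M)) \<le> \<eta>" using \<eta> by (simp add: ennreal_le_iff)
    have 2: "(\<integral>\<omega>. iexp (J \<omega>) \<partial>M) = complex_of_real (\<integral>\<omega>. exp (- VP \<omega> / 2) \<partial>M)"
      unfolding J_def VP_def by (rule char_simple_integral[OF N(1) indep \<tau>0 \<tau>(1) yN])
    have "ennreal (norm ((\<integral>\<omega>. exp (- VP \<omega> / 2) \<partial>M) - R')) \<le> (\<integral>\<^sup>+ \<omega>. ennreal (norm (exp (- VP \<omega> / 2) - exp (- V \<omega> / 2))) \<partial>M)"
      unfolding R'_def using VP0 V0
      by (intro norm_integral_diff_le integrable_const_bound[where B=1]) auto
    also have "\<dots> \<le> (\<integral>\<^sup>+ \<omega>. (\<integral>\<^sup>+ s. ennreal (1 + 1 / \<eta>) * ennreal ((norm (?R (P s \<omega> - \<psi> s \<omega>)))\<^sup>2) +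
        ennreal \<eta> * ennreal ((norm (?R (\<psi> s \<omega>)))\<^sup>2) \<partial>lborel) \<partial>M)"
    proof (rule nn_integral_mono_AE)
      show "AE \<omega> in M. ennreal (norm (exp (- VP \<omega> / 2) - exp (- V \<omega> / 2))) \<le>
        (\<integral>\<^sup>+ s. ennreal (1 + 1 / \<eta>) * ennreal ((norm (?R (P s \<omega> - \<psi> s \<omega>)))\<^sup>2) +
        ennreal \<eta> * ennreal ((norm (?R (\<psi> s \<omega>)))\<^sup>2) \<partial>lborel)"
        using int_\<psi>
      proof eventually_elim
        case (elim \<omega>)
        have intP: "integrable lborel (\<lambda>s. (norm (?R (P s \<omega>)))\<^sup>2)" "VP \<omega> = (\<integral>s. (norm (?R (P s \<omega>)))\<^sup>2 \<partial>lborel)"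
          using VP_int[of \<omega>] by (auto simp: has_bochner_integral_iff)
        have "norm (exp (- VP \<omega> / 2) - exp (- V \<omega> / 2)) \<le> \<bar>VP \<omega> - V \<omega>\<bar> / 2"
          using exp_minus_half_lipschitz[OF VP0 V0] by simp
        also have "\<dots> \<le> norm (VP \<omega> - V \<omega>)" by simp
        finally have "ennreal (norm (exp (- VP \<omega> / 2) - exp (- V \<omega> / 2))) \<le> ennreal (norm (VP \<omega> - V \<omega>))" by (rule ennreal_leI)
        also have "VP \<omega> - V \<omega> = (\<integral>s. (norm (?R (P s \<omega>)))\<^sup>2 - (norm (?R (\<psi> s \<omega>)))\<^sup>2 \<partial>lborel)"
          using intP elim by (simp add: V_def)
        also have "ennreal (norm \<dots>) \<le> (\<integral>\<^sup>+ s. ennreal (norm ((norm (?R (P s \<omega>)))\<^sup>2 - (norm (?R (\<psi> s \<omega>)))\<^sup>2)) \<partial>lborel)"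
          using intP elim by (intro integral_norm_bound_ennreal) auto
        also have "\<dots> \<le> (\<integral>\<^sup>+ s. ennreal (1 + 1 / \<eta>) * ennreal ((norm (?R (P s \<omega> - \<psi> s \<omega>)))\<^sup>2) +
          ennreal \<eta> * ennreal ((norm (?R (\<psi> s \<omega>)))\<^sup>2) \<partial>lborel)"
        proof (rule nn_integral_mono)
          fix s
          have "ennreal (norm ((norm (?R (P s \<omega>)))\<^sup>2 - (norm (?R (\<psi> s \<omega>)))\<^sup>2)) \<le>
             ennreal ((1 + 1 / \<eta>) * (norm (?R (P s \<omega> - \<psi> s \<omega>)))\<^sup>2 + \<eta> * (norm (?R (\<psi> s \<omega>)))\<^sup>2)"
            using norm_square_diff_le[OF \<eta>, of "?R (P s \<omega>)" "?R (\<psi> s \<omega>)"] by (intro ennreal_leI) (simp add: blinfun.diff_right)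
          then show "ennreal (norm ((norm (?R (P s \<omega>)))\<^sup>2 - (norm (?R (\<psi> s \<omega>)))\<^sup>2)) \<le>
             ennreal (1 + 1 / \<eta>) * ennreal ((norm (?R (P s \<omega> - \<psi> s \<omega>)))\<^sup>2) + ennreal \<eta> * ennreal ((norm (?R (\<psi> s \<omega>)))\<^sup>2)"
            using \<eta> by (subst (asm) ennreal_plus) (auto simp: ennreal_mult)
        qed
        finally show ?case .
      qed
    qed
    also have "\<dots> = (\<integral>\<^sup>+ \<omega>. ennreal (1 + 1 / \<eta>) * (\<integral>\<^sup>+ s. ennreal ((norm (?R (P s \<omega> - \<psi> s \<omega>)))\<^sup>2) \<partial>lborel) +
        ennreal \<eta> * (\<integral>\<^sup>+ s. ennreal ((norm (?R (\<psi> s \<omega>)))\<^sup>2) \<partial>lborel) \<partial>M)"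
    proof (rule nn_integral_cong)
      fix \<omega> assume "\<omega> \<in> space M"
      note [measurable] = slice[OF d this] slice[OF \<psi> this]
      show "(\<integral>\<^sup>+ s. ennreal (1 + 1 / \<eta>) * ennreal ((norm (?R (P s \<omega> - \<psi> s \<omega>)))\<^sup>2) +
        ennreal \<eta> * ennreal ((norm (?R (\<psi> s \<omega>)))\<^sup>2) \<partial>lborel) =
        ennreal (1 + 1 / \<eta>) * (\<integral>\<^sup>+ s. ennreal ((norm (?R (P s \<omega> - \<psi> s \<omega>)))\<^sup>2) \<partial>lborel) +
        ennreal \<eta> * (\<integral>\<^sup>+ s. ennreal ((norm (?R (\<psi> s \<omega>)))\<^sup>2) \<partial>lborel)"
        by (subst nn_integral_add, measurable, subst (1 2) nn_integral_cmult, measurable)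
    qed
    also have "\<dots> = ennreal (1 + 1 / \<eta>) * energy (\<lambda>s \<omega>. P s \<omega> - \<psi> s \<omega>) + ennreal \<eta> * energy \<psi>"
    proof -
      have [measurable]: "(\<lambda>\<omega>. \<integral>\<^sup>+ s. ennreal ((norm (?R (P s \<omega> - \<psi> s \<omega>)))\<^sup>2) \<partial>lborel) \<in> borel_measurable M"
        "(\<lambda>\<omega>. \<integral>\<^sup>+ s. ennreal ((norm (?R (\<psi> s \<omega>)))\<^sup>2) \<partial>lborel) \<in> borel_measurable M"
        by (rule lborel.borel_measurable_nn_integral, use swap_measurable(1)[OF d] swap_measurable(1)[OF \<psi>] in \<open>simp add: case_prod_beta'\<close>)+
      show ?thesis
        unfolding energy_swap[OF d, symmetric] energy_swap[OF \<psi>, symmetric]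
        by (subst nn_integral_add, measurable, subst (1 2) nn_integral_cmult, measurable)
    qed
    also have "\<dots> \<le> ennreal (1 + 1 / \<eta>) * ennreal (\<eta>\<^sup>2) + ennreal \<eta> * ennreal K"
      using close K by (intro add_mono mult_left_mono) (auto simp: P_def)
    also have "\<dots> = ennreal ((1 + 1 / \<eta>) * \<eta>\<^sup>2) + ennreal (\<eta> * K)"
      using \<eta> K by (intro arg_cong2[where f="(+)"] ennreal_mult[symmetric]) auto
    also have "\<dots> = ennreal ((1 + 1 / \<eta>) * \<eta>\<^sup>2 + \<eta> * K)"
      using \<eta> K by (intro ennreal_plus[symmetric]) auto
    finally have "norm ((\<integral>\<omega>. exp (- VP \<omega> / 2) \<partial>M) - R') \<le> (1 + 1 / \<eta>) * \<eta>\<^sup>2 + \<eta> * K"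
      using \<eta> K by (subst (asm) ennreal_le_iff) auto
    also have "\<dots> = \<eta>\<^sup>2 + \<eta> + \<eta> * K" using \<eta> by (simp add: power2_eq_square field_simps)
    finally have 3: "norm (complex_of_real (\<integral>\<omega>. exp (- VP \<omega> / 2) \<partial>M) - complex_of_real R') \<le> \<eta>\<^sup>2 + \<eta> + \<eta> * K"
      by (simp flip: of_real_diff)
    have "norm (L - complex_of_real R') \<le> norm (L - (\<integral>\<omega>. iexp (J \<omega>) \<partial>M)) + norm ((\<integral>\<omega>. iexp (J \<omega>) \<partial>M) - complex_of_real R')"
      using norm_triangle_ineq[of "L - (\<integral>\<omega>. iexp (J \<omega>) \<partial>M)" "(\<integral>\<omega>. iexp (J \<omega>) \<partial>M) - complex_of_real R'"] by simp
    also have "\<dots> \<le> \<eta> + (\<eta>\<^sup>2 + \<eta> + \<eta> * K)" using 1 3 unfolding 2 by (rule add_mono)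
    finally show ?thesis by (simp add: algebra_simps)
  qed
  have "((\<lambda>\<eta>. \<eta> * (2 + K) + \<eta>\<^sup>2) \<longlongrightarrow> 0 * (2 + K) + 0\<^sup>2) (at_right 0)"
    by (intro tendsto_intros)
  then have "norm (L - complex_of_real R') \<le> 0 * (2 + K) + 0\<^sup>2"
    by (rule tendsto_lowerbound) (auto simp: eventually_at_right_field intro!: exI[of _ 1] bound)
  then show ?thesis by (simp add: L_def R'_def V_def)
qed

end

text \<open>The finite energy is drawn from the existence of the stochastic integral: an elementary
  approximant is bounded, and some approximant is at finite distance from the integrand.\<close>

lemma (in wiener) tensor_integrand:
  fixes D :: "real \<Rightarrow> 'h \<Rightarrow>\<^sub>L 'h" and Y Z :: "real \<Rightarrow> 'a \<Rightarrow> 'h"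
  assumes int: "has_stochastic_integral M F Q W T (\<lambda>s \<omega>. D s o\<^sub>L tensor (Z s \<omega>) (Y s \<omega>)) I"
    and Z: "predictable_process M F Z" and T: "0 \<le> T"
  defines "z \<equiv> \<lambda>s \<omega>. indicator {0..T} s *\<^sub>R norm (sqrt_op Q (Z s \<omega>)) *\<^sub>R D s (Y s \<omega>)"
  shows "jointly_measurable z"
    and "(\<integral>\<^sup>+ \<omega>. (\<integral>\<^sup>+ s. ennreal ((norm (z s \<omega>))\<^sup>2) \<partial>lborel) \<partial>M) < \<infinity>"
proof -
  let ?R = "sqrt_op Q"
  from int have pred: "\<And>h. predictable_process M F (\<lambda>s \<omega>. indicator {0..T} s *\<^sub>R (D s o\<^sub>L tensor (Z s \<omega>) (Y s \<omega>)) h)"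
    unfolding has_stochastic_integral_def by blast
  define Zt where "Zt p = indicator {0..T} (fst p) *\<^sub>R Z (fst p) (snd p)" for p
  define \<Psi> where "\<Psi> p = indicator {0..T} (fst p) *\<^sub>R (indicator {0..T} (fst p) *\<^sub>R (D (fst p) o\<^sub>L tensor (Z (fst p) (snd p)) (Y (fst p) (snd p))))" for p
  have Zt: "Zt \<in> borel_measurable (lborel \<Otimes>\<^sub>M M)"
    using predictable_process_measurable[OF filtered Z, of T] unfolding Zt_def by (simp add: case_prod_beta')
  have "(\<lambda>p. \<Psi> p h) \<in> borel_measurable (lborel \<Otimes>\<^sub>M M)" for h
    using predictable_process_measurable[OF filtered pred[of h], of T]
    unfolding \<Psi>_def by (simp add: case_prod_beta' blinfun.scaleR_left)
  note U = borel_measurable_blinfun_family[OF this Zt]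
  \<comment> \<open>Applied to Z itself, the tensor gives the squared norm of Z times D Y; dividing
    that square out recovers D Y without asking how \<open>D\<close> depends on time. Where Z = 0
    both sides vanish.\<close>
  have "(\<lambda>p. (norm (?R (Zt p)) / (norm (Zt p))\<^sup>2) *\<^sub>R \<Psi> p (Zt p)) \<in> borel_measurable (lborel \<Otimes>\<^sub>M M)"
    using U Zt borel_measurable_blinfun_apply[OF Zt, of ?R] by measurable
  moreover have "(norm (?R (Zt p)) / (norm (Zt p))\<^sup>2) *\<^sub>R \<Psi> p (Zt p) = z (fst p) (snd p)" for p
  proof (cases "fst p \<in> {0..T}")
    case True
    then show ?thesis
      by (cases "Z (fst p) (snd p) = 0")
         (simp_all add: z_def Zt_def \<Psi>_def tensor.rep_eq blinfun.scaleR_right power2_norm_eq_inner)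
  next
    case False
    then show ?thesis by (simp add: z_def Zt_def \<Psi>_def)
  qed
  ultimately show z: "jointly_measurable z" by simp
  from int obtain n \<tau> A where el: "\<And>k. elementary_data F T (n k) (\<tau> k) (A k)"
    and lim: "(\<lambda>k. \<integral>\<^sup>+ \<omega>. (\<integral>\<^sup>+ s. hs_norm_sq ((elementary_integrand (n k) (\<tau> k) (A k) s \<omega> - (D s o\<^sub>L tensor (Z s \<omega>) (Y s \<omega>))) o\<^sub>L ?R) *
            indicator {0..T} s \<partial>lborel) \<partial>M) \<longlonglongrightarrow> 0"
    unfolding has_stochastic_integral_def by blast
  from order_tendstoD(2)[OF lim, of 1] obtain k where
    k: "(\<integral>\<^sup>+ \<omega>. (\<integral>\<^sup>+ s. hs_norm_sq ((elementary_integrand (n k) (\<tau> k) (A k) s \<omega> - (D s o\<^sub>L tensor (Z s \<omega>) (Y s \<omega>))) o\<^sub>L ?R) *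
            indicator {0..T} s \<partial>lborel) \<partial>M) < 1"
    by (auto simp: eventually_sequentially)
  define E where "E s \<omega> = elementary_integrand (n k) (\<tau> k) (A k) s \<omega>" for s \<omega>
  have mono: "\<tau> k i \<le> \<tau> k (Suc i)" if "i < n k" for i using el[of k] that by (simp add: elementary_data_def)
  have \<tau>0: "0 \<le> \<tau> k i" if "i < n k" for i
    using partition_mono[of "n k" "\<tau> k" 0 i] mono that el[of k] by (force simp: elementary_data_def)
  define c where "c i = Max (insert 0 (norm ` A k i ` space M))" for i
  have c: "norm (A k i \<omega>) \<le> c i" "0 \<le> c i" if "i < n k" "\<omega> \<in> space M" for i \<omega>
  proof -
    have "finite (A k i ` space M)"
      using el[of k] that space_F[OF \<tau>0[OF that(1)]] by (auto simp: elementary_data_def simple_function_def)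
    then show "norm (A k i \<omega>) \<le> c i" "0 \<le> c i" unfolding c_def using that by (auto intro!: Max_ge)
  qed
  have E: "norm (E s \<omega>) \<le> (\<Sum>i<n k. c i)" if "\<omega> \<in> space M" for s \<omega>
    unfolding E_def elementary_integrand_def
  proof (rule sum_norm_le)
    fix i assume "i \<in> {..<n k}"
    then show "norm (indicator {\<tau> k i<..\<tau> k (Suc i)} s *\<^sub>R A k i \<omega>) \<le> c i"
      using c[of i \<omega>] that by (auto simp: indicator_def)
  qed
  \<comment> \<open>Twice the Hilbert-Schmidt bound of the approximant, the factor being that of
    \<open>hs_norm_sq_tensor_le\<close>; it depends on neither time nor path.\<close>
  define B where "B = 2 * (ennreal ((\<Sum>i<n k. c i)\<^sup>2) * hs_norm_sq (id_blinfun o\<^sub>L ?R))"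
  have B: "B < \<infinity>"
    using hs_norm_sq_sqrt_op_finite[OF covariance, of id_blinfun] by (simp add: B_def ennreal_mult_less_top)
  \<comment> \<open>Subtracting the constant leaves a measurable left side, so that the
    Hilbert-Schmidt term may stay under the integral as a mere majorant.\<close>
  have pointwise: "ennreal ((norm (z s \<omega>))\<^sup>2) - B * indicator {0..T} s \<le>
      ennreal 2 * (hs_norm_sq ((E s \<omega> - (D s o\<^sub>L tensor (Z s \<omega>) (Y s \<omega>))) o\<^sub>L ?R) * indicator {0..T} s)"
    if \<omega>: "\<omega> \<in> space M" for s \<omega>
  proof (cases "s \<in> {0..T}")
    case True
    have "2 * hs_norm_sq (E s \<omega> o\<^sub>L ?R) \<le> B"
      unfolding B_def
      by (intro mult_left_mono order_trans[OF hs_norm_sq_compose_le] mult_right_mono ennreal_leI power_mono E \<omega>) auto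
    then have "ennreal ((norm (?R (Z s \<omega>)))\<^sup>2 * (norm (D s (Y s \<omega>)))\<^sup>2) \<le>
      2 * hs_norm_sq ((E s \<omega> - (D s o\<^sub>L tensor (Z s \<omega>) (Y s \<omega>))) o\<^sub>L ?R) + B"
      using hs_norm_sq_tensor_le[OF covariance, of "Z s \<omega>" "D s" "Y s \<omega>" "E s \<omega>"]
      by (meson add_left_mono order_trans)
    then show ?thesis
      using True B by (simp add: z_def power_mult_distrib ennreal_minus_le_iff add.commute)
  next
    case False
    then show ?thesis by (simp add: z_def)
  qed
  have z_swap: "(\<lambda>p. z (snd p) (fst p)) \<in> borel_measurable (M \<Otimes>\<^sub>M lborel)"
    using measurable_compose[OF measurable_pair_swap' z] by (simp add: case_prod_beta')
  have z_slice: "(\<lambda>s. z s \<omega>) \<in> borel_measurable lborel" if "\<omega> \<in> space M" for \<omega>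
    using measurable_compose[OF measurable_Pair2'[OF that] z] by simp
  have meas: "(\<lambda>\<omega>. \<integral>\<^sup>+ s. ennreal ((norm (z s \<omega>))\<^sup>2) - B * indicator {0..T} s \<partial>lborel) \<in> borel_measurable M"
  proof (rule lborel.borel_measurable_nn_integral)
    have "(\<lambda>p. ennreal ((norm (z (snd p) (fst p)))\<^sup>2) - B * indicator {0..T} (snd p)) \<in> borel_measurable (M \<Otimes>\<^sub>M lborel)"
      using z_swap by measurable
    then show "(\<lambda>(\<omega>, s). ennreal ((norm (z s \<omega>))\<^sup>2) - B * indicator {0..T} s) \<in> borel_measurable (M \<Otimes>\<^sub>M lborel)"
      by (simp add: case_prod_beta')
  qed
  have "(\<integral>\<^sup>+ \<omega>. (\<integral>\<^sup>+ s. ennreal ((norm (z s \<omega>))\<^sup>2) - B * indicator {0..T} s \<partial>lborel) \<partial>M) \<le>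
    ennreal 2 * (\<integral>\<^sup>+ \<omega>. (\<integral>\<^sup>+ s. hs_norm_sq ((E s \<omega> - (D s o\<^sub>L tensor (Z s \<omega>) (Y s \<omega>))) o\<^sub>L ?R) * indicator {0..T} s \<partial>lborel) \<partial>M)"
  proof (intro nn_integral_le_cmultI meas pointwise)
    fix \<omega> assume "\<omega> \<in> space M"
    note [measurable] = z_slice[OF this]
    show "(\<lambda>s. ennreal ((norm (z s \<omega>))\<^sup>2) - B * indicator {0..T} s) \<in> borel_measurable lborel" by measurable
  qed auto
  also have "\<dots> < \<infinity>"
    using order.strict_trans[OF k ennreal_one_less_top] unfolding E_def by (auto simp: ennreal_mult_less_top)
  finally have fin: "(\<integral>\<^sup>+ \<omega>. (\<integral>\<^sup>+ s. ennreal ((norm (z s \<omega>))\<^sup>2) - B * indicator {0..T} s \<partial>lborel) \<partial>M) < \<infinity>" .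
  have "(\<integral>\<^sup>+ \<omega>. (\<integral>\<^sup>+ s. ennreal ((norm (z s \<omega>))\<^sup>2) \<partial>lborel) \<partial>M) \<le>
    (\<integral>\<^sup>+ \<omega>. (\<integral>\<^sup>+ s. ennreal ((norm (z s \<omega>))\<^sup>2) - B * indicator {0..T} s \<partial>lborel) + B * ennreal T \<partial>M)"
  proof (rule nn_integral_mono)
    fix \<omega> assume "\<omega> \<in> space M"
    note [measurable] = z_slice[OF this]
    have "(\<integral>\<^sup>+ s. ennreal ((norm (z s \<omega>))\<^sup>2) \<partial>lborel) \<le>
      (\<integral>\<^sup>+ s. (ennreal ((norm (z s \<omega>))\<^sup>2) - B * indicator {0..T} s) + B * indicator {0..T} s \<partial>lborel)"
      by (intro nn_integral_mono ennreal_le_diff_add)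
    also have "\<dots> = (\<integral>\<^sup>+ s. ennreal ((norm (z s \<omega>))\<^sup>2) - B * indicator {0..T} s \<partial>lborel) + (\<integral>\<^sup>+ s. B * indicator {0..T} s \<partial>lborel)"
      by (rule nn_integral_add) measurable
    also have "(\<integral>\<^sup>+ s. B * indicator {0..T} s \<partial>lborel) = B * ennreal T"
      using T by (subst nn_integral_cmult_indicator) auto
    finally show "(\<integral>\<^sup>+ s. ennreal ((norm (z s \<omega>))\<^sup>2) \<partial>lborel) \<le>
      (\<integral>\<^sup>+ s. ennreal ((norm (z s \<omega>))\<^sup>2) - B * indicator {0..T} s \<partial>lborel) + B * ennreal T" .
  qed
  also have "\<dots> = (\<integral>\<^sup>+ \<omega>. (\<integral>\<^sup>+ s. ennreal ((norm (z s \<omega>))\<^sup>2) - B * indicator {0..T} s \<partial>lborel) \<partial>M) + B * ennreal T"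
    using meas by (simp add: nn_integral_add emeasure_space_1)
  also have "\<dots> < \<infinity>" using fin B by (simp add: ennreal_mult_less_top)
  finally show "(\<integral>\<^sup>+ \<omega>. (\<integral>\<^sup>+ s. ennreal ((norm (z s \<omega>))\<^sup>2) \<partial>lborel) \<partial>M) < \<infinity>" .
qed

section \<open>The natural filtration of Y and the characteristic function of X(t)\<close>

lemma subalgebra_natural_filtration:
  assumes L: "space L = space M" and Y: "\<And>u. u \<in> {0..s} \<Longrightarrow> Y u \<in> borel_measurable L"
  shows "subalgebra L (natural_filtration M Y s)"
proof -
  have "(\<Union>u\<in>{0..s}. {Y u -` A \<inter> space M | A. A \<in> sets borel}) \<subseteq> sets L"
    using measurable_sets[OF Y] by (auto simp: L)
  then have "sigma_sets (space L) (\<Union>u\<in>{0..s}. {Y u -` A \<inter> space M | A. A \<in> sets borel}) \<subseteq> sets L"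
    by (rule sets.sigma_sets_subset)
  then show ?thesis
    unfolding natural_filtration_def generated_sigma_def subalgebra_def
    by (auto simp: space_measure_of_conv sets_measure_of_conv L)
qed

lemma measurable_natural_filtration:
  fixes Y :: "real \<Rightarrow> 'a \<Rightarrow> 'b::topological_space"
  assumes "0 \<le> s"
  shows "Y s \<in> borel_measurable (natural_filtration M Y s)"
proof (rule measurableI)
  fix A :: "'b set" assume A: "A \<in> sets borel"
  then have "Y s -` A \<inter> space M \<in> (\<Union>u\<in>{0..s}. {Y u -` A \<inter> space M | A. A \<in> sets borel})"
    using assms by (intro UN_I[of s]) auto
  then have "Y s -` A \<inter> space M \<in> sets (natural_filtration M Y s)"
    unfolding natural_filtration_def generated_sigma_def by (intro in_measure_of) auto
  then show "Y s -` A \<inter> space (natural_filtration M Y s) \<in> sets (natural_filtration M Y s)"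
    by (simp add: natural_filtration_def generated_sigma_def space_measure_of_conv)
qed simp

text \<open>Almost sure integrability belongs to the conclusion, for otherwise the default value 0
  of \<open>strong_bochner_integral\<close> could enter the formula unnoticed.\<close>

theorem proposition9:
  fixes M :: "'a measure"
    and F :: "real \<Rightarrow> 'a measure"
    and QW QB \<eta> :: "'h::{real_inner, complete_space, second_countable_topology} \<Rightarrow>\<^sub>L 'h"
    and W B Y Z X :: "real \<Rightarrow> 'a \<Rightarrow> 'h"
    and DA DC :: "'h set"
    and A C :: "'h \<Rightarrow> 'h"
    and U S :: "real \<Rightarrow> 'h \<Rightarrow>\<^sub>L 'h"
    and Y0 X0 f :: 'h
    and t :: real
  assumes "filtered_prob_space M F"
    and "wiener_process M F QW W" and "positive_definite_op QW"
    and "wiener_process M F QB B" and "positive_definite_op QB"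
    and "independent_processes M W B"
    and "generates_C0_semigroup DA A U"
    and "predictable_process M F Y"
    and "mild_solution M F QW W U (\<lambda>s \<omega>. \<eta>) Y0 Y"
    and "predictable_process M F Z"
    and "adapted_process F Z"
    and "\<And>s. 0 \<le> s \<Longrightarrow> AE \<omega> in M. norm (Z s \<omega>) = 1"
    and "generates_C0_semigroup DC C S"
    and "mild_solution M F QB B S (heston_volatility Z Y) X0 X"
    and "adapted_process (natural_filtration M Y) Z"
    and "0 \<le> t"
  shows "(AE \<omega> in M. strong_bochner_integrable (restrict_space lborel {0..t})
            (\<lambda>s. (norm (sqrt_op QB (Z s \<omega>)))\<^sup>2 *\<^sub>R
              (S (t - s) o\<^sub>L heston_variance Y s \<omega> o\<^sub>L adjoint_op (S (t - s))))) \<and>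
    (\<integral>\<omega>. iexp (X t \<omega> \<bullet> f) \<partial>M) =
      iexp (S t X0 \<bullet> f) *
      complex_of_real (\<integral>\<omega>. exp (- (1 / 2) *
        (strong_bochner_integral (restrict_space lborel {0..t})
           (\<lambda>s. (norm (sqrt_op QB (Z s \<omega>)))\<^sup>2 *\<^sub>R
              (S (t - s) o\<^sub>L heston_variance Y s \<omega> o\<^sub>L adjoint_op (S (t - s)))) f \<bullet> f)) \<partial>M)"
proof -
  have M: "prob_space M" using assms(1) by (simp add: filtered_prob_space_def)
  interpret WW: wiener M F QW W
    unfolding wiener_def wiener_axioms_def using M assms(1,2) by blast
  interpret BB: wiener M F QB B
    unfolding wiener_def wiener_axioms_def using M assms(1,4) by blast
  let ?R = "sqrt_op QB"
  define \<Phi> where "\<Phi> s \<omega> = S (t - s) o\<^sub>L tensor (Z s \<omega>) (Y s \<omega>)" for s \<omega>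
  from assms(14,16) obtain I where int0: "has_stochastic_integral M F QB B t (\<lambda>s \<omega>. S (t - s) o\<^sub>L heston_volatility Z Y s \<omega>) I"
    and X_eq: "AE \<omega> in M. X t \<omega> = S t X0 + I \<omega>"
    unfolding mild_solution_def by blast
  from int0 have int: "has_stochastic_integral M F QB B t \<Phi> I"
    unfolding \<Phi>_def[abs_def] heston_volatility_def .
  have X_meas: "X t \<in> borel_measurable M"
    using assms(14,16) BB.measurable_F_M unfolding mild_solution_def adapted_process_def by blast
  have I_meas: "I \<in> borel_measurable M" using int by (simp add: has_stochastic_integral_def)

  \<comment> \<open>Each Y(s) is only almost surely equal to a deterministic part plus an integral
    against W, and that integral is itself an almost sure limit; hence the completion.\<close>
  define N where "N = ae_completion M (generated_sigma M W {0..})"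
  have N: "subalgebra M N"
    unfolding N_def by (rule subalgebra_ae_completion[OF WW.subalgebra_generated_sigma])
  have Y_F: "Y s \<in> borel_measurable (F s)" if "0 \<le> s" for s
    using assms(9) that unfolding mild_solution_def adapted_process_def by blast
  have Y_N: "Y s \<in> borel_measurable N" if s: "0 \<le> s" for s
  proof -
    from assms(9) s obtain J where J: "has_stochastic_integral M F QW W s (\<lambda>r \<omega>. U (s - r) o\<^sub>L \<eta>) J"
      and eq: "AE \<omega> in M. Y s \<omega> = U s Y0 + J \<omega>"
      unfolding mild_solution_def by blast
    have "(\<lambda>\<omega>. U s Y0 + J \<omega>) \<in> borel_measurable N"
      unfolding N_def
      by (intro borel_measurable_add borel_measurable_const WW.deterministic_integral_measurable[OF J s])
    then show ?thesis
      unfolding N_def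
      by (rule measurable_ae_completion_AE_eq[OF WW.subalgebra_generated_sigma WW.measurable_F_M[OF s Y_F[OF s]] _ eq])
  qed
  \<comment> \<open>The natural filtration of Y lies in \<open>F\<close>, as the isometry requires,
    and in \<open>N\<close>, which is independent of B; Z is adapted to it by assumption.\<close>
  define G where "G = natural_filtration M Y"
  have G_F: "subalgebra (F s) (G s)" if "s \<in> {0..t}" for s
    unfolding G_def
  proof (rule subalgebra_natural_filtration)
    show "space (F s) = space M" using that by (simp add: BB.space_F)
    fix u assume "u \<in> {0..s}"
    then show "Y u \<in> borel_measurable (F s)"
      using measurable_from_subalg[OF BB.subalgebra_F_F[of u s] Y_F[of u]] by simp
  qed
  have G_N: "sets (G s) \<subseteq> sets N" for s
  proof -
    have "subalgebra N (natural_filtration M Y s)"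
      using N Y_N by (intro subalgebra_natural_filtration) (auto simp: subalgebra_def)
    then show ?thesis by (simp add: G_def subalgebra_def)
  qed
  have indep: "measure M (A \<inter> C) = measure M A * measure M C"
    if "A \<in> sets N" "C \<in> sets (generated_sigma M B {0..})" for A C
  proof (rule prob_space.ae_completion_indep[OF M WW.subalgebra_generated_sigma])
    show "A \<in> sets (ae_completion M (generated_sigma M W {0..}))" using that(1) by (simp add: N_def)
    show "C \<in> sets M" using that(2) BB.subalgebra_generated_sigma by (auto simp: subalgebra_def)
    show "measure M (A \<inter> C) = measure M A * measure M C" if "A \<in> sets (generated_sigma M W {0..})" for A
      using assms(6) that \<open>C \<in> sets (generated_sigma M B {0..})\<close>
      unfolding independent_processes_def prob_space.indep_sets2_eq[OF M] by blast
  qed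

  define z where "z s \<omega> = indicator {0..t} s *\<^sub>R norm (?R (Z s \<omega>)) *\<^sub>R S (t - s) (Y s \<omega>)" for s \<omega>
  note z = BB.tensor_integrand[OF int[unfolded \<Phi>_def[abs_def]] assms(10,16), folded z_def]
  define \<psi> where "\<psi> s \<omega> = indicator {0..t} s *\<^sub>R adjoint_op (\<Phi> s \<omega>) f" for s \<omega>
  have \<psi>_eq: "\<psi> s \<omega> = indicator {0..t} s *\<^sub>R (S (t - s) (Y s \<omega>) \<bullet> f) *\<^sub>R Z s \<omega>" for s \<omega>
    by (simp add: \<psi>_def \<Phi>_def adjoint_op_compose_tensor)
  \<comment> \<open>The link between the two sides: the variance density of the Ito integrand is the
    quadratic form at \<open>f\<close> of the tensor square of \<open>z\<close>, and that tensor
    square is the Bochner integrand on [0, t].\<close>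
  have norm_\<psi>: "(norm (?R (\<psi> s \<omega>)))\<^sup>2 = (z s \<omega> \<bullet> f)\<^sup>2" for s \<omega>
    by (simp add: \<psi>_eq z_def blinfun.scaleR_right power_mult_distrib mult.commute)
  have \<psi>_G: "\<psi> s \<in> borel_measurable (G s)" if "s \<in> {0..t}" for s
  proof -
    have "Y s \<in> borel_measurable (G s)" unfolding G_def using that by (intro measurable_natural_filtration) simp
    moreover have "Z s \<in> borel_measurable (G s)"
      using assms(15) that unfolding adapted_process_def G_def by simp
    ultimately show ?thesis
      unfolding \<psi>_eq[abs_def]
      by (intro borel_measurable_scaleR borel_measurable_const borel_measurable_inner borel_measurable_blinfun_apply)
  qed
  have pred: "\<And>h. predictable_process M F (\<lambda>s \<omega>. indicator {0..t} s *\<^sub>R \<Phi> s \<omega> h)"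
    using int unfolding has_stochastic_integral_def by blast
  have "BB.energy \<psi> = (\<integral>\<^sup>+ \<omega>. (\<integral>\<^sup>+ s. ennreal ((norm (?R (\<psi> s \<omega>)))\<^sup>2) \<partial>lborel) \<partial>M)"
    unfolding \<psi>_def[abs_def] by (rule BB.energy_swap[OF BB.jointly_measurable_adjoint[OF pred], symmetric])
  also have "\<dots> \<le> (\<integral>\<^sup>+ \<omega>. ennreal ((norm f)\<^sup>2) * (\<integral>\<^sup>+ s. ennreal ((norm (z s \<omega>))\<^sup>2) \<partial>lborel) \<partial>M)"
  proof (rule nn_integral_mono)
    fix \<omega> assume "\<omega> \<in> space M"
    then have "(\<lambda>s. z s \<omega>) \<in> borel_measurable lborel"
      using measurable_compose[OF measurable_Pair2' z(1)] by simp
    then show "(\<integral>\<^sup>+ s. ennreal ((norm (?R (\<psi> s \<omega>)))\<^sup>2) \<partial>lborel) \<le> ennreal ((norm f)\<^sup>2) * (\<integral>\<^sup>+ s. ennreal ((norm (z s \<omega>))\<^sup>2) \<partial>lborel)"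
      unfolding norm_\<psi>
    proof (intro nn_integral_le_cmultI)
      fix s
      have "(z s \<omega> \<bullet> f)\<^sup>2 \<le> (norm (z s \<omega>) * norm f)\<^sup>2"
        using Cauchy_Schwarz_ineq2[of "z s \<omega>" f] by (metis abs_ge_zero power2_abs power_mono)
      then show "ennreal ((z s \<omega> \<bullet> f)\<^sup>2) \<le> ennreal ((norm f)\<^sup>2) * ennreal ((norm (z s \<omega>))\<^sup>2)"
        by (simp add: ennreal_mult[symmetric] power_mult_distrib mult.commute ennreal_leI)
    qed auto
  qed
  also have "\<dots> = ennreal ((norm f)\<^sup>2) * (\<integral>\<^sup>+ \<omega>. (\<integral>\<^sup>+ s. ennreal ((norm (z s \<omega>))\<^sup>2) \<partial>lborel) \<partial>M)"
  proof (rule nn_integral_cmult)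
    have "(\<lambda>p. z (snd p) (fst p)) \<in> borel_measurable (M \<Otimes>\<^sub>M lborel)"
      using measurable_compose[OF measurable_pair_swap' z(1)] by (simp add: case_prod_beta')
    then have "(\<lambda>p. ennreal ((norm (z (snd p) (fst p)))\<^sup>2)) \<in> borel_measurable (M \<Otimes>\<^sub>M lborel)" by measurable
    then show "(\<lambda>\<omega>. \<integral>\<^sup>+ s. ennreal ((norm (z s \<omega>))\<^sup>2) \<partial>lborel) \<in> borel_measurable M"
      by (intro lborel.borel_measurable_nn_integral) (simp add: case_prod_beta')
  qed
  also have "\<dots> < \<infinity>" using z(2) by (simp add: ennreal_mult_less_top)
  finally have fin: "BB.energy \<psi> < \<infinity>" .

  define V where "V \<omega> = (\<integral>s. (z s \<omega> \<bullet> f)\<^sup>2 \<partial>lborel)" for \<omega>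
  have "(\<integral>\<omega>. iexp (I \<omega> \<bullet> f) \<partial>M) =
      complex_of_real (\<integral>\<omega>. exp (- (\<integral>s. (norm (?R (\<psi> s \<omega>)))\<^sup>2 \<partial>lborel) / 2) \<partial>M)"
    unfolding \<psi>_def[abs_def]
    by (rule BB.char_stochastic_integral[OF int assms(16) G_F \<psi>_G[unfolded \<psi>_def[abs_def]] N G_N indep fin[unfolded \<psi>_def[abs_def]]])
  then have char_I: "(\<integral>\<omega>. iexp (I \<omega> \<bullet> f) \<partial>M) = complex_of_real (\<integral>\<omega>. exp (- V \<omega> / 2) \<partial>M)"
    by (simp only: norm_\<psi> V_def)
  have "(\<integral>\<omega>. iexp (X t \<omega> \<bullet> f) \<partial>M) = (\<integral>\<omega>. iexp (S t X0 \<bullet> f) * iexp (I \<omega> \<bullet> f) \<partial>M)"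
  proof (rule integral_cong_AE)
    show "AE \<omega> in M. iexp (X t \<omega> \<bullet> f) = iexp (S t X0 \<bullet> f) * iexp (I \<omega> \<bullet> f)"
      using X_eq by eventually_elim (simp add: inner_add_left ring_distribs exp_add)
  qed (use X_meas I_meas in measurable)
  also have "\<dots> = iexp (S t X0 \<bullet> f) * complex_of_real (\<integral>\<omega>. exp (- V \<omega> / 2) \<partial>M)"
    by (simp add: char_I)
  finally have char_X: "(\<integral>\<omega>. iexp (X t \<omega> \<bullet> f) \<partial>M) = iexp (S t X0 \<bullet> f) * complex_of_real (\<integral>\<omega>. exp (- V \<omega> / 2) \<partial>M)" .

  let ?L = "restrict_space lborel {0..t}"
  let ?g = "\<lambda>\<omega> s. (norm (?R (Z s \<omega>)))\<^sup>2 *\<^sub>R (S (t - s) o\<^sub>L heston_variance Y s \<omega> o\<^sub>L adjoint_op (S (t - s)))"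
  \<comment> \<open>\<open>v\<close> is \<open>z\<close> without the cutoff, whose role is taken
    over by the restricted measure of the Bochner integral.\<close>
  define v where "v s \<omega> = norm (?R (Z s \<omega>)) *\<^sub>R S (t - s) (Y s \<omega>)" for s \<omega>
  have g: "?g \<omega> = (\<lambda>s. tensor (v s \<omega>) (v s \<omega>))" for \<omega>
    unfolding heston_variance_def v_def by (rule ext, rule scaled_conjugated_tensor)
  have z_v: "z s \<omega> = indicator {0..t} s *\<^sub>R v s \<omega>" for s \<omega> by (simp add: z_def v_def)
  have v_meas: "(\<lambda>s. v s \<omega>) \<in> borel_measurable ?L" if "\<omega> \<in> space M" for \<omega>
  proof -
    have "(\<lambda>s. z s \<omega>) \<in> borel_measurable lborel"
      using measurable_compose[OF measurable_Pair2'[OF that] z(1)] by simp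
    then show ?thesis unfolding z_v by (subst borel_measurable_restrict_space_iff) auto
  qed
  have nn: "(\<integral>\<^sup>+ s. ennreal ((norm (v s \<omega>))\<^sup>2) \<partial>?L) = (\<integral>\<^sup>+ s. ennreal ((norm (z s \<omega>))\<^sup>2) \<partial>lborel)" for \<omega>
    by (subst nn_integral_restrict_space) (auto intro!: nn_integral_cong simp: z_v indicator_def)
  have V_v: "(\<integral>s. (v s \<omega> \<bullet> f)\<^sup>2 \<partial>?L) = V \<omega>" for \<omega>
    unfolding V_def
    by (subst integral_restrict_space) (auto intro!: Bochner_Integration.integral_cong simp: z_v indicator_def)
  have z_nn_meas: "(\<lambda>\<omega>. \<integral>\<^sup>+ s. ennreal ((norm (z s \<omega>))\<^sup>2) \<partial>lborel) \<in> borel_measurable M"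
    and V_meas: "V \<in> borel_measurable M"
  proof -
    have "(\<lambda>p. z (snd p) (fst p)) \<in> borel_measurable (M \<Otimes>\<^sub>M lborel)"
      using measurable_compose[OF measurable_pair_swap' z(1)] by (simp add: case_prod_beta')
    then have "(\<lambda>p. ennreal ((norm (z (snd p) (fst p)))\<^sup>2)) \<in> borel_measurable (M \<Otimes>\<^sub>M lborel)"
      "(\<lambda>p. (z (snd p) (fst p) \<bullet> f)\<^sup>2) \<in> borel_measurable (M \<Otimes>\<^sub>M lborel)" by measurable
    then show "(\<lambda>\<omega>. \<integral>\<^sup>+ s. ennreal ((norm (z s \<omega>))\<^sup>2) \<partial>lborel) \<in> borel_measurable M" "V \<in> borel_measurable M"
      unfolding V_def[abs_def]
      by (intro lborel.borel_measurable_nn_integral lborel.borel_measurable_lebesgue_integral; simp add: case_prod_beta')+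
  qed
  have AE_fin: "AE \<omega> in M. (\<integral>\<^sup>+ s. ennreal ((norm (z s \<omega>))\<^sup>2) \<partial>lborel) < \<infinity>"
  proof -
    have "AE \<omega> in M. (\<integral>\<^sup>+ s. ennreal ((norm (z s \<omega>))\<^sup>2) \<partial>lborel) \<noteq> \<infinity>"
      using z(2) by (intro nn_integral_noteq_infinite z_nn_meas) auto
    then show ?thesis by eventually_elim (simp add: top.not_eq_extremum)
  qed
  have "AE \<omega> in M. strong_bochner_integrable ?L (?g \<omega>)"
    using AE_fin AE_space
  proof eventually_elim
    case (elim \<omega>)
    then show ?case
      unfolding g using strong_bochner_integrable_tensor_iff[OF v_meas[of \<omega>]] by (simp add: nn)
  qed
  moreover have "(\<integral>\<omega>. exp (- V \<omega> / 2) \<partial>M) = (\<integral>\<omega>. exp (- (1 / 2) * (strong_bochner_integral ?L (?g \<omega>) f \<bullet> f)) \<partial>M)"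
  proof -
    text \<open>\<open>M\<close> need not be complete, so the integrand on the right is described everywhere and
      not just almost everywhere, to know that it is measurable.\<close>
    have "(\<integral>\<omega>. exp (- (1 / 2) * (strong_bochner_integral ?L (?g \<omega>) f \<bullet> f)) \<partial>M) =
      (\<integral>\<omega>. exp (- (if (\<integral>\<^sup>+ s. ennreal ((norm (z s \<omega>))\<^sup>2) \<partial>lborel) < \<infinity> then V \<omega> else 0) / 2) \<partial>M)"
    proof (rule Bochner_Integration.integral_cong[OF refl])
      fix \<omega> assume "\<omega> \<in> space M"
      from strong_bochner_integral_tensor[OF v_meas[OF this], of f]
      show "exp (- (1 / 2) * (strong_bochner_integral ?L (?g \<omega>) f \<bullet> f)) =
        exp (- (if (\<integral>\<^sup>+ s. ennreal ((norm (z s \<omega>))\<^sup>2) \<partial>lborel) < \<infinity> then V \<omega> else 0) / 2)"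
        unfolding g nn V_v by simp
    qed
    also have "\<dots> = (\<integral>\<omega>. exp (- V \<omega> / 2) \<partial>M)"
    proof (rule integral_cong_AE)
      show "AE \<omega> in M. exp (- (if (\<integral>\<^sup>+ s. ennreal ((norm (z s \<omega>))\<^sup>2) \<partial>lborel) < \<infinity> then V \<omega> else 0) / 2) = exp (- V \<omega> / 2)"
        using AE_fin by eventually_elim simp
    qed (use z_nn_meas V_meas in measurable)
    finally show ?thesis by (rule sym)
  qed
  ultimately show ?thesis using char_X by (simp only:)
qed

end
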